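(* Let the bilevel program (BLPP) without upper level constraints be simple at $(\bar x,\bar y)\in M$, and let $J_0:=J_0(\bar x,\bar y)$. For $\bar u\in\mathbb{R}^p$, $w\in\mathbb{R}^m$, $\xi\in\mathbb{R}^p$ let $(\ast)$ denote the system $$0=\nabla_xF-[\nabla^2_{xy}(f+\bar u^Tg)]w+\nabla_x(\xi^Tg),\quad 0=\nabla_yF-[\nabla^2_{yy}(f+\bar u^Tg)]w+\nabla_y(\xi^Tg)\ \text{ at }(\bar x,\bar y),\quad \xi_i=0\ \forall i\notin J_0 .$$ For an index set $\mathcal J$ let $(E_{\mathcal J})$ denote the system, for $x$ in a neighborhood of $\bar x$, $$\nabla_yf(x,y(x))+\sum_{j\in\mathcal J}u_j(x)\nabla_yg_j(x,y(x))=0,\qquad g_j(x,y(x))=0\ \forall j\in\mathcal J .$$ For a curve $y(\cdot)$ with $y(\bar x)=\bar y$ write $\dot F[y]:=\nabla_xF(\bar x,\bar y)+\nabla_yF(\bar x,\bar y)\cdot D_xy(\bar x)$. Case I, Type 1 ($\bar u$ the unique KKT-multiplier). There exist $w,\xi$ satisfying $(\ast)$ and $\nabla_yg_j(\bar x,\bar y)^Tw=0$ for all $j\in J_0$, if and only if there exist $C^2$-mappings $y(x)$, $u_j(x)$, $j\in J_0$, with $y(\bar x)=\bar y$, $u(\bar x)=\bar u$, satisfying $(E_{J_0})$, such that $\dot F[y]=0$. Case I, Type 2 ($\bar u$ the unique KKT-multiplier, $q\in J_0$ the unique index with $\bar u_q=0$). There exist $w,\xi$ satisfying $(\ast)$,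 $\nabla_yg_j(\bar x,\bar y)^Tw=0$ for all $j\in J_0\setminus\{q\}$, $\nabla_yg_q(\bar x,\bar y)^Tw\le0$ and $\xi_q\ge0$, if and only if there exist $C^2$-mappings $\widetilde y(x)$, $\widetilde u_j(x)$, $j\in J_0\setminus\{q\}$, and $\widehat y(x)$, $\widehat u_j(x)$, $j\in J_0$, taking the values $\bar y$, $\bar u_j$ at $\bar x$ and satisfying $(E_{J_0\setminus\{q\}})$ and $(E_{J_0})$, respectively, such that $$\dot F[\widetilde y]\le0,\ \dot F[\widehat y]\ge0\ \text{ if }\ \tfrac{d}{dx}g_q(x,\widetilde y(x))|_{x=\bar x}>0;\qquad \dot F[\widetilde y]\ge0,\ \dot F[\widehat y]\le0\ \text{ if }\ \tfrac{d}{dx}g_q(x,\widetilde y(x))|_{x=\bar x}<0 .$$ Case I, Type 4 ($(0,\bar u)$ the unique FJ-multiplier). There exist $w,\xi$ satisfying $(\ast)$ with $f+\bar u^Tg$ replaced by $\bar u^Tg$, $\nabla_yf(\bar x,\bar y)^Tw\le0$ and $\nabla_yg_j(\bar x,\bar y)^Tw=0$ for all $j\in J_0$, if and only if there exist $C^2$-mappings $x(u_0),y(u_0),u_j(u_0)$, $j\in J_0$, with $x(0)=\bar x$, $y(0)=\bar y$, $u(0)=\bar u$, satisfying for $u_0$ in an open neighborhood of $\bar u_0=0$ $$u_0\nabla_yf(x(u_0),y(u_0))+\sum_{j\in J_0}u_j(u_0)\nabla_yg_j(x(u_0),y(u_0))=0,\quad u_0+\sum_{j\in J_0}u_j(u_0)=1,\quad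 g_j(x(u_0),y(u_0))=0\ \forall j\in J_0,$$ such that $\nabla_xF(\bar x,\bar y)D_{u_0}x(0)+\nabla_yF(\bar x,\bar y)\cdot D_{u_0}y(0)\ge0$. Case I, Type 5-1 ($\bar u$ the unique KKT-multiplier and $q\in J_0$ the index such that $\bar u_q=0$, $\bar u_j>0$ for $j\in J_0\setminus\{q\}$ and $M_{\rm KKT}(\bar x,\bar y)=\bar u+\mathbb{R}_+\bar\mu$ with $\bar\mu_j>0$ for $j\in J_0$). There exists $\xi\in\mathbb{R}^p$ with $0=\nabla F(\bar x,\bar y)+\nabla(\xi^Tg)(\bar x,\bar y)$, $\xi_i=0$ for all $i\notin J_0$ and $\xi_q\ge0$, if and only if there exist $C^2$-mappings $y^q(x)$, $u^q_j(x)$, $j\in J_0\setminus\{q\}$, taking the values $\bar y,\bar u_j$ at $\bar x$ and satisfying $(E_{J_0\setminus\{q\}})$, such that $\dot F[y^q]\le0$ if $\frac{d}{dx}g_q(x,y^q(x))|_{x=\bar x}>0$, and $\dot F[y^q]\ge0$ if $\frac{d}{dx}g_q(x,y^q(x))|_{x=\bar x}<0$. Case I, Type 5-2 ($q\neq r$ in $J_0$ the unique pair and $\bar u^1,\bar u^2\in M_{\rm KKT}(\bar x,\bar y)$ with $\bar u^1_q=0$, $\bar u^1_j>0$ for $j\in J_0\setminus\{q\}$, $\bar u^2_r=0$, $\bar u^2_j>0$ for $j\in J_0\setminus\{r\}$). The condition "for every $\bar u\in M_{\rm KKT}(\bar x,\bar y)$ there exists $\xi\in\mathbb{R}^p$ with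 $0=\nabla F(\bar x,\bar y)+\nabla(\xi^Tg)(\bar x,\bar y)$, $\xi_i=0$ for all $i\notin J_0$, $\xi_q\ge0$ if $\bar u=\bar u^1$, and $\xi_r\ge0$ if $\bar u=\bar u^2$" holds if and only if there exist $C^2$-mappings $y^q(x),u^q_j(x)$, $j\in J_0\setminus\{q\}$, and $y^r(x),u^r_j(x)$, $j\in J_0\setminus\{r\}$, with $y^q(\bar x)=y^r(\bar x)=\bar y$, $u^q(\bar x)=\bar u^1$, $u^r(\bar x)=\bar u^2$, satisfying $(E_{J_0\setminus\{q\}})$ and $(E_{J_0\setminus\{r\}})$, respectively, such that $$\dot F[y^q]\le0,\ \dot F[y^r]\ge0\ \text{ if }\gamma_q>0\ (\text{i.e. }\gamma_r<0);\qquad \dot F[y^q]\ge0,\ \dot F[y^r]\le0\ \text{ if }\gamma_q<0\ (\text{i.e. }\gamma_r>0),$$ where $\gamma_q:=\mathrm{sign}\big(\frac{d}{dx}g_q(x,y^q(x))|_{x=\bar x}\big)$ and $\gamma_r:=\mathrm{sign}\big(\frac{d}{dx}g_r(x,y^r(x))|_{x=\bar x}\big)$. Case II ($S(\bar x)=\{\bar y_1,\bar y_2\}$, $\bar y=\bar y_1$, $\bar u^k$ the unique KKT-multiplier at $\bar y_k$, $\bar u=\bar u^1$). There exist $\lambda^1,\lambda^2\ge0$ with $\lambda^1+\lambda^2=1$, $w\in\mathbb{R}^m$, $\xi\in\mathbb{R}^p$ and $\mu>0$ such that $$\begin{aligned} 0&=\nabla_xF(\bar x,\bar y)+\mu\sum_{k=1}^2\lambda^k\Big(\nabla_xf(\bar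 x,\bar y)-\nabla_xf(\bar x,\bar y_k)-\sum_{i=1}^p\bar u^k_i\nabla_xg_i(\bar x,\bar y_k)\Big)-[\nabla^2_{xy}(f+\bar u^Tg)(\bar x,\bar y)]w+\nabla_x(\xi^Tg)(\bar x,\bar y),\\ 0&=\nabla_yF(\bar x,\bar y)+\mu\nabla_yf(\bar x,\bar y)-[\nabla^2_{yy}(f+\bar u^Tg)(\bar x,\bar y)]w+\nabla_y(\xi^Tg)(\bar x,\bar y),\\ &\xi_i=0\ \forall i\notin J_0,\quad\nabla_yg_j(\bar x,\bar y)^Tw=0\ \forall j\in J_0, \end{aligned}$$ if and only if there exist $C^2$-mappings $y_k(x)$, $u^k_j(x)$, $j\in J_0(\bar x,\bar y_k)$, $k=1,2$, with $y_k(\bar x)=\bar y_k$, $u^k(\bar x)=\bar u^k$, satisfying $(E_{J_0(\bar x,\bar y_k)})$, such that $\dot F[y_1]\ge0$ if $\frac{d}{dx}[f(x,y_2(x))-f(x,y_1(x))]|_{x=\bar x}>0$, and $\dot F[y_1]\le0$ if $\frac{d}{dx}[f(x,y_2(x))-f(x,y_1(x))]|_{x=\bar x}<0$.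
   Context: Setting: $x\in\mathbb{R}$ (dimension $n=1$), $y\in\mathbb{R}^m$; $F:\mathbb{R}^{1+m}\to\mathbb{R}$ is continuously differentiable; $f:\mathbb{R}^{1+m}\to\mathbb{R}$ and $g:\mathbb{R}^{1+m}\to\mathbb{R}^p$ are three times continuously differentiable, and for all $(\hat x,c)\in\mathbb{R}\times\mathbb{R}$ the set $\{(x,y): |x-\hat x|\le1,\ f(x,y)\le c,\ g(x,y)\le0\}$ is compact. $L(x)$: $\min_yf(x,y)$ s.t. $g(x,y)\le0$; $S(x)$ its set of global minimizers; $M:=\{(x,y): y\in S(x)\}$. (BLPP): $\min_{x,y}F(x,y)$ s.t. $y\in S(x)$. $J_0(x,y):=\{j: g_j(x,y)=0\}$. For $w\in\mathbb{R}^m$, $[\nabla^2_{xy}h]w:=\sum_{i=1}^m\frac{\partial^2h}{\partial x\partial y_i}w_i$. Conditions of the form $u(\bar x)=\bar u$ refer to the components of $u$ that are present in the respective system. $M_{\rm KKT}(x,y):=\{u\in\mathbb{R}^p: \nabla_yf+\sum_iu_i\nabla_yg_i=0,\ u\ge0,\ u^Tg=0\text{ at }(x,y)\}$ (KKT-multipliers). FJ-multipliers at $(x,y)$: $(u_0,u)\ge0$ with $u_0\nabla_yf+\sum_iu_i\nabla_yg_i=0$, $\|(u_0,u)\|_1=1$, $u^Tg=0$ at $(x,y)$. The uniqueness and sign properties of the multipliers named in the claim are part of the structure of the respective type at points of $M$. Types of a point $(\bar x,\bar y)$, where $\bar y$ is feasible for $L(\bar x)$ and there is $(u_0,u)\neq0$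 with $u_0\nabla_yf+\sum_{j\in J_0}u_j\nabla_yg_j=0$ at $(\bar x,\bar y)$, $J_0=J_0(\bar x,\bar y)$. LICQ: $\nabla_yg_j(\bar x,\bar y)$, $j\in J_0$, are linearly independent (then there are unique $\bar u_j$, $j\in J_0$, with $\nabla_yf+\sum_{j\in J_0}\bar u_j\nabla_yg_j=0$; set $\bar u_j=0$ otherwise). $T:=\{\zeta\in\mathbb{R}^m:\nabla_yg_j(\bar x,\bar y)^T\zeta=0,\ j\in J_0\}$; for a symmetric matrix $H$ and subspace $W$, "$H$ nonsingular on $W$" means $B^THB$ nonsingular for a matrix $B$ whose columns form a basis of $W$. - Type 1: LICQ; $\bar u_j\ne0$ for $j\in J_0$ (SC); $\nabla^2_{yy}(f+\bar u^Tg)(\bar x,\bar y)$ nonsingular on $T$ (SOC). - Type 2: LICQ; exactly one $\bar u_q$, $q\in J_0$, vanishes; $\nabla^2_{yy}(f+\bar u^Tg)(\bar x,\bar y)$ is nonsingular on $T$ and on $\{\zeta:\nabla_yg_j^T\zeta=0,\ j\in J_0\setminus\{q\}\}$; and $\frac{d}{dx}g_q(x,\widetilde y(x))|_{x=\bar x}\neq0$, where $(\widetilde y,\widetilde u)$ is the $C^2$ solution near $\bar x$ of $\nabla_yf(x,y)+\sum_{j\in J_0\setminus\{q\}}u_j\nabla_yg_j(x,y)=0$, $g_j(x,y)=0$ ($j\in J_0\setminus\{q\}$), through $(\bar y,\bar u)$. - Type 4: $|J_0|\ge1$; $\{\nabla_yg_j(\bar x,\bar y)\}_{j\in J_0}$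 has rank $|J_0|-1<m$; the nonzero solution $\lambda$ (unique up to scaling) of $\sum_{j\in J_0}\lambda_j\nabla_yg_j=0$ has $\lambda_j\neq0$ for all $j\in J_0$; $\sum_{j\in J_0}\lambda_j\nabla_xg_j\neq0$; with $B$ a basis matrix of $T$, $A:=B^T\nabla^2_{yy}(\sum_{j\in J_0}\lambda_jg_j)B$ is nonsingular and $b:=B^T\nabla_yf$ satisfies $b^TA^{-1}b\ne0$ (all at $(\bar x,\bar y)$; in particular the KKT condition fails). - Type 5: $|J_0|=m+1$; the full gradients $\nabla g_j(\bar x,\bar y)$, $j\in J_0$, are linearly independent; any $m$ of the vectors $\nabla_yg_j(\bar x,\bar y)$, $j\in J_0$, are linearly independent; for each $i\in J_0$ the unique numbers $u^{(i)}_j$, $j\in J_0\setminus\{i\}$, with $\nabla_yf+\sum_{j\in J_0\setminus\{i\}}u^{(i)}_j\nabla_yg_j=0$ are all nonzero. It is Type 5-1 if MFCQ (existence of $d$ with $\nabla_yg_j^Td<0$ for all $j\in J_0$) fails but the KKT condition holds, and Type 5-2 if MFCQ holds. (BLPP) is simple at $(\bar x,\bar y)\in M$ if either Case I: $S(\bar x)=\{\bar y\}$ and $(\bar x,\bar y)$ is of Type 1, 2, 4, 5-1 or 5-2; or Case II: $S(\bar x)=\{\bar y_1,\bar y_2\}$ (two distinct points), $(\bar x,\bar y_1),(\bar x,\bar y_2)$ are both of Type 1, and $\frac{d}{dx}[f(x,y_2(x))-f(x,y_1(x))]|_{x=\bar x}\neq0$, where $y_k(x)$ is the unique local minimizer of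 $L(x)$ near $\bar y_k$ for $x$ near $\bar x$, $y_k(\bar x)=\bar y_k$. *)

theory Defs
  imports "HOL-Analysis.Analysis"
begin

section \<open>Differentiability notions\<close>

text \<open>
  \<open>Ck_on k h S\<close>: \<open>h\<close> is \<open>k\<close> times continuously differentiable on \<open>S\<close>. It is only used with open \<open>S\<close> and
  finite-dimensional domains, where continuity of all iterated directional derivatives is the same
  as continuity of the iterated Frechet derivatives.
\<close>

fun Ck_on :: "nat \<Rightarrow> ('a::real_normed_vector \<Rightarrow> 'b::real_normed_vector) \<Rightarrow> 'a set \<Rightarrow> bool" where
  "Ck_on 0 h S \<longleftrightarrow> continuous_on S h"
| "Ck_on (Suc k) h S \<longleftrightarrow>
     (\<forall>z\<in>S. h differentiable (at z)) \<and> (\<forall>v. Ck_on k (\<lambda>z. frechet_derivative h (at z) v) S)"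

text \<open>
  A point of \<open>\<real>\<^sup>1\<^sup>+\<^sup>m\<close> is a pair \<open>(x, y)\<close> with \<open>x\<close> real and \<open>y :: real^'m\<close>.
\<close>

definition nabla_x :: "(real \<times> (real^'m) \<Rightarrow> real) \<Rightarrow> real \<times> (real^'m) \<Rightarrow> real" where
  "nabla_x h z = frechet_derivative h (at z) (1, 0)"

definition nabla_y :: "(real \<times> (real^'m) \<Rightarrow> real) \<Rightarrow> real \<times> (real^'m) \<Rightarrow> real^'m" where
  "nabla_y h z = (\<chi> i. frechet_derivative h (at z) (0, axis i 1))"

definition nabla :: "(real \<times> (real^'m) \<Rightarrow> real) \<Rightarrow> real \<times> (real^'m) \<Rightarrow> real \<times> (real^'m)" where
  "nabla h z = (nabla_x h z, nabla_y h z)"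

definition hess_yy :: "(real \<times> (real^'m) \<Rightarrow> real) \<Rightarrow> real \<times> (real^'m) \<Rightarrow> real^'m^'m" where
  "hess_yy h z = (\<chi> i k. nabla_y (\<lambda>z'. nabla_y h z' $ k) z $ i)"

text \<open>The product \<open>[\<nabla>\<^sup>2\<^sub>x\<^sub>y h] w\<close> is \<open>hess_xy h z \<bullet> w\<close>.\<close>

definition hess_xy :: "(real \<times> (real^'m) \<Rightarrow> real) \<Rightarrow> real \<times> (real^'m) \<Rightarrow> real^'m" where
  "hess_xy h z = (\<chi> i. nabla_x (\<lambda>z'. nabla_y h z' $ i) z)"

abbreviation (input) constr :: "('a \<Rightarrow> real^'p) \<Rightarrow> 'p \<Rightarrow> 'a \<Rightarrow> real" where
  "constr g j \<equiv> (\<lambda>z. g z $ j)"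

abbreviation (input) lagr :: "('a \<Rightarrow> real) \<Rightarrow> ('a \<Rightarrow> real^'p) \<Rightarrow> real^'p \<Rightarrow> 'a \<Rightarrow> real" where
  "lagr f g u \<equiv> (\<lambda>z. f z + u \<bullet> g z)"

abbreviation (input) constr_comb :: "real^'p \<Rightarrow> ('a \<Rightarrow> real^'p) \<Rightarrow> 'a \<Rightarrow> real" where
  "constr_comb u g \<equiv> (\<lambda>z. u \<bullet> g z)"


section \<open>Linear algebra\<close>

definition lin_indep_family :: "('i \<Rightarrow> 'v::real_vector) \<Rightarrow> 'i set \<Rightarrow> bool" where
  "lin_indep_family v J \<longleftrightarrow> inj_on v J \<and> independent (v ` J)"

definition is_basis_of :: "'v::real_vector set \<Rightarrow> 'v set \<Rightarrow> bool" where
  "is_basis_of Bs W \<longleftrightarrow> independent Bs \<and> span Bs = W"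

text \<open>
  A basis matrix \<open>B\<close> has as many columns as the subspace has dimensions, which no index type can
  express. Its columns are therefore indexed by the basis vectors themselves: for a basis \<open>Bs\<close>, the
  matrix \<open>B\<^sup>T H B\<close> is the \<open>Bs \<times> Bs\<close> matrix with entries \<open>b \<bullet> (H *v b')\<close>, and \<open>B\<^sup>T v\<close> is the vector with
  entries \<open>b \<bullet> v\<close>. For an empty basis both are empty, and the empty matrix is invertible.
\<close>

definition compression :: "real^'m^'m \<Rightarrow> real^'m \<Rightarrow> real^'m \<Rightarrow> real" where
  "compression H b b' = b \<bullet> (H *v b')"

definition matrix_inverse_on :: "'i set \<Rightarrow> ('i \<Rightarrow> 'i \<Rightarrow> real) \<Rightarrow> ('i \<Rightarrow> 'i \<Rightarrow> real) \<Rightarrow> bool" where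
  "matrix_inverse_on I A C \<longleftrightarrow>
     (\<forall>i\<in>I. \<forall>k\<in>I. (\<Sum>j\<in>I. A i j * C j k) = (if i = k then 1 else 0)) \<and>
     (\<forall>i\<in>I. \<forall>k\<in>I. (\<Sum>j\<in>I. C i j * A j k) = (if i = k then 1 else 0))"

definition nonsingular_on :: "real^'m^'m \<Rightarrow> (real^'m) set \<Rightarrow> bool" where
  "nonsingular_on H W \<longleftrightarrow>
     (\<exists>Bs C. is_basis_of Bs W \<and> matrix_inverse_on Bs (compression H) C)"


section \<open>The lower level problem\<close>

definition feasible :: "(real \<times> (real^'m) \<Rightarrow> real^'p) \<Rightarrow> real \<Rightarrow> real^'m \<Rightarrow> bool" where
  "feasible g x y \<longleftrightarrow> (\<forall>j. g (x, y) $ j \<le> 0)"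

definition Sol ::
  "(real \<times> (real^'m) \<Rightarrow> real) \<Rightarrow> (real \<times> (real^'m) \<Rightarrow> real^'p) \<Rightarrow> real \<Rightarrow> (real^'m) set" where
  "Sol f g x = {y. is_arg_min (\<lambda>y. f (x, y)) (feasible g x) y}"

definition BLPP_M ::
  "(real \<times> (real^'m) \<Rightarrow> real) \<Rightarrow> (real \<times> (real^'m) \<Rightarrow> real^'p) \<Rightarrow> (real \<times> (real^'m)) set" where
  "BLPP_M f g = {(x, y). y \<in> Sol f g x}"

definition local_minimizer ::
  "(real \<times> (real^'m) \<Rightarrow> real) \<Rightarrow> (real \<times> (real^'m) \<Rightarrow> real^'p) \<Rightarrow> real \<Rightarrow> real^'m \<Rightarrow> bool" where
  "local_minimizer f g x y \<longleftrightarrow>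
     feasible g x y \<and>
     (\<exists>e>0. \<forall>y'. feasible g x y' \<and> dist y' y < e \<longrightarrow> f (x, y) \<le> f (x, y'))"

definition J0 :: "(real \<times> (real^'m) \<Rightarrow> real^'p) \<Rightarrow> real \<times> (real^'m) \<Rightarrow> 'p set" where
  "J0 g z = {j. g z $ j = 0}"

definition KKT_multipliers ::
  "(real \<times> (real^'m) \<Rightarrow> real) \<Rightarrow> (real \<times> (real^'m) \<Rightarrow> real^'p) \<Rightarrow> real \<times> (real^'m) \<Rightarrow> (real^'p) set" where
  "KKT_multipliers f g z =
     {u. nabla_y f z + (\<Sum>i\<in>UNIV. u $ i *\<^sub>R nabla_y (constr g i) z) = 0 \<and>
         (\<forall>i. u $ i \<ge> 0) \<and> u \<bullet> g z = 0}"

definition FJ_multipliers ::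
  "(real \<times> (real^'m) \<Rightarrow> real) \<Rightarrow> (real \<times> (real^'m) \<Rightarrow> real^'p) \<Rightarrow> real \<times> (real^'m) \<Rightarrow>
     (real \<times> (real^'p)) set" where
  "FJ_multipliers f g z =
     {(u0, u). u0 \<ge> 0 \<and> (\<forall>i. u $ i \<ge> 0) \<and>
         u0 *\<^sub>R nabla_y f z + (\<Sum>i\<in>UNIV. u $ i *\<^sub>R nabla_y (constr g i) z) = 0 \<and>
         \<bar>u0\<bar> + (\<Sum>i\<in>UNIV. \<bar>u $ i\<bar>) = 1 \<and> u \<bullet> g z = 0}"

definition LICQ :: "(real \<times> (real^'m) \<Rightarrow> real^'p) \<Rightarrow> real \<times> (real^'m) \<Rightarrow> bool" where
  "LICQ g z \<longleftrightarrow> lin_indep_family (\<lambda>j. nabla_y (constr g j) z) (J0 g z)"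

definition MFCQ :: "(real \<times> (real^'m) \<Rightarrow> real^'p) \<Rightarrow> real \<times> (real^'m) \<Rightarrow> bool" where
  "MFCQ g z \<longleftrightarrow> (\<exists>d. \<forall>j\<in>J0 g z. nabla_y (constr g j) z \<bullet> d < 0)"

definition tangent ::
  "(real \<times> (real^'m) \<Rightarrow> real^'p) \<Rightarrow> 'p set \<Rightarrow> real \<times> (real^'m) \<Rightarrow> (real^'m) set" where
  "tangent g J z = {\<zeta>. \<forall>j\<in>J. nabla_y (constr g j) z \<bullet> \<zeta> = 0}"


section \<open>Curves\<close>

text \<open>
  \<open>E_branch f g J xb yb ub y u\<close>: the curves \<open>y\<close> and \<open>u j\<close>, \<open>j \<in> J\<close>, are \<open>C\<^sup>2\<close> on an open neighbourhood of \<open>xb\<close>,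
  solve there the system \<open>(E\<^sub>J)\<close>, and pass through \<open>yb\<close> and \<open>ub $ j\<close>. Components of \<open>u\<close> and \<open>ub\<close> outside
  \<open>J\<close> are irrelevant.
\<close>

definition E_branch ::
  "(real \<times> (real^'m) \<Rightarrow> real) \<Rightarrow> (real \<times> (real^'m) \<Rightarrow> real^'p) \<Rightarrow> 'p set \<Rightarrow>
     real \<Rightarrow> real^'m \<Rightarrow> real^'p \<Rightarrow> (real \<Rightarrow> real^'m) \<Rightarrow> ('p \<Rightarrow> real \<Rightarrow> real) \<Rightarrow> bool" where
  "E_branch f g J xb yb ub y u \<longleftrightarrow>
     y xb = yb \<and> (\<forall>j\<in>J. u j xb = ub $ j) \<and>
     (\<exists>N. open N \<and> xb \<in> N \<and> Ck_on 2 y N \<and> (\<forall>j\<in>J. Ck_on 2 (u j) N) \<and>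
        (\<forall>x\<in>N.
           nabla_y f (x, y x) + (\<Sum>j\<in>J. u j x *\<^sub>R nabla_y (constr g j) (x, y x)) = 0 \<and>
           (\<forall>j\<in>J. g (x, y x) $ j = 0)))"

definition Fdot ::
  "(real \<times> (real^'m) \<Rightarrow> real) \<Rightarrow> real \<Rightarrow> real^'m \<Rightarrow> (real \<Rightarrow> real^'m) \<Rightarrow> real" where
  "Fdot F xb yb y =
     nabla_x F (xb, yb) + nabla_y F (xb, yb) \<bullet> vector_derivative y (at xb)"

definition gdot ::
  "(real \<times> (real^'m) \<Rightarrow> real^'p) \<Rightarrow> 'p \<Rightarrow> real \<Rightarrow> (real \<Rightarrow> real^'m) \<Rightarrow> real" where
  "gdot g q xb y = deriv (\<lambda>x. g (x, y x) $ q) xb"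

text \<open>
  The curves of Type 4, parametrised by the multiplier of the objective: the variable \<open>t\<close> plays the
  role of \<open>u\<^sub>0\<close>.
\<close>

definition FJ_branch ::
  "(real \<times> (real^'m) \<Rightarrow> real) \<Rightarrow> (real \<times> (real^'m) \<Rightarrow> real^'p) \<Rightarrow> 'p set \<Rightarrow>
     real \<Rightarrow> real^'m \<Rightarrow> real^'p \<Rightarrow>
     (real \<Rightarrow> real) \<Rightarrow> (real \<Rightarrow> real^'m) \<Rightarrow> ('p \<Rightarrow> real \<Rightarrow> real) \<Rightarrow> bool" where
  "FJ_branch f g J xb yb ub x y u \<longleftrightarrow>
     x 0 = xb \<and> y 0 = yb \<and> (\<forall>j\<in>J. u j 0 = ub $ j) \<and>
     (\<exists>N. open N \<and> 0 \<in> N \<and> Ck_on 2 x N \<and> Ck_on 2 y N \<and> (\<forall>j\<in>J. Ck_on 2 (u j) N) \<and>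
        (\<forall>t\<in>N.
           t *\<^sub>R nabla_y f (x t, y t)
             + (\<Sum>j\<in>J. u j t *\<^sub>R nabla_y (constr g j) (x t, y t)) = 0 \<and>
           t + (\<Sum>j\<in>J. u j t) = 1 \<and>
           (\<forall>j\<in>J. g (x t, y t) $ j = 0)))"


section \<open>Types of generalized critical points\<close>

definition gen_critical ::
  "(real \<times> (real^'m) \<Rightarrow> real) \<Rightarrow> (real \<times> (real^'m) \<Rightarrow> real^'p) \<Rightarrow> real \<Rightarrow> real^'m \<Rightarrow> bool" where
  "gen_critical f g x y \<longleftrightarrow>
     feasible g x y \<and>
     (\<exists>(u0::real) (u::'p \<Rightarrow> real).
        (u0 \<noteq> 0 \<or> (\<exists>j\<in>J0 g (x, y). u j \<noteq> 0)) \<and>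
        u0 *\<^sub>R nabla_y f (x, y)
          + (\<Sum>j\<in>J0 g (x, y). u j *\<^sub>R nabla_y (constr g j) (x, y)) = 0)"

text \<open>Under LICQ the vector \<open>u\<close> in the next definition is unique.\<close>

definition stationary_multiplier ::
  "(real \<times> (real^'m) \<Rightarrow> real) \<Rightarrow> (real \<times> (real^'m) \<Rightarrow> real^'p) \<Rightarrow> real \<times> (real^'m) \<Rightarrow> real^'p \<Rightarrow> bool" where
  "stationary_multiplier f g z u \<longleftrightarrow>
     (\<forall>j. j \<notin> J0 g z \<longrightarrow> u $ j = 0) \<and>
     nabla_y f z + (\<Sum>j\<in>J0 g z. u $ j *\<^sub>R nabla_y (constr g j) z) = 0"

definition type1 ::
  "(real \<times> (real^'m) \<Rightarrow> real) \<Rightarrow> (real \<times> (real^'m) \<Rightarrow> real^'p) \<Rightarrow> real \<Rightarrow> real^'m \<Rightarrow> bool" where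
  "type1 f g x y \<longleftrightarrow>
     gen_critical f g x y \<and> LICQ g (x, y) \<and>
     (\<exists>u. stationary_multiplier f g (x, y) u \<and>
        (\<forall>j\<in>J0 g (x, y). u $ j \<noteq> 0) \<and>
        nonsingular_on (hess_yy (lagr f g u) (x, y)) (tangent g (J0 g (x, y)) (x, y)))"

definition type2 ::
  "(real \<times> (real^'m) \<Rightarrow> real) \<Rightarrow> (real \<times> (real^'m) \<Rightarrow> real^'p) \<Rightarrow> real \<Rightarrow> real^'m \<Rightarrow> bool" where
  "type2 f g x y \<longleftrightarrow>
     gen_critical f g x y \<and> LICQ g (x, y) \<and>
     (\<exists>u q. stationary_multiplier f g (x, y) u \<and>
        {j \<in> J0 g (x, y). u $ j = 0} = {q} \<and>
        nonsingular_on (hess_yy (lagr f g u) (x, y)) (tangent g (J0 g (x, y)) (x, y)) \<and>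
        nonsingular_on (hess_yy (lagr f g u) (x, y)) (tangent g (J0 g (x, y) - {q}) (x, y)) \<and>
        (\<exists>yt ut. E_branch f g (J0 g (x, y) - {q}) x y u yt ut \<and> gdot g q x yt \<noteq> 0))"

text \<open>
  The rank condition makes the solution \<open>lam\<close> unique up to scaling, and all requirements on it are
  invariant under scaling. \<open>C\<close> is the matrix \<open>A\<inverse>\<close>, and the last double sum is \<open>b\<^sup>T A\<inverse> b\<close>.
\<close>

definition type4 ::
  "(real \<times> (real^'m) \<Rightarrow> real) \<Rightarrow> (real \<times> (real^'m) \<Rightarrow> real^'p) \<Rightarrow> real \<Rightarrow> real^'m \<Rightarrow> bool" where
  "type4 f g x y \<longleftrightarrow>
     (let z = (x, y); J = J0 g z in
        gen_critical f g x y \<and>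
        card J \<ge> 1 \<and>
        dim ((\<lambda>j. nabla_y (constr g j) z) ` J) = card J - 1 \<and> card J - 1 < CARD('m) \<and>
        (\<exists>lam::real^'p.
           (\<forall>j. j \<notin> J \<longrightarrow> lam $ j = 0) \<and>
           (\<Sum>j\<in>J. lam $ j *\<^sub>R nabla_y (constr g j) z) = 0 \<and>
           (\<forall>j\<in>J. lam $ j \<noteq> 0) \<and>
           (\<Sum>j\<in>J. lam $ j * nabla_x (constr g j) z) \<noteq> 0 \<and>
           (\<exists>Bs C.
              is_basis_of Bs (tangent g J z) \<and>
              matrix_inverse_on Bs (compression (hess_yy (constr_comb lam g) z)) C \<and>
              (\<Sum>b\<in>Bs. \<Sum>b'\<in>Bs. (b \<bullet> nabla_y f z) * C b b' * (b' \<bullet> nabla_y f z)) \<noteq> 0)))"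

text \<open>
  The numbers \<open>u j\<close> belonging to \<open>i\<close> are unique because any \<open>m\<close> of the gradients are independent.
\<close>

definition type5 ::
  "(real \<times> (real^'m) \<Rightarrow> real) \<Rightarrow> (real \<times> (real^'m) \<Rightarrow> real^'p) \<Rightarrow> real \<Rightarrow> real^'m \<Rightarrow> bool" where
  "type5 f g x y \<longleftrightarrow>
     (let z = (x, y); J = J0 g z in
        gen_critical f g x y \<and>
        card J = CARD('m) + 1 \<and>
        lin_indep_family (\<lambda>j. nabla (constr g j) z) J \<and>
        (\<forall>I. I \<subseteq> J \<and> card I = CARD('m) \<longrightarrow> lin_indep_family (\<lambda>j. nabla_y (constr g j) z) I) \<and>
        (\<forall>i\<in>J. \<exists>u::'p \<Rightarrow> real.
           nabla_y f z + (\<Sum>j\<in>J - {i}. u j *\<^sub>R nabla_y (constr g j) z) = 0 \<and>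
           (\<forall>j\<in>J - {i}. u j \<noteq> 0)))"

definition type5_1 ::
  "(real \<times> (real^'m) \<Rightarrow> real) \<Rightarrow> (real \<times> (real^'m) \<Rightarrow> real^'p) \<Rightarrow> real \<Rightarrow> real^'m \<Rightarrow> bool" where
  "type5_1 f g x y \<longleftrightarrow> type5 f g x y \<and> \<not> MFCQ g (x, y) \<and> KKT_multipliers f g (x, y) \<noteq> {}"

definition type5_2 ::
  "(real \<times> (real^'m) \<Rightarrow> real) \<Rightarrow> (real \<times> (real^'m) \<Rightarrow> real^'p) \<Rightarrow> real \<Rightarrow> real^'m \<Rightarrow> bool" where
  "type5_2 f g x y \<longleftrightarrow> type5 f g x y \<and> MFCQ g (x, y)"


section \<open>Simple bilevel problems\<close>

text \<open>
  \<open>y\<close> assigns to each \<open>x\<close> near \<open>xb\<close> the only local minimizer of \<open>L(x)\<close> in a fixed neighbourhood of \<open>yb\<close>.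
\<close>

definition local_minimizer_curve ::
  "(real \<times> (real^'m) \<Rightarrow> real) \<Rightarrow> (real \<times> (real^'m) \<Rightarrow> real^'p) \<Rightarrow> real \<Rightarrow> real^'m \<Rightarrow>
     (real \<Rightarrow> real^'m) \<Rightarrow> bool" where
  "local_minimizer_curve f g xb yb y \<longleftrightarrow>
     y xb = yb \<and>
     (\<exists>N U. open N \<and> xb \<in> N \<and> open U \<and> yb \<in> U \<and>
        (\<forall>x\<in>N. {v \<in> U. local_minimizer f g x v} = {y x}))"

definition case_II ::
  "(real \<times> (real^'m) \<Rightarrow> real) \<Rightarrow> (real \<times> (real^'m) \<Rightarrow> real^'p) \<Rightarrow> real \<Rightarrow>
     real^'m \<Rightarrow> real^'m \<Rightarrow> bool" where
  "case_II f g xb yb1 yb2 \<longleftrightarrow>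
     Sol f g xb = {yb1, yb2} \<and> yb1 \<noteq> yb2 \<and> type1 f g xb yb1 \<and> type1 f g xb yb2 \<and>
     (\<exists>y1 y2 D. local_minimizer_curve f g xb yb1 y1 \<and> local_minimizer_curve f g xb yb2 y2 \<and>
        ((\<lambda>x. f (x, y2 x) - f (x, y1 x)) has_real_derivative D) (at xb) \<and> D \<noteq> 0)"

definition simple_at ::
  "(real \<times> (real^'m) \<Rightarrow> real) \<Rightarrow> (real \<times> (real^'m) \<Rightarrow> real^'p) \<Rightarrow> real \<Rightarrow> real^'m \<Rightarrow> bool" where
  "simple_at f g xb yb \<longleftrightarrow>
     (xb, yb) \<in> BLPP_M f g \<and>
     (Sol f g xb = {yb} \<and>
        (type1 f g xb yb \<or> type2 f g xb yb \<or> type4 f g xb yb \<or> type5_1 f g xb yb \<or>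
         type5_2 f g xb yb) \<or>
      (\<exists>yb1 yb2. case_II f g xb yb1 yb2))"


section \<open>The dual systems and multiplier data\<close>

text \<open>
  System \<open>(\<ast>)\<close>, with \<open>h\<close> in place of \<open>f + u\<^sup>T g\<close>.
\<close>

definition star_system ::
  "(real \<times> (real^'m) \<Rightarrow> real) \<Rightarrow> (real \<times> (real^'m) \<Rightarrow> real^'p) \<Rightarrow> (real \<times> (real^'m) \<Rightarrow> real) \<Rightarrow>
     real \<times> (real^'m) \<Rightarrow> real^'m \<Rightarrow> real^'p \<Rightarrow> bool" where
  "star_system F g h z w xi \<longleftrightarrow>
     0 = nabla_x F z - hess_xy h z \<bullet> w + nabla_x (constr_comb xi g) z \<and>
     0 = nabla_y F z - hess_yy h z *v w + nabla_y (constr_comb xi g) z \<and>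
     (\<forall>i. i \<notin> J0 g z \<longrightarrow> xi $ i = 0)"

definition star5_system ::
  "(real \<times> (real^'m) \<Rightarrow> real) \<Rightarrow> (real \<times> (real^'m) \<Rightarrow> real^'p) \<Rightarrow>
     real \<times> (real^'m) \<Rightarrow> real^'p \<Rightarrow> bool" where
  "star5_system F g z xi \<longleftrightarrow>
     0 = nabla F z + nabla (constr_comb xi g) z \<and> (\<forall>i. i \<notin> J0 g z \<longrightarrow> xi $ i = 0)"

definition type5_1_data ::
  "(real \<times> (real^'m) \<Rightarrow> real) \<Rightarrow> (real \<times> (real^'m) \<Rightarrow> real^'p) \<Rightarrow> real \<times> (real^'m) \<Rightarrow>
     real^'p \<Rightarrow> 'p \<Rightarrow> bool" where
  "type5_1_data f g z u q \<longleftrightarrow>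
     q \<in> J0 g z \<and> u $ q = 0 \<and> (\<forall>j\<in>J0 g z - {q}. u $ j > 0) \<and>
     (\<exists>\<mu>. KKT_multipliers f g z = {u + t *\<^sub>R \<mu> | t. t \<ge> 0} \<and> (\<forall>j\<in>J0 g z. \<mu> $ j > 0))"

definition type5_2_data ::
  "(real \<times> (real^'m) \<Rightarrow> real) \<Rightarrow> (real \<times> (real^'m) \<Rightarrow> real^'p) \<Rightarrow> real \<times> (real^'m) \<Rightarrow>
     'p \<Rightarrow> 'p \<Rightarrow> real^'p \<Rightarrow> real^'p \<Rightarrow> bool" where
  "type5_2_data f g z q r u1 u2 \<longleftrightarrow>
     q \<in> J0 g z \<and> r \<in> J0 g z \<and> q \<noteq> r \<and>
     u1 \<in> KKT_multipliers f g z \<and> u2 \<in> KKT_multipliers f g z \<and>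
     u1 $ q = 0 \<and> (\<forall>j\<in>J0 g z - {q}. u1 $ j > 0) \<and>
     u2 $ r = 0 \<and> (\<forall>j\<in>J0 g z - {r}. u2 $ j > 0)"

end

theory Submission
  imports Defs
begin

text \<open>
  In every case a dual system is the adjoint of the linear system obtained by differentiating the curve
  equations at the base point. Pairing the two (lemma \<open>dual_identity\<close>) expresses the derivative of \<open>F\<close>
  along a curve through the residual of the \<open>x\<close>-equation and the sign-constrained dual
  quantities, so the equivalences reduce to existence of curves (an implicit function theorem with \<open>C\<^sup>2\<close>
  solutions), solvability of the dual system (nonsingularity on the tangent space), and signs.
  The multipliers come from a Fritz John theorem at local minimizers. Two signs need more: for
  Type 2 the derivative of \<open>u\<^sub>q\<close> along the curve with \<open>g\<^sub>q\<close> active has the sign of \<open>d/dx g\<^sub>q\<close> along the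
  other curve, by the second order necessary condition, and in Case II the curves of local minimizers
  have to be identified with the solution curves of \<open>(E\<^sub>J)\<close>.
\<close>

text \<open>The cases differ in which unknown is left over. Under the regularity of each type the
  y-equation of the dual system can always be solved, so the only real condition is that one scalar,
  the residual of the x-equation, vanishes. In Type 1 nothing is left over and the residual is the
  derivative of \<open>F\<close> itself. Type 2 and Case II have one more unknown, namely
  \<open>\<xi>\<^sub>q\<close> and the product of \<mu> with the second weight; it absorbs the
  residual, and the inequalities speak about its sign. In Type 4 the residual is absorbed by
  shifting \<xi> along the multiplier, and the sign sits in the product of the gradient of
  \<open>f\<close> with \<open>w\<close>. In Type 5 the tangent spaces are trivial, \<open>w\<close>
  disappears, and \<xi> is the coefficient vector of -\<nabla>F in the basis of full gradients. The
  claims quantify existentially over curves, so from right to left the sign must be read off an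
  arbitrary branch. This works because the differentiated system evaluates the derivative of
  \<open>F\<close> along whichever branch is given.\<close>

section \<open>Linear algebra\<close>

lemma lin_indep_family_mono:
  assumes "lin_indep_family v J" "I \<subseteq> J"
  shows "lin_indep_family v I"
  using assms unfolding lin_indep_family_def
  by (meson image_mono independent_mono inj_on_subset)

lemma lin_indep_family_coeff_0:
  assumes "lin_indep_family v J" "finite J" "(\<Sum>j\<in>J. c j *\<^sub>R v j) = 0" "j \<in> J"
  shows "c j = 0"
proof -
  have inj: "inj_on v J" and ind: "independent (v ` J)"
    using assms(1) by (auto simp: lin_indep_family_def)
  have "(\<Sum>a\<in>v ` J. c (the_inv_into J v a) *\<^sub>R a) = (\<Sum>j\<in>J. c j *\<^sub>R v j)"
    by (simp add: sum.reindex[OF inj] the_inv_into_f_f[OF inj])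
  then have "c (the_inv_into J v (v j)) = 0"
    using assms(3,4)
    by (intro independentD[OF ind finite_imageI[OF assms(2)] order_refl]) auto
  then show ?thesis
    using the_inv_into_f_f[OF inj assms(4)] by simp
qed

text \<open>Coefficients are attached to indices and not to vectors, because different constraints
  may have equal gradients.\<close>

lemma span_image_coeffs:
  assumes "finite J" "x \<in> span (v ` J)"
  obtains c where "x = (\<Sum>j\<in>J. c j *\<^sub>R v j)"
proof -
  have "\<exists>c. x = (\<Sum>j\<in>J. c j *\<^sub>R v j)"
    using assms(2)
  proof (induction rule: span_induct_alt)
    case base
    show ?case by (rule exI[of _ "\<lambda>_. 0"]) simp
  next
    case (step a x y)
    then obtain c i where c: "y = (\<Sum>j\<in>J. c j *\<^sub>R v j)" and i: "i \<in> J" "x = v i"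
      by auto
    have "a *\<^sub>R x + y = (\<Sum>j\<in>J. (c j + (if j = i then a else 0)) *\<^sub>R v j)"
      using i assms(1) by (simp add: c scaleR_left_distrib sum.distrib if_distrib[of "\<lambda>t. t *\<^sub>R _"] sum.delta cong: if_cong)
    then show ?case by (intro exI[of _ "\<lambda>j. c j + (if j = i then a else 0)"])
  qed
  then show ?thesis using that by blast
qed

text \<open>Split \<open>r\<close> into its part in \<open>span S\<close> and an orthogonal
  remainder \<open>n\<close>. The remainder is orthogonal to all of \<open>S\<close>, so the
  hypothesis makes \<open>r\<close> orthogonal to \<open>n\<close>, and hence \<open>n\<close>
  orthogonal to itself.\<close>

lemma in_span_if_orthogonal_complement:
  fixes r :: "'v::euclidean_space"
  assumes "\<And>\<zeta>. (\<And>a. a \<in> S \<Longrightarrow> a \<bullet> \<zeta> = 0) \<Longrightarrow> r \<bullet> \<zeta> = 0"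
  shows "r \<in> span S"
proof -
  obtain y n where y: "y \<in> span S" and n: "\<And>w. w \<in> span S \<Longrightarrow> orthogonal n w" and r: "r = y + n"
    using orthogonal_subspace_decomp_exists[of S r] by metis
  have "r \<bullet> n = 0"
    using assms n by (metis inner_commute orthogonal_def span_base)
  moreover have "y \<bullet> n = 0"
    using n[OF y] by (simp add: orthogonal_def inner_commute)
  ultimately have "n = 0"
    using r by (simp add: inner_add_left)
  then show ?thesis using r y by simp
qed

text \<open>If 0 were outside the convex hull of the vectors, a hyperplane would separate it
  strictly from this compact set, and minus the normal would have a negative product with every
  \<open>c j\<close>. So 0 is a convex combination.\<close>

lemma gordan_alternative:
  fixes c :: "'i \<Rightarrow> 'v::euclidean_space"
  assumes "finite J" "\<nexists>d. \<forall>j\<in>J. c j \<bullet> d < 0"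
  obtains \<mu> where "\<And>j. j \<in> J \<Longrightarrow> 0 \<le> \<mu> j" "sum \<mu> J = (1::real)" "(\<Sum>j\<in>J. \<mu> j *\<^sub>R c j) = 0"
proof -
  let ?S = "convex hull (c ` J)"
  have "0 \<in> ?S"
  proof (rule ccontr)
    assume "0 \<notin> ?S"
    moreover have "closed ?S"
      using assms(1) by (simp add: finite_imp_compact_convex_hull compact_imp_closed)
    ultimately obtain a b where ab: "0 < b" "\<forall>x\<in>?S. a \<bullet> x > b"
      using separating_hyperplane_closed_0[of ?S] by (auto simp: convex_convex_hull)
    have "c j \<bullet> (- a) < 0" if "j \<in> J" for j
      using ab hull_inc[of "c j" "c ` J" convex] that by (force simp: inner_commute)
    then show False using assms(2) by blast
  qed
  then obtain u where u: "\<forall>x\<in>c ` J. 0 \<le> u x" "sum u (c ` J) = 1" "(\<Sum>x\<in>c ` J. u x *\<^sub>R x) = 0"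
    using assms(1) by (auto simp: convex_hull_finite)
  \<comment> \<open>The hull yields weights on the set of vectors. \<open>r\<close> picks one index
    for each vector and the other indices get weight 0, since \<open>c\<close> need not be
    injective.\<close>
  define r where "r = inv_into J c"
  have r: "r x \<in> J" "c (r x) = x" if "x \<in> c ` J" for x
    using that by (auto simp: r_def inv_into_into f_inv_into_f)
  have inj: "inj_on r (c ` J)"
    by (metis inj_onI r(2))
  define \<mu> where "\<mu> j = (if j \<in> r ` c ` J then u (c j) else 0)" for j
  have sub: "r ` c ` J \<subseteq> J" using r by blast
  \<comment> \<open>\<open>h\<close> has an arbitrary target type, so one transfer serves both the
    sum of the weights and the weighted sum of the vectors.\<close>
  have \<mu>sum: "(\<Sum>j\<in>J. \<mu> j *\<^sub>R h (c j)) = (\<Sum>x\<in>c ` J. u x *\<^sub>R h x)" for h :: "'v \<Rightarrow> 'w::real_vector"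
  proof -
    have "(\<Sum>j\<in>J. \<mu> j *\<^sub>R h (c j)) = (\<Sum>j\<in>r ` c ` J. \<mu> j *\<^sub>R h (c j))"
      by (rule sum.mono_neutral_right) (use assms(1) sub in \<open>auto simp: \<mu>_def\<close>)
    also have "\<dots> = (\<Sum>x\<in>c ` J. u x *\<^sub>R h x)"
      unfolding sum.reindex[OF inj] by (rule sum.cong) (use r in \<open>auto simp: \<mu>_def\<close>)
    finally show ?thesis .
  qed
  show ?thesis
  proof
    show "0 \<le> \<mu> j" if "j \<in> J" for j
      using u(1) that by (auto simp: \<mu>_def)
    show "sum \<mu> J = 1"
      using \<mu>sum[of "\<lambda>_. 1::real"] u(2) by simp
    show "(\<Sum>j\<in>J. \<mu> j *\<^sub>R c j) = 0"
      using \<mu>sum[of "\<lambda>x. x"] u(3) by simp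
  qed
qed

section \<open>Compressed matrices and saddle point systems\<close>

lemma is_basis_of_coeffs:
  fixes W :: "'v::euclidean_space set"
  assumes "is_basis_of Bs W" "x \<in> W"
  obtains e where "x = (\<Sum>b\<in>Bs. e b *\<^sub>R b)"
proof -
  have fin: "finite Bs"
    using assms(1) by (auto simp: is_basis_of_def independent_imp_finite)
  have "x \<in> span ((\<lambda>b. b) ` Bs)"
    using assms by (auto simp: is_basis_of_def)
  from span_image_coeffs[OF fin this] show ?thesis using that by blast
qed

lemma inner_compression_sum:
  "(\<Sum>b\<in>Bs. e b *\<^sub>R b) \<bullet> (H *v b') = (\<Sum>b\<in>Bs. e b * compression H b b')"
  by (simp add: compression_def inner_sum_left)

text \<open>
  Differentiating the stationarity system along a curve produces the transpose of the Hessian, while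
  the dual systems contain the Hessian itself. Since the two operators below are adjoint to
  each other, the symmetry of the Hessian is never needed.
\<close>

lemma saddle_injective:
  assumes "nonsingular_on H W" "\<eta> \<in> W" "\<And>\<zeta>. \<zeta> \<in> W \<Longrightarrow> (\<eta> v* H) \<bullet> \<zeta> = 0"
  shows "\<eta> = 0"
proof -
  obtain Bs C where Bs: "is_basis_of Bs W" and C: "matrix_inverse_on Bs (compression H) C"
    using assms(1) by (auto simp: nonsingular_on_def)
  have fin: "finite Bs"
    using Bs by (auto simp: is_basis_of_def independent_imp_finite)
  obtain e where e: "\<eta> = (\<Sum>b\<in>Bs. e b *\<^sub>R b)"
    using is_basis_of_coeffs[OF Bs assms(2)] .
  have col: "(\<Sum>b\<in>Bs. e b * compression H b b') = 0" if "b' \<in> Bs" for b'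
  proof -
    have "b' \<in> W" using Bs that by (auto simp: is_basis_of_def span_base)
    then have "\<eta> \<bullet> (H *v b') = 0" using assms(3) by (simp add: dot_lmul_matrix)
    then show ?thesis by (simp add: e inner_compression_sum)
  qed
  have "e b = 0" if b: "b \<in> Bs" for b
  proof -
    \<comment> \<open>As a row vector, \<open>e\<close> annihilates the compressed matrix;
      multiplying by its inverse \<open>C\<close> on the right isolates \<open>e b\<close>.\<close>
    have "0 = (\<Sum>k\<in>Bs. (\<Sum>a\<in>Bs. e a * compression H a k) * C k b)"
      using col by simp
    also have "\<dots> = (\<Sum>a\<in>Bs. e a * (\<Sum>k\<in>Bs. compression H a k * C k b))"
      by (simp add: sum_distrib_left sum_distrib_right mult.assoc) (rule sum.swap)
    also have "\<dots> = (\<Sum>a\<in>Bs. e a * (if a = b then 1 else 0))"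
      using C b by (intro sum.cong) (auto simp: matrix_inverse_on_def)
    also have "\<dots> = e b"
      using fin b by (simp add: if_distrib sum.delta cong: if_cong)
    finally show ?thesis by simp
  qed
  then show ?thesis using e by simp
qed

text \<open>Solve the compressed equation for \<open>w\<close> inside the subspace. The defect H w -
  r is then orthogonal to the subspace, hence in the span of the \<open>a j\<close>, and its
  coefficients are the multipliers \<open>c\<close>.\<close>

lemma saddle_solvable:
  fixes a :: "'i \<Rightarrow> real^'m"
  assumes "nonsingular_on H {\<zeta>. \<forall>j\<in>J. a j \<bullet> \<zeta> = 0}" "finite J"
  obtains w c where "H *v w = r + (\<Sum>j\<in>J. c j *\<^sub>R a j)" "\<And>j. j \<in> J \<Longrightarrow> a j \<bullet> w = 0"
proof -
  let ?W = "{\<zeta>. \<forall>j\<in>J. a j \<bullet> \<zeta> = 0}"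
  obtain Bs C where Bs: "is_basis_of Bs ?W" and C: "matrix_inverse_on Bs (compression H) C"
    using assms(1) by (auto simp: nonsingular_on_def)
  have fin: "finite Bs"
    using Bs by (auto simp: is_basis_of_def independent_imp_finite)
  \<comment> \<open>These are the entries of \<open>C\<close> applied to the compressed right-hand
    side.\<close>
  define e where "e b = (\<Sum>k\<in>Bs. C b k * (k \<bullet> r))" for b
  define w where "w = (\<Sum>b\<in>Bs. e b *\<^sub>R b)"
  have "w \<in> span Bs"
    unfolding w_def by (intro span_sum span_scale span_base)
  then have wW: "w \<in> ?W"
    using Bs by (simp add: is_basis_of_def)
  have basis: "b \<bullet> (H *v w) = b \<bullet> r" if b: "b \<in> Bs" for b
  proof -
    have "H *v w = (\<Sum>k\<in>Bs. e k *\<^sub>R (H *v k))"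
      unfolding w_def by (simp add: linear_sum[OF matrix_vector_mul_linear] matrix_vector_mult_scaleR)
    then have "b \<bullet> (H *v w) = (\<Sum>k\<in>Bs. e k * compression H b k)"
      by (simp add: inner_sum_right compression_def)
    also have "\<dots> = (\<Sum>k\<in>Bs. \<Sum>l\<in>Bs. compression H b k * C k l * (l \<bullet> r))"
      by (simp add: e_def sum_distrib_right sum_distrib_left mult_ac)
    also have "\<dots> = (\<Sum>l\<in>Bs. (\<Sum>k\<in>Bs. compression H b k * C k l) * (l \<bullet> r))"
      by (subst sum.swap) (simp add: sum_distrib_right)
    also have "\<dots> = (\<Sum>l\<in>Bs. (if b = l then 1 else 0) * (l \<bullet> r))"
      using C b by (intro sum.cong) (auto simp: matrix_inverse_on_def)
    also have "\<dots> = b \<bullet> r"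
      using fin b by (simp add: if_distrib[of "\<lambda>t. t * _"] sum.delta cong: if_cong)
    finally show ?thesis .
  qed
  have "H *v w - r \<in> span (a ` J)"
  proof (rule in_span_if_orthogonal_complement)
    fix \<zeta> assume "\<And>v. v \<in> a ` J \<Longrightarrow> v \<bullet> \<zeta> = 0"
    then have "\<zeta> \<in> ?W" by auto
    then obtain d where d: "\<zeta> = (\<Sum>b\<in>Bs. d b *\<^sub>R b)"
      using is_basis_of_coeffs[OF Bs] by blast
    show "(H *v w - r) \<bullet> \<zeta> = 0"
      using basis by (subst inner_commute) (simp add: d inner_sum_left inner_diff_right)
  qed
  then obtain c where "H *v w - r = (\<Sum>j\<in>J. c j *\<^sub>R a j)"
    using span_image_coeffs[OF assms(2)] by blast
  then show ?thesis
    using that[of w c] wW by (simp add: algebra_simps)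
qed

text \<open>The empty basis works. This is the situation of Type 5, where m independent gradients
  leave no tangent direction.\<close>

lemma nonsingular_on_zero: "nonsingular_on H {0}"
  unfolding nonsingular_on_def is_basis_of_def matrix_inverse_on_def
  by (rule exI[of _ "{}"]) (simp add: independent_empty)

text \<open>
  The identity behind all equivalences. The first bracket is the residual of the
  \<open>x\<close>-equation of a dual system whose \<open>y\<close>-equation is the assumption; the other terms
  are evaluated by the differentiated primal system.
\<close>

lemma dual_identity:
  fixes c :: "'i \<Rightarrow> real" and n :: "'i \<Rightarrow> real^'m"
  assumes "b = H *v w - (\<Sum>j\<in>J. c j *\<^sub>R n j)"
  shows "a + b \<bullet> y' = (a - h \<bullet> w + (\<Sum>j\<in>J. c j * k j)) + w \<bullet> (h + y' v* H)
           - (\<Sum>j\<in>J. c j * (k j + n j \<bullet> y'))"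
proof -
  have "b \<bullet> y' = w \<bullet> (y' v* H) - (\<Sum>j\<in>J. c j * (n j \<bullet> y'))"
    unfolding assms
    by (simp add: inner_diff_left inner_sum_left inner_commute[of w] dot_lmul_matrix)
       (simp add: inner_commute)
  then show ?thesis
    by (simp add: inner_add_right distrib_left sum.distrib inner_commute[of h])
qed

section \<open>Closure rules for C^k maps\<close>

section \<open>Continuously differentiable maps\<close>

lemma frechet_derivativeI: "(h has_derivative h') (at z) \<Longrightarrow> frechet_derivative h (at z) = h'"
  by (metis frechet_derivative_at)

lemma Ck_on_cong:
  assumes "open S" "\<And>z. z \<in> S \<Longrightarrow> h z = h' z" "Ck_on k h S"
  shows "Ck_on k h' S"
  using assms(2,3)
proof (induction k arbitrary: h h')
  case 0
  then show ?case by (simp cong: continuous_on_cong)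
next
  case (Suc k)
  have D: "(h' has_derivative frechet_derivative h (at z)) (at z)" if z: "z \<in> S" for z
    using Suc.prems z assms(1)
    by (auto intro: has_derivative_transform_within_open[where f = h] simp: frechet_derivative_works)
  have "Ck_on k (\<lambda>z. frechet_derivative h' (at z) v) S" for v
  proof (rule Suc.IH)
    show "Ck_on k (\<lambda>z. frechet_derivative h (at z) v) S" using Suc.prems by simp
    show "frechet_derivative h (at z) v = frechet_derivative h' (at z) v" if "z \<in> S" for z
      using frechet_derivativeI[OF D[OF that]] by simp
  qed
  then show ?case using D by (auto simp: differentiable_def)
qed

lemma Ck_on_differentiable:
  "Ck_on (Suc k) h S \<Longrightarrow> z \<in> S \<Longrightarrow> (h has_derivative frechet_derivative h (at z)) (at z)"
  by (simp add: frechet_derivative_works)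

lemma Ck_on_Suc_imp: "Ck_on (Suc k) h S \<Longrightarrow> Ck_on k h S"
proof (induction k arbitrary: h)
  case 0
  then show ?case
    using Ck_on_differentiable has_derivative_continuous continuous_at_imp_continuous_on
    by (metis Ck_on.simps(1))
next
  case (Suc k)
  then show ?case by (metis Ck_on.simps(2))
qed

lemma Ck_on_const: "Ck_on k (\<lambda>_. c) S"
proof (induction k arbitrary: c)
  case (Suc k)
  then show ?case by simp
qed simp

text \<open>The derivative in direction \<open>v\<close> is the derivative of \<open>h\<close> in
  direction \<open>A v\<close>, again composed with \<open>A\<close>, so the induction closes. The
  systems below read their arguments through linear projections, so this case of the chain rule
  carries their smoothness.\<close>

lemma Ck_on_compose_linear:
  assumes "bounded_linear A" "Ck_on k h UNIV"
  shows "Ck_on k (\<lambda>w. h (A w)) UNIV"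
  using assms(2)
proof (induction k arbitrary: h)
  case 0
  then show ?case
    using linear_continuous_on[OF assms(1)] by (auto intro: continuous_on_compose2)
next
  case (Suc k)
  have D: "((\<lambda>w. h (A w)) has_derivative (\<lambda>v. frechet_derivative h (at (A z)) (A v))) (at z)" for z
    using Ck_on_differentiable[OF Suc.prems UNIV_I, of "A z"]
    by (rule has_derivative_compose[OF bounded_linear_imp_has_derivative[OF assms(1)]])
  have "Ck_on k (\<lambda>w. frechet_derivative h (at (A w)) (A v)) UNIV" for v
    using Suc.prems by (intro Suc.IH) simp
  then show ?case
    using D by (auto simp: frechet_derivativeI[OF D] differentiable_def)
qed

lemma Ck_on_linear_compose:
  assumes "bounded_linear B" "open S" "Ck_on k h S"
  shows "Ck_on k (\<lambda>w. B (h w)) S"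
  using assms(3)
proof (induction k arbitrary: h)
  case 0
  then show ?case
    using linear_continuous_on[OF assms(1)] by (auto intro: continuous_on_compose2)
next
  case (Suc k)
  have D: "((\<lambda>w. B (h w)) has_derivative (\<lambda>v. B (frechet_derivative h (at z) v))) (at z)"
    if "z \<in> S" for z
    by (intro bounded_linear.has_derivative[OF assms(1)] Ck_on_differentiable[OF Suc.prems that])
  have "Ck_on k (\<lambda>w. frechet_derivative (\<lambda>w. B (h w)) (at w) v) S" for v
  proof (rule Ck_on_cong[OF assms(2)])
    show "Ck_on k (\<lambda>w. B (frechet_derivative h (at w) v)) S"
      using Suc.prems by (intro Suc.IH) simp
  qed (simp add: frechet_derivativeI[OF D])
  then show ?case using D by (auto simp: differentiable_def)
qed

lemma Ck_on_add_open:
  assumes "open S" "Ck_on k h S" "Ck_on k h' S"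
  shows "Ck_on k (\<lambda>w. h w + h' w) S"
  using assms(2,3)
proof (induction k arbitrary: h h')
  case 0
  then show ?case by (simp add: continuous_on_add)
next
  case (Suc k)
  have D: "((\<lambda>w. h w + h' w) has_derivative
      (\<lambda>v. frechet_derivative h (at z) v + frechet_derivative h' (at z) v)) (at z)" if "z \<in> S" for z
    using Suc.prems that by (intro has_derivative_add Ck_on_differentiable) auto
  have "Ck_on k (\<lambda>w. frechet_derivative (\<lambda>w. h w + h' w) (at w) v) S" for v
  proof (rule Ck_on_cong[OF assms(1)])
    show "Ck_on k (\<lambda>w. frechet_derivative h (at w) v + frechet_derivative h' (at w) v) S"
      using Suc.prems by (intro Suc.IH) simp_all
  qed (simp add: frechet_derivativeI[OF D])
  then show ?case using D by (auto simp: differentiable_def)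
qed

lemmas Ck_on_add = Ck_on_add_open[OF open_UNIV]

lemma Ck_on_sum:
  "(\<And>i. i \<in> I \<Longrightarrow> Ck_on k (h i) UNIV) \<Longrightarrow> Ck_on k (\<lambda>w. \<Sum>i\<in>I. h i w) UNIV"
  by (induction I rule: infinite_finite_induct) (simp_all add: Ck_on_const Ck_on_add)

text \<open>The product rule mixes first derivatives with the factors themselves, which is why
  \<open>Ck_on_Suc_imp\<close> has to lower the factors by one order inside the induction.\<close>

lemma Ck_on_scaleR:
  assumes "Ck_on k c UNIV" "Ck_on k h UNIV"
  shows "Ck_on k (\<lambda>w. c w *\<^sub>R h w) UNIV"
  using assms
proof (induction k arbitrary: c h)
  case 0
  then show ?case by (simp add: continuous_on_scaleR)
next
  case (Suc k)
  have D: "((\<lambda>w. c w *\<^sub>R h w) has_derivative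
      (\<lambda>v. c z *\<^sub>R frechet_derivative h (at z) v + frechet_derivative c (at z) v *\<^sub>R h z)) (at z)" for z
    using Suc.prems by (intro has_derivative_scaleR Ck_on_differentiable) auto
  have "Ck_on k (\<lambda>w. c w *\<^sub>R frechet_derivative h (at w) v + frechet_derivative c (at w) v *\<^sub>R h w) UNIV" for v
    using Suc.prems Suc.prems[THEN Ck_on_Suc_imp] by (intro Ck_on_add Suc.IH) simp_all
  then show ?case
    using D by (auto simp: frechet_derivativeI[OF D] differentiable_def)
qed

lemma bounded_linear_Pair_left: "bounded_linear (\<lambda>a. (a, 0))"
  and bounded_linear_Pair_right: "bounded_linear (\<lambda>b. (0, b))"
  by (auto intro: bounded_linear_Pair bounded_linear_ident bounded_linear_zero)

text \<open>A pair is the sum of its two linear embeddings.\<close>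

lemma Ck_on_Pair_open:
  assumes "open S" "Ck_on k h S" "Ck_on k h' S"
  shows "Ck_on k (\<lambda>w. (h w, h' w)) S"
  using Ck_on_add_open[OF assms(1) Ck_on_linear_compose[OF bounded_linear_Pair_left assms(1,2)]
      Ck_on_linear_compose[OF bounded_linear_Pair_right assms(1,3)]]
  by simp

lemmas Ck_on_Pair = Ck_on_Pair_open[OF open_UNIV]

lemma Ck_on_linear: "bounded_linear A \<Longrightarrow> Ck_on k A UNIV"
proof (induction k)
  case 0
  then show ?case by (simp add: linear_continuous_on)
next
  case (Suc k)
  have D: "(A has_derivative A) (at z)" for z
    by (rule bounded_linear_imp_has_derivative[OF Suc.prems])
  then show ?case
    by (auto simp: frechet_derivativeI[OF D] differentiable_def Ck_on_const)
qed

lemma Ck_on_vec: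
  fixes h :: "'i::finite \<Rightarrow> 'a::real_normed_vector \<Rightarrow> real"
  assumes "\<And>i. Ck_on k (h i) UNIV"
  shows "Ck_on k (\<lambda>w. \<chi> i. h i w) UNIV"
proof -
  have "(\<lambda>w. \<chi> i. h i w) = (\<lambda>w. \<Sum>i\<in>UNIV. h i w *\<^sub>R axis i (1::real))"
    by (auto simp: vec_eq_iff axis_def if_distrib sum.delta cong: if_cong)
  then show ?thesis
    using assms by (auto intro!: Ck_on_sum Ck_on_scaleR Ck_on_const)
qed

lemma frechet_derivative_curve: "(y has_vector_derivative a) (at t) \<Longrightarrow> frechet_derivative y (at t) v = v *\<^sub>R a"
  by (simp add: has_vector_derivative_def frechet_derivativeI)

text \<open>On the line every directional derivative is a multiple of the velocity, so
  \<open>Ck_on\<close> can be checked on ordinary vector derivatives.\<close>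

lemma Ck_on_1_curveI:
  fixes y :: "real \<Rightarrow> 'a::real_normed_vector"
  assumes "open N" "\<And>t. t \<in> N \<Longrightarrow> (y has_vector_derivative y' t) (at t)" "continuous_on N y'"
  shows "Ck_on 1 y N"
proof -
  have "Ck_on 0 (\<lambda>t. frechet_derivative y (at t) v) N" for v
    by (rule Ck_on_cong[OF assms(1), of "\<lambda>t. v *\<^sub>R y' t"])
       (use assms in \<open>auto simp: frechet_derivative_curve[OF assms(2)] intro: continuous_intros\<close>)
  moreover have "\<forall>t\<in>N. y differentiable (at t)"
    using assms(2) by (auto simp: has_vector_derivative_def differentiable_def)
  ultimately show ?thesis by (simp add: One_nat_def)
qed

lemma Ck_on_2_curveI:
  fixes y :: "real \<Rightarrow> 'a::real_normed_vector"
  assumes "open N" "\<And>t. t \<in> N \<Longrightarrow> (y has_vector_derivative y' t) (at t)"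
    "\<And>t. t \<in> N \<Longrightarrow> (y' has_vector_derivative y'' t) (at t)" "continuous_on N y''"
  shows "Ck_on 2 y N"
proof -
  have "Ck_on 1 (\<lambda>t. frechet_derivative y (at t) v) N" for v
  proof (rule Ck_on_cong[OF assms(1)])
    show "Ck_on 1 (\<lambda>t. v *\<^sub>R y' t) N"
      by (rule Ck_on_1_curveI[OF assms(1), of _ "\<lambda>t. v *\<^sub>R y'' t"])
         (use assms in \<open>auto simp: has_vector_derivative_def intro!: derivative_eq_intros continuous_intros\<close>)
  qed (simp add: frechet_derivative_curve[OF assms(2)])
  moreover have "\<forall>t\<in>N. y differentiable (at t)"
    using assms(2) by (auto simp: has_vector_derivative_def differentiable_def)
  ultimately show ?thesis by (simp add: numeral_2_eq_2)
qed

lemma Ck_on_curve_derivative: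
  fixes y :: "real \<Rightarrow> 'a::real_normed_vector"
  assumes "Ck_on (Suc k) y N" "t \<in> N"
  shows "(y has_vector_derivative vector_derivative y (at t)) (at t)"
  using assms by (simp add: vector_derivative_works)

section \<open>An implicit function theorem with C^2 solution curves\<close>

section \<open>Implicit curves\<close>

text \<open>A left inverse is bounded, and the reciprocal of its bound is the constant.\<close>

lemma linear_injective_bounded_below:
  fixes A :: "'a::euclidean_space \<Rightarrow> 'b::euclidean_space"
  assumes "linear A" "\<And>v. A v = 0 \<Longrightarrow> v = 0"
  obtains c where "c > 0" "\<And>v. c * norm v \<le> norm (A v)"
proof -
  have "inj A" using assms linear_injective_0 by blast
  then obtain A' where A': "linear A'" "A' \<circ> A = id"
    using linear_injective_left_inverse[OF assms(1)] by blast
  obtain B where B: "B > 0" "\<And>x. norm (A' x) \<le> B * norm x"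
    using linear_bounded_pos[OF A'(1)] by blast
  have "1 / B * norm v \<le> norm (A v)" for v
  proof -
    have "norm v = norm (A' (A v))" using A'(2) by (metis comp_apply id_apply)
    also have "\<dots> \<le> B * norm (A v)" by (rule B)
    finally show ?thesis using B(1) by (simp add: field_simps)
  qed
  then show ?thesis using that[of "1 / B"] B(1) by simp
qed

text \<open>This makes the velocity of an implicit curve continuous. The lower bound
  \<open>c\<close> of the matrix at \<open>s\<close> survives nearby as \<open>c / 2\<close>, so the
  change of the solution is at most 2 / c times the defect of the old solution \<open>x s\<close> in
  the new system.\<close>

lemma continuous_on_linear_solution:
  fixes A :: "'t::metric_space \<Rightarrow> 'a::euclidean_space \<Rightarrow>\<^sub>L 'b::euclidean_space"
  assumes A: "continuous_on N A" and b: "continuous_on N b"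
    and sol: "\<And>t. t \<in> N \<Longrightarrow> A t (x t) = b t"
    and inj: "\<And>t v. t \<in> N \<Longrightarrow> A t v = 0 \<Longrightarrow> v = 0"
  shows "continuous_on N x"
  unfolding continuous_on_def
proof
  fix s assume s: "s \<in> N"
  let ?F = "at s within N"
  obtain c where c: "c > 0" "\<And>v. c * norm v \<le> norm (A s v)"
    using linear_injective_bounded_below[of "blinfun_apply (A s)"] inj[OF s]
    by (metis blinfun.bounded_linear_right bounded_linear.linear)
  have At: "(A \<longlongrightarrow> A s) ?F" and bt: "(b \<longlongrightarrow> b s) ?F"
    using A b s by (auto simp: continuous_on_def)
  have "((\<lambda>t. 2 / c * norm (b t - A t (x s))) \<longlongrightarrow> 2 / c * norm (b s - A s (x s))) ?F"
    by (intro tendsto_intros At bt)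
  then have lim: "((\<lambda>t. 2 / c * norm (b t - A t (x s))) \<longlongrightarrow> 0) ?F"
    using sol[OF s] by simp
  have ev: "\<forall>\<^sub>F t in ?F. norm (x t - x s) \<le> 2 / c * norm (b t - A t (x s))"
  proof -
    have "\<forall>\<^sub>F t in ?F. dist (A t) (A s) < c / 2"
      using At c(1) by (intro tendstoD) auto
    moreover have "\<forall>\<^sub>F t in ?F. t \<in> N" by (simp add: eventually_at_filter)
    ultimately show ?thesis
    proof eventually_elim
      case (elim t)
      let ?v = "x t - x s"
      have "c * norm ?v \<le> norm (A t ?v - (A t - A s) ?v)"
        using c(2)[of ?v] by (simp add: blinfun.diff_left)
      also have "\<dots> \<le> norm (A t ?v) + norm (A t - A s) * norm ?v"
        by (intro order_trans[OF norm_triangle_ineq4] add_left_mono norm_blinfun)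
      also have "\<dots> \<le> norm (A t ?v) + c / 2 * norm ?v"
        using elim(1) by (intro add_left_mono mult_right_mono) (auto simp: dist_norm)
      finally have "norm ?v \<le> 2 / c * norm (A t ?v)"
        using c(1) by (simp add: field_simps)
      then show ?case
        using sol[OF elim(2)] by (simp add: blinfun.diff_right)
    qed
  qed
  have "((\<lambda>t. x t - x s) \<longlongrightarrow> 0) ?F"
    by (rule Lim_null_comparison[OF ev lim])
  then show "(x \<longlongrightarrow> x s) ?F"
    by (simp add: LIM_zero_cancel)
qed

lemma implicit_curve_derivative:
  fixes y :: "real \<Rightarrow> 'a::real_normed_vector" and G :: "real \<times> 'a \<Rightarrow> 'b::real_normed_vector"
  assumes "open N" "t \<in> N" "\<And>s. s \<in> N \<Longrightarrow> G (s, y s) = 0"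
    and y': "(y has_vector_derivative y') (at t)" and G': "(G has_derivative G') (at (t, y t))"
  shows "G' (1, y') = 0"
proof -
  have "((\<lambda>s. (s, y s)) has_derivative (\<lambda>h. (h, h *\<^sub>R y'))) (at t)"
    using y' unfolding has_vector_derivative_def by (intro has_derivative_Pair has_derivative_ident)
  from has_derivative_compose[OF this G']
  have "((\<lambda>s. 0) has_derivative (\<lambda>h. G' (h, h *\<^sub>R y'))) (at t)"
    by (rule has_derivative_transform_within_open[OF _ assms(1,2)]) (rule assms(3))
  then have "(\<lambda>h. G' (h, h *\<^sub>R y')) = (\<lambda>h. 0)"
    by (rule has_derivative_unique) (rule has_derivative_const)
  from fun_cong[OF this, of 1] show ?thesis by simp
qed

text \<open>The next lemma is the inverse function theorem applied to \<open>(t, z) \<mapsto> (t, G (t, z))\<close>.\<close>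

lemma implicit_curve_C1:
  fixes G :: "real \<times> 'a::euclidean_space \<Rightarrow> 'a"
  assumes G: "Ck_on 1 G UNIV" and G0: "G (t0, z0) = 0"
    and inj: "\<And>v. frechet_derivative G (at (t0, z0)) (0, v) = 0 \<Longrightarrow> v = 0"
  obtains y y' N W where "open N" "t0 \<in> N" "open W" "(t0, z0) \<in> W"
    "\<And>t. t \<in> N \<Longrightarrow> (t, y t) \<in> W \<and> G (t, y t) = 0"
    "\<And>t z. (t, z) \<in> W \<Longrightarrow> G (t, z) = 0 \<Longrightarrow> t \<in> N \<and> z = y t"
    "\<And>t. t \<in> N \<Longrightarrow> (y has_vector_derivative y' t) (at t)"
    "continuous_on N y'"
    "\<And>t v. t \<in> N \<Longrightarrow> frechet_derivative G (at (t, y t)) (0, v) = 0 \<Longrightarrow> v = 0"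
proof -
  define D where "D w = Blinfun (frechet_derivative G (at w))" for w
  have D: "(G has_derivative blinfun_apply (D w)) (at w)" for w
  proof -
    have "(G has_derivative frechet_derivative G (at w)) (at w)"
      using G by (intro Ck_on_differentiable[of 0, OF _ UNIV_I]) (simp only: One_nat_def)
    then show ?thesis
      by (simp add: D_def bounded_linear_Blinfun_apply has_derivative_bounded_linear)
  qed
  have FD: "frechet_derivative G (at w) = blinfun_apply (D w)" for w
    by (rule frechet_derivativeI[OF D])
  have "continuous_on UNIV (\<lambda>w. D w v)" for v
    using G by (cases v) (simp add: One_nat_def FD)
  \<comment> \<open>In finite dimension, continuity of every directional derivative is continuity in
    the operator norm, as the inverse function theorem demands.\<close>
  then have contD: "continuous_on UNIV D"
    by (intro continuous_on_blinfun_componentwise)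
  define P where "P w = Blinfun (\<lambda>v::real \<times> 'a. (fst v, D w v))" for w
  have P: "blinfun_apply (P w) = (\<lambda>v. (fst v, D w v))" for w
    unfolding P_def by (intro bounded_linear_Blinfun_apply bounded_linear_Pair bounded_linear_fst
        blinfun.bounded_linear_right)
  have derP: "((\<lambda>w. (fst w, G w)) has_derivative blinfun_apply (P w)) (at w)" for w
    unfolding P by (intro has_derivative_Pair D bounded_linear_imp_has_derivative bounded_linear_fst)
  have contP: "continuous_on UNIV P"
    by (rule continuous_on_blinfun_componentwise)
       (auto simp: P intro!: continuous_intros blinfun.continuous_on contD)
  \<comment> \<open>A kernel vector of \<open>P\<close> has first component 0, so it is vertical and
    \<open>inj\<close> applies.\<close>
  have "inj (blinfun_apply (P (t0, z0)))"
    unfolding linear_injective_0[OF bounded_linear.linear[OF blinfun.bounded_linear_right]]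
    using inj by (auto simp: P FD zero_prod_def)
  then obtain Q where Q: "linear Q" "Q \<circ> blinfun_apply (P (t0, z0)) = id"
    using linear_injective_left_inverse[OF bounded_linear.linear[OF blinfun.bounded_linear_right]]
    by blast
  have "Q (P (t0, z0) v) = v" for v
    using Q(2) by (metis comp_apply id_apply)
  then have "Blinfun Q o\<^sub>L P (t0, z0) = id_blinfun"
    using Q(1) by (intro blinfun_eqI) (simp add: bounded_linear_Blinfun_apply linear_conv_bounded_linear)
  from inverse_function_theorem[OF open_UNIV derP contP UNIV_I this]
  obtain U V g g' where U: "open U" "(t0, z0) \<in> U" and V: "open V" "(fst (t0, z0), G (t0, z0)) \<in> V"
    and hom: "homeomorphism U V (\<lambda>w. (fst w, G w)) g"
    and g: "\<And>w. w \<in> V \<Longrightarrow> (g has_derivative g' w) (at w)"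
    and bij: "\<And>w. w \<in> V \<Longrightarrow> bij (blinfun_apply (P (g w)))"
    by (metis (no_types, lifting))
  \<comment> \<open>The curve is the second component of the local inverse on the slice where the
    value of \<open>G\<close> is 0.\<close>
  define N where "N = {t. (t, 0) \<in> V}"
  define y where "y t = snd (g (t, 0))" for t
  define y' where "y' t = snd (g' (t, 0) (1, 0))" for t
  have gV: "g (t, 0) = (t, y t)" "(t, y t) \<in> U" "G (t, y t) = 0" if "t \<in> N" for t
  proof -
    have "(t, 0) \<in> V" using that by (simp add: N_def)
    then have "g (t, 0) \<in> U" "(fst (g (t, 0)), G (g (t, 0))) = (t, 0)"
      using hom by (auto simp: homeomorphism_def)
    then show "g (t, 0) = (t, y t)" "(t, y t) \<in> U" "G (t, y t) = 0"
      by (auto simp: y_def prod_eq_iff) (metis prod.collapse)+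
  qed
  have injN: "v = 0" if t: "t \<in> N" and v: "D (t, y t) (0, v) = 0" for t v
  proof -
    have "inj (blinfun_apply (P (t, y t)))"
      using bij[of "(t, 0)"] gV(1)[OF t] t by (auto simp: N_def bij_is_inj)
    moreover have "P (t, y t) (0, v) = P (t, y t) 0"
      using v by (simp add: P blinfun.zero_right)
    ultimately have "(0, v) = (0::real \<times> 'a)" by (rule injD)
    then show ?thesis by (simp add: zero_prod_def)
  qed
  have N: "open N"
  proof -
    have "N = (\<lambda>t. (t, 0)) -` V" by (auto simp: N_def)
    then show ?thesis using V by (auto intro!: open_vimage continuous_intros)
  qed
  have y': "(y has_vector_derivative y' t) (at t)" if t: "t \<in> N" for t
  proof -
    have g1: "(g has_derivative g' (t, 0)) (at (t, 0))" using g t by (simp add: N_def)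
    have "((\<lambda>t. g (t, 0)) has_derivative (\<lambda>h. g' (t, 0) (h, 0))) (at t)"
      by (rule has_derivative_compose[of "\<lambda>t. (t, 0)" "\<lambda>h. (h, 0)" t UNIV g "g' (t, 0)"])
         (auto intro!: derivative_eq_intros g1)
    then have "(y has_derivative (\<lambda>h. snd (g' (t, 0) (h, 0)))) (at t)"
      unfolding y_def by (rule has_derivative_snd)
    moreover have "snd (g' (t, 0) (h, 0)) = h *\<^sub>R y' t" for h
      using linear_scale[OF has_derivative_linear[OF g1], of h "(1, 0)"] by (simp add: y'_def)
    ultimately show ?thesis by (simp add: has_vector_derivative_def)
  qed
  have conty: "continuous_on N y"
    using y' by (meson continuous_at_imp_continuous_on has_vector_derivative_continuous)
  have contDy: "continuous_on N (\<lambda>t. D (t, y t))"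
    by (intro continuous_on_compose2[OF contD] continuous_intros conty) auto
  \<comment> \<open>Moving the time direction to the right-hand side leaves a linear system for the
    velocity whose matrix is the vertical derivative.\<close>
  have eq: "D (t, y t) (0, y' t) = - D (t, y t) (1, 0)" if t: "t \<in> N" for t
  proof -
    have "D (t, y t) (1, y' t) = 0"
      by (rule implicit_curve_derivative[OF N t gV(3) y'[OF t] D])
    then have "D (t, y t) ((0, y' t) + (1, 0)) = 0" by simp
    then show ?thesis
      unfolding blinfun.add_right by (simp add: eq_neg_iff_add_eq_0)
  qed
  have "continuous_on N y'"
  proof (rule continuous_on_linear_solution)
    let ?B = "Blinfun (\<lambda>v::'a. (0::real, v))"
    have B: "blinfun_apply ?B = (\<lambda>v. (0, v))"
      by (intro bounded_linear_Blinfun_apply bounded_linear_Pair_right)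
    show "continuous_on N (\<lambda>t. D (t, y t) o\<^sub>L ?B)"
      by (intro continuous_intros contDy)
    show "continuous_on N (\<lambda>t. - D (t, y t) (1, 0))"
      by (intro continuous_intros contDy)
    show "(D (t, y t) o\<^sub>L ?B) (y' t) = - D (t, y t) (1, 0)" if "t \<in> N" for t
      using eq[OF that] by (simp add: B)
    show "v = 0" if "t \<in> N" "(D (t, y t) o\<^sub>L ?B) v = 0" for t v
      using injN that by (simp add: B)
  qed
  moreover have "t0 \<in> N" using V G0 by (simp add: N_def)
  moreover have "t \<in> N \<and> z = y t" if "(t, z) \<in> U" "G (t, z) = 0" for t z
  proof -
    have "(fst (t, z), G (t, z)) \<in> V" "g (fst (t, z), G (t, z)) = (t, z)"
      using hom that(1) unfolding homeomorphism_def by blast+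
    then have "g (t, 0) = (t, z)" "(t, 0) \<in> V"
      using that(2) by simp_all
    then show ?thesis by (simp add: N_def y_def)
  qed
  moreover note injN[folded FD]
  ultimately show ?thesis
    by (intro that[OF N _ U, of y y']) (use gV(2,3) y' in \<open>assumption | blast\<close>)+
qed


text \<open>\<open>Ck_on\<close> gives smoothness of the derivative in each fixed direction. The
  prolonged system below needs it in a variable direction, which is therefore expanded in a
  basis.\<close>

lemma linear_at_0_pair:
  fixes D :: "real \<times> 'a::euclidean_space \<Rightarrow> 'b::real_vector"
  assumes "linear D"
  shows "D (r, v) = r *\<^sub>R D (1, 0) + (\<Sum>b\<in>Basis. (v \<bullet> b) *\<^sub>R D (0, b))"
proof -
  have lin: "linear (\<lambda>v. D (0, v))"
    using linear_compose[OF bounded_linear.linear[OF bounded_linear_Pair_right] assms]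
    by (simp add: comp_def)
  have "D (r, v) = D (r *\<^sub>R (1, 0) + (0, v))" by simp
  also have "\<dots> = r *\<^sub>R D (1, 0) + D (0, v)"
    unfolding linear_add[OF assms] linear_scale[OF assms] ..
  also have "D (0, v) = D (0, \<Sum>b\<in>Basis. (v \<bullet> b) *\<^sub>R b)" by (simp add: euclidean_representation)
  also have "\<dots> = (\<Sum>b\<in>Basis. (v \<bullet> b) *\<^sub>R D (0, b))"
    by (simp add: linear_sum[OF lin] linear_scale[OF lin])
  finally show ?thesis .
qed

text \<open>
  The second derivative of an implicit curve \<open>y\<close> comes from the previous lemma applied to the prolonged
  system satisfied by \<open>(y, y')\<close>.
\<close>

lemma implicit_curve_C2:
  fixes G :: "real \<times> 'a::euclidean_space \<Rightarrow> 'a"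
  assumes G: "Ck_on 2 G UNIV" and G0: "G (t0, z0) = 0"
    and G': "(G has_derivative G') (at (t0, z0))" and inj: "\<And>v. G' (0, v) = 0 \<Longrightarrow> v = 0"
  obtains y N W where "open N" "t0 \<in> N" "open W" "(t0, z0) \<in> W" "y t0 = z0" "Ck_on 2 y N"
    "\<And>t. t \<in> N \<Longrightarrow> G (t, y t) = 0"
    "\<And>t z. (t, z) \<in> W \<Longrightarrow> G (t, z) = 0 \<Longrightarrow> t \<in> N \<and> z = y t"
proof -
  have G2: "Ck_on (Suc 1) G UNIV" using G by (simp add: numeral_2_eq_2)
  note G1 = Ck_on_Suc_imp[OF G2]
  define D where "D w = frechet_derivative G (at w)" for w
  have D: "(G has_derivative D w) (at w)" for w
    unfolding D_def by (rule Ck_on_differentiable[OF G2 UNIV_I])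
  have DC: "Ck_on 1 (\<lambda>w. D w v) UNIV" for v
    using G2 unfolding D_def Ck_on.simps(2)[of 1] by blast
  have linD: "linear (D w)" for w by (rule has_derivative_linear[OF D])
  have "frechet_derivative G (at (t0, z0)) (0, v) = 0 \<Longrightarrow> v = 0" for v
    using inj unfolding frechet_derivativeI[OF G'] .
  then obtain y y' N W where N: "open N" "t0 \<in> N" and W: "open W" "(t0, z0) \<in> W"
    and sol: "\<And>t. t \<in> N \<Longrightarrow> (t, y t) \<in> W \<and> G (t, y t) = 0"
    and uniq: "\<And>t z. (t, z) \<in> W \<Longrightarrow> G (t, z) = 0 \<Longrightarrow> t \<in> N \<and> z = y t"
    and y': "\<And>t. t \<in> N \<Longrightarrow> (y has_vector_derivative y' t) (at t)"
    and conty': "continuous_on N y'"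
    and injN: "\<And>t v. t \<in> N \<Longrightarrow> frechet_derivative G (at (t, y t)) (0, v) = 0 \<Longrightarrow> v = 0"
    by (rule implicit_curve_C1[OF G1 G0]) blast+
  have conty: "continuous_on N y"
    using y' by (meson continuous_at_imp_continuous_on has_vector_derivative_continuous)
  \<comment> \<open>The prolonged system: the equation together with its derivative along a curve
    whose velocity is the new unknown \<open>snd (snd w)\<close>.\<close>
  define \<Gamma> where "\<Gamma> w = (G (fst w, fst (snd w)),
      D (fst w, fst (snd w)) (1, 0)
        + (\<Sum>b\<in>Basis. (snd (snd w) \<bullet> b) *\<^sub>R D (fst w, fst (snd w)) (0, b)))"
    for w :: "real \<times> 'a \<times> 'a"
  have bl: "bounded_linear (\<lambda>w::real \<times> 'a \<times> 'a. (fst w, fst (snd w)))"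
    "\<And>b. bounded_linear (\<lambda>w::real \<times> 'a \<times> 'a. snd (snd w) \<bullet> b)"
    by (intro bounded_linear_intros)+
  have \<Gamma>C: "Ck_on 1 \<Gamma> UNIV"
    unfolding \<Gamma>_def
    by (intro Ck_on_Pair Ck_on_add Ck_on_sum Ck_on_scaleR Ck_on_linear[OF bl(2)]
        Ck_on_compose_linear[OF bl(1), where h = G] G1
        Ck_on_compose_linear[OF bl(1), where h = "\<lambda>w. D w _"] DC)
  have \<Gamma>D: "\<Gamma> (t, z, \<zeta>) = (G (t, z), D (t, z) (1, \<zeta>))" for t z \<zeta>
    using linear_at_0_pair[OF linD, of "(t, z)" 1 \<zeta>] by (simp add: \<Gamma>_def)
  have \<Gamma>0: "\<Gamma> (t, y t, y' t) = 0" if t: "t \<in> N" for t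
  proof -
    have "G (s, y s) = 0" if "s \<in> N" for s using sol[OF that] by blast
    then have "D (t, y t) (1, y' t) = 0"
      by (rule implicit_curve_derivative[OF N(1) t _ y'[OF t] D])
    then show ?thesis using sol[OF t] by (simp add: \<Gamma>D zero_prod_def)
  qed
  \<comment> \<open>The vertical derivative of \<Gamma> is block triangular with the vertical
    derivative of \<open>G\<close> in both diagonal blocks: the first component forces
    \<open>fst v = 0\<close>, after which the second reduces to the same injective map.\<close>
  have \<Gamma>inj: "v = 0" if t: "t \<in> N" and v: "frechet_derivative \<Gamma> (at (t, y t, y' t)) (0, v) = 0" for t v
  proof -
    let ?w = "(t, y t, y' t)"
    let ?p = "\<lambda>w::real \<times> 'a \<times> 'a. (fst w, fst (snd w))"
    define D2 where "D2 b = frechet_derivative (\<lambda>w. D w b) (at (t, y t))" for b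
    have D2: "((\<lambda>w. D w b) has_derivative D2 b) (at (?p ?w))" for b
      unfolding D2_def using DC[of b]
      by (simp del: Ck_on.simps) (rule Ck_on_differentiable[of 0, OF _ UNIV_I], simp only: One_nat_def)
    have p: "(?p has_derivative ?p) (at ?w)"
      by (rule bounded_linear_imp_has_derivative[OF bl(1)])
    have "((\<lambda>w. D (?p w) (1, 0) + (\<Sum>b\<in>Basis. (snd (snd w) \<bullet> b) *\<^sub>R D (?p w) (0, b))) has_derivative
       (\<lambda>v. D2 (1, 0) (?p v) + (\<Sum>b\<in>Basis. (snd (snd ?w) \<bullet> b) *\<^sub>R D2 (0, b) (?p v)
             + (snd (snd v) \<bullet> b) *\<^sub>R D (?p ?w) (0, b)))) (at ?w)"
      by (intro has_derivative_add has_derivative_sum has_derivative_scaleR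
          has_derivative_compose[OF p D2] bounded_linear_imp_has_derivative[OF bl(2)])
    then have "(\<Gamma> has_derivative (\<lambda>v. (D (?p ?w) (?p v), D2 (1, 0) (?p v)
        + (\<Sum>b\<in>Basis. (snd (snd ?w) \<bullet> b) *\<^sub>R D2 (0, b) (?p v)
             + (snd (snd v) \<bullet> b) *\<^sub>R D (?p ?w) (0, b))))) (at ?w)"
      unfolding \<Gamma>_def by (intro has_derivative_Pair has_derivative_compose[OF p D])
    from v[unfolded frechet_derivativeI[OF this]]
    have 1: "D (t, y t) (0, fst v) = 0"
      and 2: "D2 (1, 0) (0, fst v) + (\<Sum>b\<in>Basis. (y' t \<bullet> b) *\<^sub>R D2 (0, b) (0, fst v)
             + (snd v \<bullet> b) *\<^sub>R D (t, y t) (0, b)) = 0"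
      by (simp_all add: zero_prod_def)
    have v1: "fst v = 0" using injN[OF t] 1 by (simp add: D_def)
    have "D2 b (0, 0) = 0" for b
      using linear_0[OF has_derivative_linear[OF D2, of b]] by (simp add: zero_prod_def)
    then have "(\<Sum>b\<in>Basis. (snd v \<bullet> b) *\<^sub>R D (t, y t) (0, b)) = 0"
      using 2 v1 by simp
    then have "D (t, y t) (0, snd v) = 0"
      using linear_at_0_pair[OF linD, of "(t, y t)" 0 "snd v"] by simp
    then have "snd v = 0" using injN[OF t] by (simp add: D_def)
    with v1 show "v = 0" by (simp add: prod_eq_iff)
  qed
  \<comment> \<open>Near each \<open>s\<close> the prolonged system has a C^1 solution, and local
    uniqueness identifies its last component with the velocity already found.\<close>
  have loc: "\<exists>y'' M. open M \<and> s \<in> M \<and> (\<forall>t\<in>M. (y' has_vector_derivative y'' t) (at t)) \<and> continuous_on M y''"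
    if s: "s \<in> N" for s
  proof -
    obtain e e' M V where M: "open M" "s \<in> M" and V: "open V" "(s, y s, y' s) \<in> V"
      and "\<And>t. t \<in> M \<Longrightarrow> (t, e t) \<in> V \<and> \<Gamma> (t, e t) = 0"
      and uniq2: "\<And>t z. (t, z) \<in> V \<Longrightarrow> \<Gamma> (t, z) = 0 \<Longrightarrow> t \<in> M \<and> z = e t"
      and e': "\<And>t. t \<in> M \<Longrightarrow> (e has_vector_derivative e' t) (at t)" "continuous_on M e'"
      by (rule implicit_curve_C1[OF \<Gamma>C \<Gamma>0[OF s] \<Gamma>inj[OF s]]) blast+
    let ?M = "(\<lambda>t. (t, y t, y' t)) -` V \<inter> N"
    have cM: "continuous_on N (\<lambda>t. (t, y t, y' t))"
      by (intro continuous_intros conty conty')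
    have oM: "open ?M"
      using cM N(1) V(1) continuous_on_open_vimage by blast
    have eq: "t \<in> M" "y' t = snd (e t)" if "t \<in> ?M" for t
      using uniq2[of t "(y t, y' t)"] \<Gamma>0[of t] that by (auto simp: prod_eq_iff)
    have "(y' has_vector_derivative snd (e' t)) (at t)" if t: "t \<in> ?M" for t
    proof -
      have "((\<lambda>t. snd (e t)) has_vector_derivative snd (e' t)) (at t)"
        by (rule bounded_linear.has_vector_derivative[OF bounded_linear_snd e'(1)[OF eq(1)[OF t]]])
      then show ?thesis
        by (rule has_vector_derivative_transform_within_open[OF _ oM t]) (rule eq(2)[symmetric])
    qed
    moreover have "continuous_on ?M (\<lambda>t. snd (e' t))"
      using e'(2) eq(1) by (intro continuous_intros) (auto intro: continuous_on_subset)
    ultimately show ?thesis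
      using oM V(2) s by (intro exI[of _ "\<lambda>t. snd (e' t)"] exI[of _ ?M]) auto
  qed
  \<comment> \<open>The local second derivatives fit together because
    \<open>vector_derivative\<close> does not depend on the neighbourhood.\<close>
  define y'' where "y'' t = vector_derivative y' (at t)" for t
  have y'': "(y' has_vector_derivative y'' t) (at t)" if "t \<in> N" for t
    using loc[OF that] by (metis y''_def vector_derivative_at)
  have "continuous_on N y''"
  proof (rule continuous_at_imp_continuous_on, rule ballI)
    fix s assume s: "s \<in> N"
    obtain d M where M: "open M" "s \<in> M" "\<forall>t\<in>M. (y' has_vector_derivative d t) (at t)" "continuous_on M d"
      using loc[OF s] by blast
    have "d t = y'' t" if "t \<in> M" for t
      using M(3) that by (metis y''_def vector_derivative_at)
    then have "continuous_on M y''"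
      using M(4) continuous_on_cong by (metis (no_types, lifting))
    then show "isCont y'' s" using M(1,2) continuous_on_eq_continuous_at by blast
  qed
  from Ck_on_2_curveI[OF N(1) y' y'' this] have "Ck_on 2 y N" .
  moreover have "y t0 = z0" using uniq[OF W(2) G0] by simp
  ultimately show ?thesis
    using that[OF N W, of y] sol uniq by blast
qed

section \<open>Gradients, Hessians and the derivative of the branch equations\<close>

section \<open>Differentiating the stationarity system\<close>

lemma has_derivative_vecI:
  fixes h :: "'a::real_normed_vector \<Rightarrow> real^'i"
  assumes "\<And>i. ((\<lambda>w. h w $ i) has_derivative (\<lambda>v. D v $ i)) F"
  shows "(h has_derivative D) F"
proof -
  have expand: "(\<lambda>w. \<Sum>i\<in>UNIV. (k w $ i) *\<^sub>R axis i 1) = k" for k :: "'a \<Rightarrow> real^'i"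
    by (auto simp: vec_eq_iff axis_def if_distrib sum.delta cong: if_cong)
  have "((\<lambda>w. \<Sum>i\<in>UNIV. (h w $ i) *\<^sub>R axis i (1::real)) has_derivative
        (\<lambda>v. \<Sum>i\<in>UNIV. (D v $ i) *\<^sub>R axis i (1::real))) F"
    by (intro has_derivative_sum has_derivative_scaleR_left assms)
  then show ?thesis by (simp only: expand)
qed

lemma Ck_on_imp_differentiable: "Ck_on (Suc k) h UNIV \<Longrightarrow> h differentiable (at z)"
  unfolding Ck_on.simps by blast

lemma inner_vec_expand: "(x::real^'i) \<bullet> y = (\<Sum>i\<in>UNIV. x $ i * y $ i)"
  by (simp add: inner_vec_def)

lemma nabla_has_derivative:
  fixes h :: "real \<times> (real^'m) \<Rightarrow> real"
  assumes "h differentiable (at z)"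
  shows "(h has_derivative (\<lambda>v. fst v * nabla_x h z + nabla_y h z \<bullet> snd v)) (at z)"
proof -
  let ?D = "frechet_derivative h (at z)"
  have D: "(h has_derivative ?D) (at z)" using assms by (simp add: frechet_derivative_works)
  have lin: "linear ?D" by (rule has_derivative_linear[OF D])
  have lin0: "linear (\<lambda>v. ?D (0, v))"
    using linear_compose[OF bounded_linear.linear[OF bounded_linear_Pair_right] lin]
    by (simp add: comp_def)
  have "?D v = fst v * nabla_x h z + nabla_y h z \<bullet> snd v" for v
  proof -
    have "?D v = ?D (fst v *\<^sub>R (1, 0) + (0, snd v))" by simp
    also have "\<dots> = fst v * nabla_x h z + ?D (0, snd v)"
      unfolding linear_add[OF lin] linear_scale[OF lin] nabla_x_def by simp
    also have "?D (0, snd v) = ?D (0, \<Sum>i\<in>UNIV. (snd v $ i) *\<^sub>R axis i 1)"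
      using basis_expansion[of "snd v"] by (simp add: scalar_mult_eq_scaleR)
    also have "\<dots> = nabla_y h z \<bullet> snd v"
      by (simp add: linear_sum[OF lin0] linear_scale[OF lin0] inner_vec_expand nabla_y_def mult.commute)
    finally show ?thesis .
  qed
  then have "?D = (\<lambda>v. fst v * nabla_x h z + nabla_y h z \<bullet> snd v)" by auto
  with D show ?thesis by simp
qed

lemma nabla_eqI:
  fixes h :: "real \<times> (real^'m) \<Rightarrow> real"
  assumes "(h has_derivative (\<lambda>v. fst v * a + b \<bullet> snd v)) (at z)"
  shows "nabla_x h z = a" "nabla_y h z = b"
  unfolding nabla_x_def nabla_y_def frechet_derivativeI[OF assms]
  by (simp_all add: vec_eq_iff inner_axis)

lemma nabla_lagr:
  fixes f :: "real \<times> (real^'m) \<Rightarrow> real" and g :: "real \<times> (real^'m) \<Rightarrow> real^'p"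
  assumes "f differentiable (at z)" "g differentiable (at z)"
  shows "nabla_x (lagr f g u) z = nabla_x f z + (\<Sum>j\<in>UNIV. u $ j * nabla_x (constr g j) z)"
    and "nabla_y (lagr f g u) z = nabla_y f z + (\<Sum>j\<in>UNIV. u $ j *\<^sub>R nabla_y (constr g j) z)"
proof -
  have g: "constr g j differentiable (at z)" for j
    using assms(2) unfolding differentiable_def
    by (blast intro: bounded_linear.has_derivative[OF bounded_linear_vec_nth])
  have "(lagr f g u has_derivative (\<lambda>v. (fst v * nabla_x f z + nabla_y f z \<bullet> snd v) +
      (\<Sum>j\<in>UNIV. u $ j * (fst v * nabla_x (constr g j) z + nabla_y (constr g j) z \<bullet> snd v)))) (at z)"
    unfolding inner_vec_expand[of u]
    by (intro has_derivative_add has_derivative_sum has_derivative_mult_right nabla_has_derivative assms(1) g)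
  then have "(lagr f g u has_derivative (\<lambda>v. fst v * (nabla_x f z + (\<Sum>j\<in>UNIV. u $ j * nabla_x (constr g j) z)) +
      (nabla_y f z + (\<Sum>j\<in>UNIV. u $ j *\<^sub>R nabla_y (constr g j) z)) \<bullet> snd v)) (at z)"
    by (rule back_subst[of "\<lambda>D. (_ has_derivative D) _"])
       (simp add: fun_eq_iff distrib_left sum.distrib inner_add_left inner_sum_left sum_distrib_left mult_ac)
  from nabla_eqI[OF this]
  show "nabla_x (lagr f g u) z = nabla_x f z + (\<Sum>j\<in>UNIV. u $ j * nabla_x (constr g j) z)"
    and "nabla_y (lagr f g u) z = nabla_y f z + (\<Sum>j\<in>UNIV. u $ j *\<^sub>R nabla_y (constr g j) z)"
    by blast+
qed

lemma nabla_const: "nabla_x (\<lambda>_. c) z = 0" "nabla_y (\<lambda>_. c) z = 0"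
  using nabla_eqI[of "\<lambda>_. c" 0 0 z] by simp_all

lemma nabla_constr_comb:
  fixes g :: "real \<times> (real^'m) \<Rightarrow> real^'p"
  assumes "g differentiable (at z)"
  shows "nabla_x (constr_comb u g) z = (\<Sum>j\<in>UNIV. u $ j * nabla_x (constr g j) z)"
    and "nabla_y (constr_comb u g) z = (\<Sum>j\<in>UNIV. u $ j *\<^sub>R nabla_y (constr g j) z)"
  using nabla_lagr[OF differentiable_const[of 0] assms, of u] by (simp_all add: nabla_const)

lemma Ck_on_nabla_y:
  fixes h :: "real \<times> (real^'m) \<Rightarrow> real"
  assumes "Ck_on (Suc k) h UNIV"
  shows "Ck_on k (nabla_y h) UNIV"
  unfolding nabla_y_def[abs_def] using assms by (intro Ck_on_vec) simp

text \<open>The row index of \<open>hess_yy\<close> belongs to the outer differentiation, so the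
  increment enters as a row vector.\<close>

lemma nabla_y_has_derivative:
  fixes h :: "real \<times> (real^'m) \<Rightarrow> real"
  assumes "Ck_on (Suc (Suc k)) h UNIV"
  shows "(nabla_y h has_derivative (\<lambda>v. fst v *\<^sub>R hess_xy h z + snd v v* hess_yy h z)) (at z)"
proof (rule has_derivative_vecI)
  fix i
  have "Ck_on (Suc k) (\<lambda>w. nabla_y h w $ i) UNIV"
    by (intro Ck_on_linear_compose[OF bounded_linear_vec_nth] Ck_on_nabla_y assms open_UNIV)
  then have "(\<lambda>w. nabla_y h w $ i) differentiable (at z)" by (rule Ck_on_imp_differentiable)
  from nabla_has_derivative[OF this]
  show "((\<lambda>w. nabla_y h w $ i) has_derivative
      (\<lambda>v. (fst v *\<^sub>R hess_xy h z + snd v v* hess_yy h z) $ i)) (at z)"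
    by (simp add: hess_xy_def hess_yy_def vector_matrix_mult_def inner_vec_expand mult.commute)
qed

locale lower_level =
  fixes f :: "real \<times> (real^'m) \<Rightarrow> real" and g :: "real \<times> (real^'m) \<Rightarrow> real^'p"
  assumes f_C3: "Ck_on 3 f UNIV" and g_C3: "Ck_on 3 g UNIV"
begin

lemma f_C: "Ck_on (Suc (Suc (Suc 0))) f UNIV"
  and g_C: "Ck_on (Suc (Suc (Suc 0))) g UNIV"
  using f_C3 g_C3 by (simp_all only: numeral_3_eq_3)

lemma constr_C: "Ck_on (Suc (Suc (Suc 0))) (constr g j) UNIV"
  by (intro Ck_on_linear_compose[OF bounded_linear_vec_nth] g_C open_UNIV)

lemma lagr_C: "Ck_on (Suc (Suc (Suc 0))) (lagr f g u) UNIV"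
  by (intro Ck_on_add f_C Ck_on_linear_compose[OF bounded_linear_inner_right] g_C open_UNIV)

lemma constr_comb_C: "Ck_on (Suc (Suc (Suc 0))) (constr_comb u g) UNIV"
  by (intro Ck_on_linear_compose[OF bounded_linear_inner_right] g_C open_UNIV)

lemma f_diff: "f differentiable (at z)" and g_diff: "g differentiable (at z)"
  and constr_diff: "constr g j differentiable (at z)"
  using f_C g_C constr_C by (blast intro: Ck_on_imp_differentiable)+

lemmas f_deriv = nabla_has_derivative[OF f_diff]
lemmas constr_deriv = nabla_has_derivative[OF constr_diff]
lemmas nabla_y_lagr_deriv = nabla_y_has_derivative[OF lagr_C]
lemmas nabla_y_comb_deriv = nabla_y_has_derivative[OF constr_comb_C]
lemmas nabla_y_f_deriv = nabla_y_has_derivative[OF f_C]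
lemmas nabla_y_constr_deriv = nabla_y_has_derivative[OF constr_C]

text \<open>The unknowns \<open>u\<^sub>j\<close>, \<open>j \<notin> I\<close>, are frozen at \<open>ub $ j\<close>, which makes the system square.\<close>

definition E_map :: "'p set \<Rightarrow> real^'p \<Rightarrow> real \<times> (real^'m) \<times> (real^'p) \<Rightarrow> (real^'m) \<times> (real^'p)" where
  "E_map I ub w = (let p = (fst w, fst (snd w)); u = snd (snd w) in
     (nabla_y f p + (\<Sum>j\<in>I. u $ j *\<^sub>R nabla_y (constr g j) p),
      \<chi> j. if j \<in> I then g p $ j else u $ j - ub $ j))"

lemma E_map_eq_0_iff:
  "E_map I ub (x, y, u) = 0 \<longleftrightarrow>
     nabla_y f (x, y) + (\<Sum>j\<in>I. u $ j *\<^sub>R nabla_y (constr g j) (x, y)) = 0 \<and>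
     (\<forall>j\<in>I. g (x, y) $ j = 0) \<and> (\<forall>j. j \<notin> I \<longrightarrow> u $ j = ub $ j)"
  by (auto simp: E_map_def Let_def zero_prod_def vec_eq_iff)

lemma bounded_linear_point: "bounded_linear (\<lambda>w::real \<times> 'a::real_normed_vector \<times> 'b::real_normed_vector. (fst w, fst (snd w)))"
  and bounded_linear_mult_nth: "bounded_linear (\<lambda>w::'c::real_normed_vector \<times> 'a \<times> (real^'k). snd (snd w) $ j)"
  by (intro bounded_linear_intros bounded_linear_compose[OF bounded_linear_vec_nth])+

lemma E_map_C2: "Ck_on 2 (E_map I ub) UNIV"
proof -
  have if_C: "Ck_on 2 (\<lambda>w. if j \<in> I then g (fst w, fst (snd w)) $ j else snd (snd w) $ j - ub $ j) UNIV"
    for j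
    using Ck_on_compose_linear[OF bounded_linear_point Ck_on_Suc_imp[OF constr_C[of j]]]
      Ck_on_add[OF Ck_on_linear[OF bounded_linear_mult_nth] Ck_on_const, of 2 j "- ub $ j"]
    by (cases "j \<in> I") (simp_all add: numeral_2_eq_2 del: Ck_on.simps)
  have "Ck_on 2 (nabla_y f) UNIV" "Ck_on 2 (nabla_y (constr g j)) UNIV" for j
    using Ck_on_nabla_y[OF f_C] Ck_on_nabla_y[OF constr_C] by (simp_all only: numeral_2_eq_2)
  then show ?thesis
    unfolding E_map_def[abs_def] Let_def
    by (intro Ck_on_Pair Ck_on_add Ck_on_sum Ck_on_scaleR Ck_on_vec if_C
        Ck_on_compose_linear[OF bounded_linear_point, where h = "nabla_y f"]
        Ck_on_compose_linear[OF bounded_linear_point, where h = "nabla_y (constr g _)"]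
        Ck_on_linear[OF bounded_linear_mult_nth])
qed

definition E_map_deriv ::
  "'p set \<Rightarrow> real^'p \<Rightarrow> real \<times> (real^'m) \<Rightarrow> real \<times> (real^'m) \<times> (real^'p) \<Rightarrow> (real^'m) \<times> (real^'p)" where
  "E_map_deriv I ub z v =
     (fst v *\<^sub>R hess_xy (lagr f g ub) z + fst (snd v) v* hess_yy (lagr f g ub) z
        + (\<Sum>j\<in>I. snd (snd v) $ j *\<^sub>R nabla_y (constr g j) z),
      \<chi> j. if j \<in> I then fst v * nabla_x (constr g j) z + nabla_y (constr g j) z \<bullet> fst (snd v)
           else snd (snd v) $ j)"

lemma E_map_has_derivative:
  assumes "\<And>j. j \<notin> I \<Longrightarrow> ub $ j = 0"
  shows "(E_map I ub has_derivative E_map_deriv I ub (x, y)) (at (x, y, ub))"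
proof -
  let ?p = "\<lambda>w::real \<times> (real^'m) \<times> (real^'p). (fst w, fst (snd w))"
  let ?w = "(x, y, ub)"
  have p: "(?p has_derivative ?p) (at ?w)"
    by (rule bounded_linear_imp_has_derivative[OF bounded_linear_point])
  have supp: "(\<Sum>j\<in>UNIV. ub $ j *\<^sub>R k j) = (\<Sum>j\<in>I. ub $ j *\<^sub>R k j)" for k :: "'p \<Rightarrow> real^'m"
    by (rule sum.mono_neutral_right) (use assms in auto)
  \<comment> \<open>Rewritten around the base point: the gradient of the Lagrangian with constant
    multiplier \<open>ub\<close>, plus the deviations from \<open>ub\<close>. These vanish at the
    base point, so second derivatives of the constraints enter only through the Hessian of the
    Lagrangian.\<close>
  have E: "E_map I ub = (\<lambda>w. (nabla_y (lagr f g ub) (?p w)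
        + (\<Sum>j\<in>I. (snd (snd w) $ j - ub $ j) *\<^sub>R nabla_y (constr g j) (?p w)),
      \<chi> j. if j \<in> I then g (?p w) $ j else snd (snd w) $ j - ub $ j))"
    by (rule ext) (simp add: E_map_def Let_def nabla_lagr[OF f_diff g_diff] supp scaleR_diff_left sum_subtractf)
  have p': "((\<lambda>w. h (?p w)) has_derivative (\<lambda>v. D (?p v))) (at ?w)"
    if "(h has_derivative D) (at (x, y))" for h :: "real \<times> (real^'m) \<Rightarrow> 'c::real_normed_vector" and D
    using has_derivative_compose[OF p, of h D] that by simp
  have u: "((\<lambda>w. snd (snd w) $ j - ub $ j) has_derivative (\<lambda>v. snd (snd v) $ j)) (at ?w)" for j
    using has_derivative_diff[OF bounded_linear_imp_has_derivative[OF bounded_linear_mult_nth] has_derivative_const]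
    by simp
  have 1: "((\<lambda>w. (snd (snd w) $ j - ub $ j) *\<^sub>R nabla_y (constr g j) (?p w)) has_derivative
      (\<lambda>v. snd (snd v) $ j *\<^sub>R nabla_y (constr g j) (x, y))) (at ?w)" for j
    using has_derivative_scaleR[OF u p'[OF nabla_y_constr_deriv]] by simp
  have 2: "((\<lambda>w. (\<chi> j. if j \<in> I then g (?p w) $ j else snd (snd w) $ j - ub $ j)) has_derivative
     (\<lambda>v. \<chi> j. if j \<in> I then fst v * nabla_x (constr g j) (x, y) + nabla_y (constr g j) (x, y) \<bullet> fst (snd v)
           else snd (snd v) $ j)) (at ?w)"
  proof (rule has_derivative_vecI)
    show "((\<lambda>w. (\<chi> j. if j \<in> I then g (?p w) $ j else snd (snd w) $ j - ub $ j) $ i) has_derivative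
      (\<lambda>v. (\<chi> j. if j \<in> I then fst v * nabla_x (constr g j) (x, y) + nabla_y (constr g j) (x, y) \<bullet> fst (snd v)
           else snd (snd v) $ j) $ i)) (at ?w)" for i
      using p'[OF constr_deriv, of i] u by (cases "i \<in> I") simp_all
  qed
  show ?thesis
    unfolding E E_map_deriv_def[abs_def]
    using p'[OF nabla_y_lagr_deriv[of ub]]
    by (intro has_derivative_Pair has_derivative_add has_derivative_sum 1 2) simp
qed

text \<open>A branch carries multipliers for \<open>I\<close> only. Padding them with 0 embeds it
  into the square system, which is consistent because \<open>ub\<close> vanishes off
  \<open>I\<close>.\<close>

lemma E_branch_derivative:
  assumes br: "E_branch f g I xb yb ub y v" and ub: "\<And>j. j \<notin> I \<Longrightarrow> ub $ j = 0"
    and z: "z = (xb, yb)"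
  obtains y' v' where "(y has_vector_derivative y') (at xb)"
    "hess_xy (lagr f g ub) z + y' v* hess_yy (lagr f g ub) z
       + (\<Sum>j\<in>I. v' j *\<^sub>R nabla_y (constr g j) z) = 0"
    "\<And>j. j \<in> I \<Longrightarrow> nabla_x (constr g j) z + nabla_y (constr g j) z \<bullet> y' = 0"
proof -
  from br obtain N where y0: "y xb = yb" "\<And>j. j \<in> I \<Longrightarrow> v j xb = ub $ j"
    and N: "open N" "xb \<in> N" and C: "Ck_on 2 y N" "\<And>j. j \<in> I \<Longrightarrow> Ck_on 2 (v j) N"
    and sol: "\<And>x. x \<in> N \<Longrightarrow> nabla_y f (x, y x) + (\<Sum>j\<in>I. v j x *\<^sub>R nabla_y (constr g j) (x, y x)) = 0"
      "\<And>x j. x \<in> N \<Longrightarrow> j \<in> I \<Longrightarrow> g (x, y x) $ j = 0"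
    unfolding E_branch_def by blast
  define y' where "y' = vector_derivative y (at xb)"
  define v' where "v' j = vector_derivative (v j) (at xb)" for j
  have y': "(y has_vector_derivative y') (at xb)"
    unfolding y'_def using C N by (intro Ck_on_curve_derivative[of 1]) (simp_all only: Suc_1)
  have v': "(v j has_vector_derivative v' j) (at xb)" if "j \<in> I" for j
    unfolding v'_def using C that N by (intro Ck_on_curve_derivative[of 1]) (simp_all only: Suc_1)
  let ?u = "\<lambda>x. \<chi> j. if j \<in> I then v j x else 0"
  have "(?u has_derivative (\<lambda>h. h *\<^sub>R (\<chi> j. if j \<in> I then v' j else 0))) (at xb)"
  proof (rule has_derivative_vecI)
    show "((\<lambda>x. ?u x $ j) has_derivative (\<lambda>h. (h *\<^sub>R (\<chi> j. if j \<in> I then v' j else 0)) $ j)) (at xb)" for j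
      using v' by (cases "j \<in> I") (simp_all add: has_vector_derivative_def)
  qed
  then have W: "((\<lambda>x. (y x, ?u x)) has_vector_derivative (y', \<chi> j. if j \<in> I then v' j else 0)) (at xb)"
    by (intro has_vector_derivative_Pair y') (simp only: has_vector_derivative_def)
  have "(xb, y xb, ?u xb) = (xb, yb, ub)"
    using y0 ub by (simp add: vec_eq_iff)
  then have GD: "(E_map I ub has_derivative E_map_deriv I ub z) (at (xb, y xb, ?u xb))"
    using E_map_has_derivative[OF ub] z by simp
  have G0: "E_map I ub (x, y x, ?u x) = 0" if "x \<in> N" for x
    using sol that ub by (simp add: E_map_eq_0_iff)
  have "E_map_deriv I ub z (1, y', \<chi> j. if j \<in> I then v' j else 0) = 0"
    by (rule implicit_curve_derivative[OF N G0 W GD])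
  then have *: "hess_xy (lagr f g ub) z + y' v* hess_yy (lagr f g ub) z
       + (\<Sum>j\<in>I. v' j *\<^sub>R nabla_y (constr g j) z) = 0"
    "\<forall>i. (if i \<in> I then nabla_x (constr g i) z + nabla_y (constr g i) z \<bullet> y' else 0) = 0"
    by (simp_all add: E_map_deriv_def zero_prod_def vec_eq_iff cong: if_cong)
  show ?thesis using that[OF y' *(1)] *(2) by metis
qed

text \<open>Independent gradients and a nonsingular compression make the linearised system
  injective. The uniqueness neighbourhood \<open>W\<close> is recorded for Case II, where a curve of
  minimizers has to be recognised as this branch.\<close>

lemma E_branch_exists:
  fixes xb :: real and yb :: "real^'m"
  defines "z \<equiv> (xb, yb)"
  assumes ub: "\<And>j. j \<notin> I \<Longrightarrow> ub $ j = 0"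
    and stat: "nabla_y f z + (\<Sum>j\<in>I. ub $ j *\<^sub>R nabla_y (constr g j) z) = 0"
    and act: "\<And>j. j \<in> I \<Longrightarrow> g z $ j = 0"
    and ind: "lin_indep_family (\<lambda>j. nabla_y (constr g j) z) I"
    and reg: "nonsingular_on (hess_yy (lagr f g ub) z) (tangent g I z)"
  obtains y v W where "E_branch f g I xb yb ub y v" "open W" "(xb, yb, ub) \<in> W"
    "\<And>x y' u. (x, y', u) \<in> W \<Longrightarrow> (\<And>j. j \<notin> I \<Longrightarrow> u $ j = 0) \<Longrightarrow>
       nabla_y f (x, y') + (\<Sum>j\<in>I. u $ j *\<^sub>R nabla_y (constr g j) (x, y')) = 0 \<Longrightarrow>
       (\<And>j. j \<in> I \<Longrightarrow> g (x, y') $ j = 0) \<Longrightarrow> y' = y x"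
proof -
  have 0: "E_map I ub (xb, yb, ub) = 0"
    using stat act by (simp add: E_map_eq_0_iff z_def)
  have inj: "v = 0" if v: "E_map_deriv I ub z (0, v) = 0" for v
  proof -
    have 1: "fst v v* hess_yy (lagr f g ub) z + (\<Sum>j\<in>I. snd v $ j *\<^sub>R nabla_y (constr g j) z) = 0"
      and 2: "\<And>j. j \<in> I \<Longrightarrow> nabla_y (constr g j) z \<bullet> fst v = 0"
      and 3: "\<And>j. j \<notin> I \<Longrightarrow> snd v $ j = 0"
    proof -
      have "\<forall>i. (if i \<in> I then nabla_y (constr g i) z \<bullet> fst v else snd v $ i) = 0"
        using v by (simp add: E_map_deriv_def zero_prod_def vec_eq_iff cong: if_cong)
      then show "\<And>j. j \<in> I \<Longrightarrow> nabla_y (constr g j) z \<bullet> fst v = 0"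
        and "\<And>j. j \<notin> I \<Longrightarrow> snd v $ j = 0" by metis+
    qed (use v in \<open>simp add: E_map_deriv_def zero_prod_def\<close>)
    \<comment> \<open>Against tangent vectors the multiplier terms vanish, which isolates the
      Hessian. Once the y-part is 0, independence removes the multipliers.\<close>
    have "fst v = 0"
    proof (rule saddle_injective[OF reg])
      show "fst v \<in> tangent g I z" using 2 by (simp add: tangent_def)
      fix \<zeta> assume "\<zeta> \<in> tangent g I z"
      then have "(\<Sum>j\<in>I. snd v $ j *\<^sub>R nabla_y (constr g j) z) \<bullet> \<zeta> = 0"
        by (simp add: tangent_def inner_sum_left)
      then show "(fst v v* hess_yy (lagr f g ub) z) \<bullet> \<zeta> = 0"
        using arg_cong[OF 1, of "\<lambda>a. a \<bullet> \<zeta>"] by (simp add: inner_add_left)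
    qed
    moreover from this have "snd v $ j = 0" for j
      using lin_indep_family_coeff_0[OF ind finite, of "\<lambda>j. snd v $ j"] 1 3 by auto
    ultimately show "v = 0" by (simp add: prod_eq_iff vec_eq_iff)
  qed
  have der: "(E_map I ub has_derivative E_map_deriv I ub z) (at (xb, yb, ub))"
    unfolding z_def by (rule E_map_has_derivative[OF ub])
  obtain w N W where N: "open N" "xb \<in> N" and W: "open W" "(xb, yb, ub) \<in> W"
    and w0: "w xb = (yb, ub)" and wC: "Ck_on 2 w N"
    and sol: "\<And>t. t \<in> N \<Longrightarrow> E_map I ub (t, w t) = 0"
    and uniq: "\<And>t z. (t, z) \<in> W \<Longrightarrow> E_map I ub (t, z) = 0 \<Longrightarrow> t \<in> N \<and> z = w t"
    by (rule implicit_curve_C2[OF E_map_C2 0 der inj]) blast+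
  have sol': "nabla_y f (t, fst (w t)) + (\<Sum>j\<in>I. snd (w t) $ j *\<^sub>R nabla_y (constr g j) (t, fst (w t))) = 0"
    "\<forall>j\<in>I. g (t, fst (w t)) $ j = 0" if "t \<in> N" for t
    using sol[OF that] E_map_eq_0_iff[of I ub t "fst (w t)" "snd (w t)"] by simp_all
  have "E_branch f g I xb yb ub (\<lambda>t. fst (w t)) (\<lambda>j t. snd (w t) $ j)"
    unfolding E_branch_def
  proof (intro conjI exI[of _ N] ballI N)
    show "Ck_on 2 (\<lambda>t. fst (w t)) N"
      by (rule Ck_on_linear_compose[OF bounded_linear_fst N(1) wC])
    show "Ck_on 2 (\<lambda>t. snd (w t) $ j) N" for j
      by (rule Ck_on_linear_compose[OF _ N(1) wC])
         (intro bounded_linear_compose[OF bounded_linear_vec_nth] bounded_linear_snd)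
  qed (use w0 sol' in auto)
  moreover have "y' = fst (w x)" if "(x, y', u) \<in> W" "\<And>j. j \<notin> I \<Longrightarrow> u $ j = 0"
       "nabla_y f (x, y') + (\<Sum>j\<in>I. u $ j *\<^sub>R nabla_y (constr g j) (x, y')) = 0"
       "\<And>j. j \<in> I \<Longrightarrow> g (x, y') $ j = 0" for x y' u
  proof -
    have "E_map I ub (x, y', u) = 0"
      unfolding E_map_eq_0_iff using that ub by simp
    from uniq[OF that(1) this] show ?thesis by (metis fst_conv)
  qed
  ultimately show ?thesis by (rule that[OF _ W])
qed

end

section \<open>Fritz John and KKT multipliers\<close>

section \<open>Multipliers at local minimizers\<close>

lemma negative_derivative_eventually_less:
  fixes h :: "real \<Rightarrow> real"
  assumes "(h has_real_derivative l) (at t)" "l < 0"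
  shows "\<forall>\<^sub>F s in at_right t. h s < h t"
proof -
  obtain d where "d > 0" "\<forall>k>0. k < d \<longrightarrow> h (t + k) < h t"
    using has_real_derivative_neg_dec_right[OF assms] by auto
  then have "h s < h t" if "t < s" "s < t + d" for s
    using that by (auto dest!: spec[of _ "s - t"])
  then show ?thesis
    using \<open>d > 0\<close> unfolding eventually_at_right_field by (intro exI[of _ "t + d"]) auto
qed

lemma directional_derivative:
  fixes h :: "real \<times> (real^'m) \<Rightarrow> real"
  assumes "h differentiable (at (x, y))"
  shows "((\<lambda>t. h (x, y + t *\<^sub>R d)) has_real_derivative nabla_y h (x, y) \<bullet> d) (at 0)"
proof -
  have 1: "((\<lambda>t. (x, y + t *\<^sub>R d)) has_derivative (\<lambda>t. (0, t *\<^sub>R d))) (at 0)"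
    by (auto intro!: derivative_eq_intros)
  have 2: "(h has_derivative (\<lambda>v. fst v * nabla_x h (x, y) + nabla_y h (x, y) \<bullet> snd v)) (at (x, y + 0 *\<^sub>R d))"
    using nabla_has_derivative[OF assms] by simp
  from has_derivative_compose[OF 1 2] show ?thesis
    by (simp add: has_field_derivative_def mult_commute_abs)
qed

lemma Sol_local_minimizer: "y \<in> Sol f g x \<Longrightarrow> local_minimizer f g x y"
  unfolding Sol_def is_arg_min_linorder local_minimizer_def by (auto intro: exI[of _ 1])

context lower_level
begin

lemma f_isCont: "isCont f z" and g_isCont: "isCont g z"
  by (rule differentiable_imp_continuous_within[OF f_diff])
     (rule differentiable_imp_continuous_within[OF g_diff])

text \<open>Along such a \<open>d\<close> the objective and all active constraints would decrease
  for small t > 0 while the inactive ones stay negative by continuity, so feasible points close to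
  \<open>y\<close> would be strictly better.\<close>

lemma no_descent_direction:
  assumes lm: "local_minimizer f g x y" and z: "z = (x, y)"
  shows "\<not> (nabla_y f z \<bullet> d < 0 \<and> (\<forall>j\<in>J0 g z. nabla_y (constr g j) z \<bullet> d < 0))"
proof
  assume d: "nabla_y f z \<bullet> d < 0 \<and> (\<forall>j\<in>J0 g z. nabla_y (constr g j) z \<bullet> d < 0)"
  obtain e where e: "e > 0" "\<And>y'. feasible g x y' \<Longrightarrow> dist y' y < e \<Longrightarrow> f (x, y) \<le> f (x, y')"
    and feas: "\<And>j. g z $ j \<le> 0"
    using lm z by (auto simp: local_minimizer_def feasible_def)
  have lim: "((\<lambda>t. y + t *\<^sub>R d) \<longlongrightarrow> y) (at_right 0)"
    by (auto intro!: tendsto_eq_intros)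
  have "\<forall>\<^sub>F t in at_right 0. g (x, y + t *\<^sub>R d) $ j \<le> 0" for j
  proof (cases "j \<in> J0 g z")
    case True
    have "\<forall>\<^sub>F t in at_right 0. g (x, y + t *\<^sub>R d) $ j < g (x, y + 0 *\<^sub>R d) $ j"
      using d True z by (intro negative_derivative_eventually_less[OF directional_derivative[OF constr_diff]]) auto
    then show ?thesis using True z by (auto simp: J0_def elim: eventually_mono)
  next
    case False
    have "((\<lambda>t. g (x, y + t *\<^sub>R d) $ j) \<longlongrightarrow> g z $ j) (at_right 0)"
      unfolding z by (intro tendsto_intros isCont_tendsto_compose[OF g_isCont] lim)
    moreover have "g z $ j < 0" using feas[of j] False by (simp add: J0_def)
    ultimately have "\<forall>\<^sub>F t in at_right 0. g (x, y + t *\<^sub>R d) $ j < 0"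
      by (rule order_tendstoD)
    then show ?thesis by (rule eventually_mono) simp
  qed
  then have "\<forall>\<^sub>F t in at_right 0. \<forall>j. g (x, y + t *\<^sub>R d) $ j \<le> 0"
    by (rule eventually_all_finite)
  moreover have "\<forall>\<^sub>F t in at_right 0. f (x, y + t *\<^sub>R d) < f (x, y + 0 *\<^sub>R d)"
    using d z by (intro negative_derivative_eventually_less[OF directional_derivative[OF f_diff]]) auto
  moreover have "\<forall>\<^sub>F t in at_right 0. dist (y + t *\<^sub>R d) y < e"
    using lim e(1) by (rule tendstoD)
  ultimately have "\<forall>\<^sub>F t in at_right (0::real). False"
    by eventually_elim (use e(2) in \<open>force simp: feasible_def\<close>)
  then show False by simp
qed

text \<open>All terms of the product have the same sign, so it vanishes only if each term does.
  Complementarity thereby becomes a condition on the support.\<close>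

lemma multiplier_support:
  assumes "\<And>j. u $ j \<ge> 0" "\<And>j. g z $ j \<le> 0"
  shows "u \<bullet> g z = 0 \<longleftrightarrow> (\<forall>j. j \<notin> J0 g z \<longrightarrow> u $ j = 0)"
proof -
  have "(\<Sum>j\<in>UNIV. - (u $ j * g z $ j)) = 0 \<longleftrightarrow> (\<forall>j\<in>UNIV. - (u $ j * g z $ j) = 0)"
    using assms by (intro sum_nonneg_eq_0_iff) (auto simp: mult_nonneg_nonpos)
  then show ?thesis by (auto simp: inner_vec_expand J0_def sum_negf)
qed

lemma sum_support:
  fixes u :: "real^'p" and k :: "'p \<Rightarrow> 'v::real_vector"
  assumes "\<And>j. j \<notin> I \<Longrightarrow> u $ j = 0"
  shows "(\<Sum>j\<in>UNIV. u $ j *\<^sub>R k j) = (\<Sum>j\<in>I. u $ j *\<^sub>R k j)"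
  by (rule sum.mono_neutral_right) (use assms in auto)

lemma KKT_iff:
  assumes "feasible g x y" "z = (x, y)"
  shows "u \<in> KKT_multipliers f g z \<longleftrightarrow>
     nabla_y f z + (\<Sum>j\<in>J0 g z. u $ j *\<^sub>R nabla_y (constr g j) z) = 0 \<and>
     (\<forall>j. u $ j \<ge> 0) \<and> (\<forall>j. j \<notin> J0 g z \<longrightarrow> u $ j = 0)"
proof -
  have 1: "u \<bullet> g z = 0 \<longleftrightarrow> (\<forall>j. j \<notin> J0 g z \<longrightarrow> u $ j = 0)" if "\<forall>j. u $ j \<ge> 0"
    using that assms by (intro multiplier_support) (auto simp: feasible_def)
  have 2: "(\<Sum>j\<in>UNIV. u $ j *\<^sub>R nabla_y (constr g j) z) = (\<Sum>j\<in>J0 g z. u $ j *\<^sub>R nabla_y (constr g j) z)"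
    if "\<forall>j. j \<notin> J0 g z \<longrightarrow> u $ j = 0"
    using that by (intro sum_support) blast
  show ?thesis (is "_ \<longleftrightarrow> ?R")
  proof
    assume "u \<in> KKT_multipliers f g z"
    then have a: "nabla_y f z + (\<Sum>j\<in>UNIV. u $ j *\<^sub>R nabla_y (constr g j) z) = 0"
      "\<forall>j. u $ j \<ge> 0" "u \<bullet> g z = 0"
      by (simp_all add: KKT_multipliers_def)
    have s: "\<forall>j. j \<notin> J0 g z \<longrightarrow> u $ j = 0" using 1[OF a(2)] a(3) by simp
    show ?R using a(1,2) s unfolding 2[OF s] by blast
  next
    assume R: ?R
    then have s: "\<forall>j. u $ j \<ge> 0" "\<forall>j. j \<notin> J0 g z \<longrightarrow> u $ j = 0" by blast+
    show "u \<in> KKT_multipliers f g z"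
      unfolding KKT_multipliers_def mem_Collect_eq 1[OF s(1)] 2[OF s(2)] using R by blast
  qed
qed

lemma FJ_iff:
  assumes "feasible g x y" "z = (x, y)"
  shows "(u0, u) \<in> FJ_multipliers f g z \<longleftrightarrow>
     u0 *\<^sub>R nabla_y f z + (\<Sum>j\<in>J0 g z. u $ j *\<^sub>R nabla_y (constr g j) z) = 0 \<and>
     u0 \<ge> 0 \<and> (\<forall>j. u $ j \<ge> 0) \<and> u0 + (\<Sum>j\<in>J0 g z. u $ j) = 1 \<and> (\<forall>j. j \<notin> J0 g z \<longrightarrow> u $ j = 0)"
proof -
  have 1: "u \<bullet> g z = 0 \<longleftrightarrow> (\<forall>j. j \<notin> J0 g z \<longrightarrow> u $ j = 0)" if "\<forall>j. u $ j \<ge> 0"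
    using that assms by (intro multiplier_support) (auto simp: feasible_def)
  have 2: "(\<Sum>j\<in>UNIV. u $ j *\<^sub>R nabla_y (constr g j) z) = (\<Sum>j\<in>J0 g z. u $ j *\<^sub>R nabla_y (constr g j) z)"
    "(\<Sum>j\<in>UNIV. \<bar>u $ j\<bar>) = (\<Sum>j\<in>J0 g z. \<bar>u $ j\<bar>)"
    if "\<forall>j. j \<notin> J0 g z \<longrightarrow> u $ j = 0"
    using that by (intro sum_support sum.mono_neutral_right; auto)+
  have 3: "(\<Sum>j\<in>J0 g z. \<bar>u $ j\<bar>) = (\<Sum>j\<in>J0 g z. u $ j)" if "\<forall>j. u $ j \<ge> 0"
    using that by (intro sum.cong) auto
  show ?thesis (is "_ \<longleftrightarrow> ?R")
  proof
    assume "(u0, u) \<in> FJ_multipliers f g z"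
    then have a: "u0 *\<^sub>R nabla_y f z + (\<Sum>j\<in>UNIV. u $ j *\<^sub>R nabla_y (constr g j) z) = 0"
      "\<forall>j. u $ j \<ge> 0" "u \<bullet> g z = 0" "u0 \<ge> 0" "u0 + (\<Sum>j\<in>UNIV. \<bar>u $ j\<bar>) = 1"
      unfolding FJ_multipliers_def by auto
    have s: "\<forall>j. j \<notin> J0 g z \<longrightarrow> u $ j = 0" using 1[OF a(2)] a(3) by simp
    show ?R using a(1,2,4,5) s unfolding 2[OF s] 3[OF a(2)] by blast
  next
    assume R: ?R
    then have s: "\<forall>j. u $ j \<ge> 0" "\<forall>j. j \<notin> J0 g z \<longrightarrow> u $ j = 0" and "\<bar>u0\<bar> = u0" by simp_all
    then show "(u0, u) \<in> FJ_multipliers f g z"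
      unfolding FJ_multipliers_def mem_Collect_eq case_prod_conv 1[OF s(1)] 2[OF s(2)] 3[OF s(1)]
      using R by simp
  qed
qed

text \<open>Gordan's alternative for the gradients of the objective, indexed by \<open>None\<close>,
  and of the active constraints. Its weights have sum 1, which is the normalisation of
  FJ-multipliers.\<close>

lemma FJ_exists:
  assumes lm: "local_minimizer f g x y" and z: "z = (x, y)"
  obtains u0 u where "(u0, u) \<in> FJ_multipliers f g z"
proof -
  let ?I = "insert None (Some ` J0 g z)"
  let ?c = "\<lambda>i. case i of None \<Rightarrow> nabla_y f z | Some j \<Rightarrow> nabla_y (constr g j) z"
  have "\<nexists>d. \<forall>i\<in>?I. ?c i \<bullet> d < 0"
    using no_descent_direction[OF lm z] by auto
  then obtain \<mu> where \<mu>: "\<And>i. i \<in> ?I \<Longrightarrow> 0 \<le> \<mu> i" "sum \<mu> ?I = 1" "(\<Sum>i\<in>?I. \<mu> i *\<^sub>R ?c i) = 0"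
    by (rule gordan_alternative[rotated]) auto
  define u :: "real^'p" where "u = (\<chi> j. if j \<in> J0 g z then \<mu> (Some j) else 0)"
  have "feasible g x y" using lm by (simp add: local_minimizer_def)
  then have "(\<mu> None, u) \<in> FJ_multipliers f g z"
    using \<mu> by (subst FJ_iff[OF _ z]) (auto simp: u_def sum.reindex)
  then show ?thesis by (rule that)
qed

lemma FJ_KKT:
  assumes feas: "feasible g x y" and z: "z = (x, y)"
    and av: "(a, v) \<in> FJ_multipliers f g z" and a: "a > 0"
  shows "(1 / a) *\<^sub>R v \<in> KKT_multipliers f g z" (is "?v \<in> _")
proof -
  note av = av[unfolded FJ_iff[OF feas z]]
  have "nabla_y f z + (\<Sum>j\<in>J0 g z. ?v $ j *\<^sub>R nabla_y (constr g j) z)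
      = (1 / a) *\<^sub>R (a *\<^sub>R nabla_y f z + (\<Sum>j\<in>J0 g z. v $ j *\<^sub>R nabla_y (constr g j) z))"
    using a by (simp add: scaleR_add_right scaleR_sum_right)
  also have "\<dots> = 0" using av by simp
  finally show ?thesis
    unfolding KKT_iff[OF feas z] using av a by simp
qed

text \<open>Weight 0 on the objective would leave a nontrivial relation among the active
  gradients.\<close>

lemma LICQ_FJ_pos:
  assumes feas: "feasible g x y" and z: "z = (x, y)" and licq: "LICQ g z"
    and av: "(a, v) \<in> FJ_multipliers f g z"
  shows "a > 0"
proof -
  note av = av[unfolded FJ_iff[OF feas z]]
  have "a \<noteq> 0"
  proof
    assume "a = 0"
    then have "v $ j = 0" if "j \<in> J0 g z" for j
      using lin_indep_family_coeff_0[OF licq[unfolded LICQ_def] finite, of "\<lambda>j. v $ j"] av that by simp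
    then show False using av \<open>a = 0\<close> by simp
  qed
  then show ?thesis using av by simp
qed

text \<open>Types 1 and 2 supply a stationary multiplier of unknown sign. Minimality supplies a
  nonnegative one, and LICQ forces the two to agree.\<close>

lemma LICQ_KKT:
  assumes lm: "local_minimizer f g x y" and z: "z = (x, y)" and licq: "LICQ g z"
    and st: "stationary_multiplier f g z u"
  shows "KKT_multipliers f g z = {u}"
proof -
  have feas: "feasible g x y" using lm by (simp add: local_minimizer_def)
  note coeff0 = lin_indep_family_coeff_0[OF licq[unfolded LICQ_def] finite]
  have uniq: "u' = u" if "stationary_multiplier f g z u'" for u'
  proof -
    have "(\<Sum>j\<in>J0 g z. u' $ j *\<^sub>R nabla_y (constr g j) z) = (\<Sum>j\<in>J0 g z. u $ j *\<^sub>R nabla_y (constr g j) z)"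
    proof -
      have "nabla_y f z + (\<Sum>j\<in>J0 g z. u' $ j *\<^sub>R nabla_y (constr g j) z)
          = nabla_y f z + (\<Sum>j\<in>J0 g z. u $ j *\<^sub>R nabla_y (constr g j) z)"
        using that st by (simp only: stationary_multiplier_def)
      then show ?thesis by (rule add_left_imp_eq)
    qed
    then have "(\<Sum>j\<in>J0 g z. (u' $ j - u $ j) *\<^sub>R nabla_y (constr g j) z) = 0"
      by (simp add: scaleR_diff_left sum_subtractf)
    from coeff0[OF this] have "u' $ j = u $ j" if "j \<in> J0 g z" for j
      using that by simp
    moreover have "u' $ j = u $ j" if "j \<notin> J0 g z" for j
      using that st \<open>stationary_multiplier f g z u'\<close> by (simp add: stationary_multiplier_def)
    ultimately show ?thesis unfolding vec_eq_iff by blast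
  qed
  obtain a v where av: "(a, v) \<in> FJ_multipliers f g z" using FJ_exists[OF lm z] .
  have "(1 / a) *\<^sub>R v \<in> KKT_multipliers f g z"
    using FJ_KKT[OF feas z av LICQ_FJ_pos[OF feas z licq av]] .
  moreover have "u' = u" if "u' \<in> KKT_multipliers f g z" for u'
    using that unfolding KKT_iff[OF feas z] by (intro uniq) (simp add: stationary_multiplier_def)
  ultimately show ?thesis by blast
qed

text \<open>\<open>dual_identity\<close> along a branch. Two corrections to the residual survive:
  multiplier velocities times constraint gradients at \<open>w\<close> on \<open>I\<close>, and
  \<xi> times constraint velocities off \<open>I\<close>. The data \<open>a\<close> and
  \<open>b\<close> stay free because Case II adds \<mu>-terms to the gradient of
  \<open>F\<close>.\<close>

lemma KKT_E_branch_derivative: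
  assumes br: "E_branch f g I xb yb u y v" and u: "\<And>j. j \<notin> I \<Longrightarrow> u $ j = 0" and z: "z = (xb, yb)"
    and b: "b = hess_yy (lagr f g u) z *v w - (\<Sum>j\<in>UNIV. \<xi> $ j *\<^sub>R nabla_y (constr g j) z)"
  obtains y' v' where "(y has_vector_derivative y') (at xb)"
    "hess_xy (lagr f g u) z + y' v* hess_yy (lagr f g u) z
       + (\<Sum>j\<in>I. v' j *\<^sub>R nabla_y (constr g j) z) = 0"
    "\<And>j. j \<in> I \<Longrightarrow> nabla_x (constr g j) z + nabla_y (constr g j) z \<bullet> y' = 0"
    "a + b \<bullet> y' = (a - hess_xy (lagr f g u) z \<bullet> w + nabla_x (constr_comb \<xi> g) z)
       - (\<Sum>j\<in>I. v' j * (nabla_y (constr g j) z \<bullet> w))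
       - (\<Sum>j\<in>UNIV - I. \<xi> $ j * (nabla_x (constr g j) z + nabla_y (constr g j) z \<bullet> y'))"
proof -
  obtain y' v' where *: "(y has_vector_derivative y') (at xb)"
    "hess_xy (lagr f g u) z + y' v* hess_yy (lagr f g u) z
       + (\<Sum>j\<in>I. v' j *\<^sub>R nabla_y (constr g j) z) = 0"
    "\<And>j. j \<in> I \<Longrightarrow> nabla_x (constr g j) z + nabla_y (constr g j) z \<bullet> y' = 0"
    using E_branch_derivative[OF br u z] by blast
  let ?k = "\<lambda>j. nabla_x (constr g j) z + nabla_y (constr g j) z \<bullet> y'"
  have 1: "(\<Sum>j\<in>UNIV. \<xi> $ j * ?k j) = (\<Sum>j\<in>UNIV - I. \<xi> $ j * ?k j)"
    by (rule sum.mono_neutral_right) (use *(3) in auto)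
  have "hess_xy (lagr f g u) z + y' v* hess_yy (lagr f g u) z = - (\<Sum>j\<in>I. v' j *\<^sub>R nabla_y (constr g j) z)"
    using *(2) by (simp only: eq_neg_iff_add_eq_0)
  then have 2: "w \<bullet> (hess_xy (lagr f g u) z + y' v* hess_yy (lagr f g u) z)
      = - (\<Sum>j\<in>I. v' j * (nabla_y (constr g j) z \<bullet> w))"
    by (simp add: inner_sum_right inner_commute)
  show ?thesis
    using that[OF *] dual_identity[OF b, of a y' "hess_xy (lagr f g u) z" "\<lambda>j. nabla_x (constr g j) z"]
    unfolding 1 2 by (simp add: nabla_constr_comb[OF g_diff])
qed

lemma gdot_eq:
  assumes "(y has_vector_derivative y') (at xb)" "y xb = yb" "z = (xb, yb)"
  shows "gdot g q xb y = nabla_x (constr g q) z + nabla_y (constr g q) z \<bullet> y'"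
proof -
  have 1: "((\<lambda>x. (x, y x)) has_derivative (\<lambda>h. (h, h *\<^sub>R y'))) (at xb)"
    using assms(1) by (intro has_derivative_Pair has_derivative_ident) (simp add: has_vector_derivative_def)
  have 2: "(constr g q has_derivative (\<lambda>v. fst v * nabla_x (constr g q) z + nabla_y (constr g q) z \<bullet> snd v))
      (at (xb, y xb))"
    unfolding assms(2) assms(3)[symmetric] by (rule constr_deriv)
  from has_derivative_compose[OF 1 2]
  have "((\<lambda>x. g (x, y x) $ q) has_real_derivative nabla_x (constr g q) z + nabla_y (constr g q) z \<bullet> y') (at xb)"
    unfolding has_field_derivative_def
    by (rule back_subst[of "\<lambda>D. (_ has_derivative D) _"]) (simp add: fun_eq_iff algebra_simps)
  then show ?thesis unfolding gdot_def by (rule DERIV_imp_deriv)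
qed

lemma Fdot_eq:
  assumes "(y has_vector_derivative y') (at xb)" "z = (xb, yb)"
  shows "Fdot F xb yb y = nabla_x F z + nabla_y F z \<bullet> y'"
  using assms by (simp add: Fdot_def vector_derivative_at)

end

section \<open>Second order necessary condition along a feasible arc\<close>

section \<open>Second order necessary condition\<close>

lemma Ck_on_translate:
  assumes "Ck_on k h UNIV"
  shows "Ck_on k (\<lambda>w. h (c + w)) UNIV"
  using assms
proof (induction k arbitrary: h)
  case 0
  then show ?case by (auto intro!: continuous_on_compose2[of UNIV h] continuous_intros)
next
  case (Suc k)
  have D: "((\<lambda>w. h (c + w)) has_derivative frechet_derivative h (at (c + z))) (at z)" for z
    by (rule has_derivative_compose[of "\<lambda>w. c + w" "\<lambda>v. v" z UNIV h])
       (auto intro!: derivative_eq_intros Ck_on_differentiable[OF Suc.prems])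
  have "Ck_on k (\<lambda>w. frechet_derivative h (at (c + w)) v) UNIV" for v
    using Suc.prems by (intro Suc.IH) simp
  then show ?case
    using D by (auto simp: frechet_derivativeI[OF D] differentiable_def)
qed

context lower_level
begin

text \<open>
  The feasible arc along which the second order condition is read off corrects the line \<open>y + t \<zeta>\<close> by
  a combination of the gradients of the constraints that have to stay active.
\<close>

lemma feasible_arc:
  fixes x :: real and y \<zeta> :: "real^'m"
  defines "z \<equiv> (x, y)"
  assumes ind: "lin_indep_family (\<lambda>j. nabla_y (constr g j) z) I"
    and act: "\<And>j. j \<in> I \<Longrightarrow> g z $ j = 0"
    and \<zeta>: "\<And>j. j \<in> I \<Longrightarrow> nabla_y (constr g j) z \<bullet> \<zeta> = 0"
  obtains Y N where "open N" "0 \<in> N" "Ck_on 2 Y N" "Y 0 = y" "(Y has_vector_derivative \<zeta>) (at 0)"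
    "\<And>t j. t \<in> N \<Longrightarrow> j \<in> I \<Longrightarrow> g (x, Y t) $ j = 0"
proof -
  let ?n = "\<lambda>j. nabla_y (constr g j) z"
  \<comment> \<open>The displacement of the arc: its first component is 0 because \<open>x\<close>
    stays fixed, and the unknowns are the coefficients of the gradients.\<close>
  define A where "A w = (0::real, fst w *\<^sub>R \<zeta> + (\<Sum>i\<in>I. snd w $ i *\<^sub>R ?n i))" for w :: "real \<times> (real^'p)"
  define G where "G w = (\<chi> j. if j \<in> I then g (z + A w) $ j else snd w $ j)" for w :: "real \<times> (real^'p)"
  define G' where "G' w = (\<chi> j. if j \<in> I then ?n j \<bullet> snd (A w) else snd w $ j)" for w :: "real \<times> (real^'p)"
  have nth: "bounded_linear (\<lambda>w::real \<times> (real^'p). snd w $ j)" for j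
    by (intro bounded_linear_compose[OF bounded_linear_vec_nth] bounded_linear_snd)
  have A: "bounded_linear A"
    unfolding A_def[abs_def]
    by (intro bounded_linear_Pair bounded_linear_zero bounded_linear_add bounded_linear_sum
        bounded_linear_compose[OF bounded_linear_scaleR_left] bounded_linear_fst nth)
  have "Ck_on 2 (\<lambda>w. g (z + A w) $ j) UNIV" for j
    using Ck_on_compose_linear[OF A Ck_on_translate[OF Ck_on_Suc_imp[OF constr_C[of j]], of z]]
    by (simp only: numeral_2_eq_2)
  then have "Ck_on 2 (\<lambda>w. if j \<in> I then g (z + A w) $ j else snd w $ j) UNIV" for j
    using Ck_on_linear[OF nth] by (cases "j \<in> I") (simp_all del: Ck_on.simps)
  then have GC: "Ck_on 2 G UNIV"
    unfolding G_def[abs_def] by (rule Ck_on_vec)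
  have A0: "A (0, 0) = 0" by (simp add: A_def zero_prod_def)
  have G0: "G (0, 0) = 0" using act by (simp add: G_def vec_eq_iff A0)
  have "((\<lambda>w. z + A w) has_derivative A) (at (0, 0))"
    using has_derivative_add[OF has_derivative_const bounded_linear_imp_has_derivative[OF A]] by simp
  moreover have "(constr g j has_derivative (\<lambda>v. fst v * nabla_x (constr g j) z + ?n j \<bullet> snd v)) (at (z + A (0, 0)))" for j
    using constr_deriv[of j z] by (simp add: A0)
  ultimately have "((\<lambda>w. g (z + A w) $ j) has_derivative
      (\<lambda>v. fst (A v) * nabla_x (constr g j) z + ?n j \<bullet> snd (A v))) (at (0, 0))" for j
    by (rule has_derivative_compose)
  then have G1: "((\<lambda>w. g (z + A w) $ j) has_derivative (\<lambda>v. ?n j \<bullet> snd (A v))) (at (0, 0))" for j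
    by (simp add: A_def)
  have GD: "(G has_derivative G') (at (0, 0))"
  proof (rule has_derivative_vecI)
    show "((\<lambda>w. G w $ j) has_derivative (\<lambda>v. G' v $ j)) (at (0, 0))" for j
      using G1[of j] bounded_linear_imp_has_derivative[OF nth[of j]]
      by (cases "j \<in> I") (simp_all add: G_def G'_def)
  qed
  \<comment> \<open>A combination of the gradients that is orthogonal to each of them is orthogonal
    to itself.\<close>
  have sum0: "(\<Sum>i\<in>I. s i *\<^sub>R ?n i) = 0"
    if "\<And>j. j \<in> I \<Longrightarrow> ?n j \<bullet> (\<Sum>i\<in>I. s i *\<^sub>R ?n i) = 0" for s
  proof -
    have "(\<Sum>i\<in>I. s i *\<^sub>R ?n i) \<bullet> (\<Sum>i\<in>I. s i *\<^sub>R ?n i) = (\<Sum>j\<in>I. s j * (?n j \<bullet> (\<Sum>i\<in>I. s i *\<^sub>R ?n i)))"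
      by (simp only: inner_sum_left inner_scaleR_left)
    then show ?thesis using that by simp
  qed
  have G'I: "?n j \<bullet> (\<Sum>i\<in>I. snd w $ i *\<^sub>R ?n i) = 0" if "G' w = 0" "j \<in> I" for w j
    using that \<zeta>[of j] by (auto simp: G'_def vec_eq_iff A_def inner_add_right dest: spec[of _ j])
  have inj: "v = 0" if v: "G' (0, v) = 0" for v
  proof -
    have "(\<Sum>i\<in>I. v $ i *\<^sub>R ?n i) = 0"
      using G'I[OF v] by (intro sum0) simp
    then have "v $ j = 0" if "j \<in> I" for j
      using lin_indep_family_coeff_0[OF ind finite] that by blast
    moreover have "v $ j = 0" if "j \<notin> I" for j
      using v that by (auto simp: G'_def vec_eq_iff dest: spec[of _ j])
    ultimately show ?thesis unfolding vec_eq_iff by (metis zero_index)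
  qed
  obtain s N W where N: "open N" "0 \<in> N" and "open W" "(0, 0) \<in> W" and s0: "s 0 = 0" and sC: "Ck_on 2 s N"
    and sol: "\<And>t. t \<in> N \<Longrightarrow> G (t, s t) = 0"
    and "\<And>t z. (t, z) \<in> W \<Longrightarrow> G (t, z) = 0 \<Longrightarrow> t \<in> N \<and> z = s t"
    by (rule implicit_curve_C2[OF GC G0 GD inj]) blast+
  define s' where "s' = vector_derivative s (at 0)"
  have s': "(s has_vector_derivative s') (at 0)"
    unfolding s'_def using sC N by (intro Ck_on_curve_derivative[of 1]) (simp_all only: Suc_1)
  have curve: "((\<lambda>t. (t, s t)) has_vector_derivative (1, s')) (at 0)"
    using s' by (intro has_vector_derivative_Pair has_vector_derivative_id)
  \<comment> \<open>Since \<zeta> is tangent, the differentiated system makes the first-order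
    correction vanish, and the arc starts with velocity exactly \<zeta>.\<close>
  have "G' (1, s') = 0"
    by (rule implicit_curve_derivative[of N 0 G s s' G', OF N sol s']) (simp_all add: GD s0)
  from G'I[OF this] have p0: "(\<Sum>i\<in>I. s' $ i *\<^sub>R ?n i) = 0"
    by (intro sum0) simp
  define Y where "Y t = snd (z + A (t, s t))" for t
  have YA: "z + A (t, s t) = (x, Y t)" for t
    by (simp add: Y_def A_def z_def)
  have pairC: "Ck_on 2 (\<lambda>t. A (t, s t)) N"
  proof (rule Ck_on_linear_compose[OF A N(1)])
    have "Ck_on 2 (\<lambda>t::real. t) N"
      by (rule Ck_on_2_curveI[OF N(1), where y' = "\<lambda>_. 1" and y'' = "\<lambda>_. 0"])
         (auto intro!: derivative_eq_intros)
    then show "Ck_on 2 (\<lambda>t. (t, s t)) N"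
      by (rule Ck_on_Pair_open[OF N(1) _ sC])
  qed
  show ?thesis
  proof
    show "Ck_on 2 Y N"
      using Ck_on_add_open[OF N(1) Ck_on_const Ck_on_linear_compose[OF bounded_linear_snd N(1) pairC], of "snd z"]
      by (simp only: Y_def[abs_def] snd_add)
    show "Y 0 = y" by (simp add: Y_def A0 s0 z_def)
    have "((\<lambda>t. snd (z + A (t, s t))) has_vector_derivative snd (A (1, s'))) (at 0)"
      by (intro bounded_linear.has_vector_derivative[OF bounded_linear_snd]
          has_vector_derivative_add[OF has_vector_derivative_const, simplified]
          bounded_linear.has_vector_derivative[OF A] curve)
    moreover have "snd (A (1, s')) = \<zeta>" by (simp add: A_def p0)
    ultimately show "(Y has_vector_derivative \<zeta>) (at 0)" unfolding Y_def by simp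
    show "g (x, Y t) $ j = 0" if "t \<in> N" "j \<in> I" for t j
      using sol[OF that(1)] that(2) unfolding YA[symmetric]
      by (auto simp: G_def vec_eq_iff dest: spec[of _ j])
  qed (rule N)+
qed

text \<open>The arc keeps \<open>I\<close> active, and \<open>g\<^sub>q\<close> becomes negative for
  small t > 0 because its derivative along \<zeta> is negative. On the arc the Lagrangian equals the
  objective and is stationary at the start, so a negative second derivative would make nearby
  feasible points better.\<close>

lemma second_order_necessary:
  assumes lm: "local_minimizer f g x y" and z: "z = (x, y)"
    and J: "J0 g z = insert q I"
    and ind: "lin_indep_family (\<lambda>j. nabla_y (constr g j) z) I"
    and u: "\<And>j. j \<notin> I \<Longrightarrow> u $ j = 0"
    and stat: "nabla_y f z + (\<Sum>j\<in>I. u $ j *\<^sub>R nabla_y (constr g j) z) = 0"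
    and \<zeta>: "\<And>j. j \<in> I \<Longrightarrow> nabla_y (constr g j) z \<bullet> \<zeta> = 0" "nabla_y (constr g q) z \<bullet> \<zeta> < 0"
  shows "0 \<le> (\<zeta> v* hess_yy (lagr f g u) z) \<bullet> \<zeta>"
proof (rule ccontr)
  assume neg: "\<not> ?thesis"
  obtain e where e: "e > 0" "\<And>y'. feasible g x y' \<Longrightarrow> dist y' y < e \<Longrightarrow> f (x, y) \<le> f (x, y')"
    and feas: "\<And>j. g z $ j \<le> 0"
    using lm z by (auto simp: local_minimizer_def feasible_def)
  have act: "g (x, y) $ j = 0" if "j \<in> I" for j
    using J that z by (auto simp: J0_def)
  obtain Y N where N: "open N" "0 \<in> N" and YC: "Ck_on 2 Y N" and Y0: "Y 0 = y"
    and Yd: "(Y has_vector_derivative \<zeta>) (at 0)"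
    and Yact: "\<And>t j. t \<in> N \<Longrightarrow> j \<in> I \<Longrightarrow> g (x, Y t) $ j = 0"
    by (rule feasible_arc[OF ind[unfolded z] act \<zeta>(1)[unfolded z]]) blast+
  define Y' where "Y' t = frechet_derivative Y (at t) 1" for t
  have YC2: "Ck_on (Suc 1) Y N" using YC by (simp only: Suc_1)
  have Y': "(Y has_vector_derivative Y' t) (at t)" if "t \<in> N" for t
    using Ck_on_curve_derivative[OF YC2 that] frechet_derivative_curve[of Y _ t 1]
    by (simp add: Y'_def)
  have "Y' 0 = \<zeta>" using frechet_derivative_curve[OF Yd] by (simp add: Y'_def)
  have "Ck_on 1 Y' N" using YC2 unfolding Y'_def[abs_def] Ck_on.simps(2)[of 1] by blast
  then obtain Y2 where Y2: "(Y' has_vector_derivative Y2) (at 0)"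
    using Ck_on_curve_derivative[of 0 Y' N 0] N(2) by (simp only: One_nat_def) blast
  let ?L = "lagr f g u"
  have Ld: "?L differentiable (at w)" for w by (rule Ck_on_imp_differentiable[OF lagr_C])
  have pair: "((\<lambda>t. (x, Y t)) has_derivative (\<lambda>h. (0, h *\<^sub>R Y' t))) (at t)" if "t \<in> N" for t
    using Y'[OF that] by (auto simp: has_vector_derivative_def intro!: derivative_eq_intros)
  have chain: "((\<lambda>t. h (x, Y t)) has_real_derivative nabla_y h (x, Y t) \<bullet> Y' t) (at t)"
    if "t \<in> N" "\<And>w. h differentiable (at w)" for h :: "real \<times> (real^'m) \<Rightarrow> real" and t
    using has_derivative_compose[OF pair[OF that(1)] nabla_has_derivative[OF that(2)]]
    by (simp add: has_field_derivative_def mult_commute_abs)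
  have L0: "nabla_y ?L (x, Y 0) = 0"
    using stat sum_support[of I u "\<lambda>j. nabla_y (constr g j) z"] u by (simp add: nabla_lagr[OF f_diff g_diff] Y0 z)
  have "((\<lambda>t. nabla_y ?L (x, Y t)) has_derivative (\<lambda>h. (h *\<^sub>R \<zeta>) v* hess_yy ?L z)) (at 0)"
    using has_derivative_compose[OF pair[OF N(2)] nabla_y_lagr_deriv[of u]] \<open>Y' 0 = \<zeta>\<close>
    by (simp add: z Y0)
  \<comment> \<open>The acceleration \<open>Y2\<close> of the arc drops out because the gradient of
    the Lagrangian vanishes at the base point.\<close>
  from has_derivative_inner[OF this Y2[unfolded has_vector_derivative_def]]
  have "((\<lambda>t. nabla_y ?L (x, Y t) \<bullet> Y' t) has_real_derivative (\<zeta> v* hess_yy ?L z) \<bullet> \<zeta>) (at 0)"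
    unfolding has_field_derivative_def
    by (rule back_subst[of "\<lambda>D. (_ has_derivative D) _"])
       (simp add: fun_eq_iff L0 \<open>Y' 0 = \<zeta>\<close> scaleR_vector_matrix_assoc)
  then have "\<forall>\<^sub>F t in at_right 0. nabla_y ?L (x, Y t) \<bullet> Y' t < nabla_y ?L (x, Y 0) \<bullet> Y' 0"
    using neg by (intro negative_derivative_eventually_less) auto
  then obtain d where d: "d > 0" "\<And>t. 0 < t \<Longrightarrow> t < d \<Longrightarrow> nabla_y ?L (x, Y t) \<bullet> Y' t < 0"
    by (auto simp: L0 eventually_at_right_field)
  obtain r where r: "r > 0" "ball 0 r \<subseteq> N" using N open_contains_ball by blast
  have Ldec: "?L (x, Y t) < ?L (x, Y 0)" if t: "0 < t" "t < min d r" for t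
  proof (rule DERIV_neg_imp_decreasing_open[OF t(1)])
    have inN: "s \<in> N" if "0 \<le> s" "s \<le> t" for s using r(2) t that by (auto simp: dist_real_def)
    show "\<exists>D. ((\<lambda>t. ?L (x, Y t)) has_real_derivative D) (at s) \<and> D < 0" if "0 < s" "s < t" for s
      using chain[OF inN Ld, of s] d(2)[of s] that t by auto
    show "continuous_on {0..t} (\<lambda>t. ?L (x, Y t))"
      by (rule continuous_at_imp_continuous_on) (auto intro!: DERIV_isCont[OF chain[OF inN Ld]])
  qed
  have Ylim: "(Y \<longlongrightarrow> y) (at_right 0)"
    using has_vector_derivative_continuous[OF Yd] Y0
    by (metis continuous_at filterlim_at_split)
  have "\<forall>\<^sub>F t in at_right 0. t < min d r" "\<forall>\<^sub>F t in at_right (0::real). t > 0"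
    using d(1) r(1) by (auto simp: eventually_at_right_field intro: exI[of _ "min d r"])
  moreover have "\<forall>\<^sub>F t in at_right 0. \<forall>j. g (x, Y t) $ j \<le> 0"
  proof (rule eventually_all_finite)
    fix j
    have "g z $ j = 0 \<longleftrightarrow> j = q \<or> j \<in> I"
      using eqset_imp_iff[OF J, of j] by (simp add: J0_def)
    then consider "j \<in> I" | "j = q" | "g z $ j < 0"
      using feas[of j] by (metis order_le_less)
    then show "\<forall>\<^sub>F t in at_right 0. g (x, Y t) $ j \<le> 0"
    proof cases
      case 1
      have "\<forall>\<^sub>F t in at_right 0. t \<in> N"
        using eventually_at_in_open'[OF N] by (simp add: eventually_at_split)
      then show ?thesis by eventually_elim (simp add: Yact 1)
    next
      case 2
      have "\<forall>\<^sub>F t in at_right 0. g (x, Y t) $ q < g (x, Y 0) $ q"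
        using \<zeta>(2) \<open>Y' 0 = \<zeta>\<close> by (intro negative_derivative_eventually_less[OF chain[OF N(2) constr_diff]]) (simp add: Y0 z)
      moreover have "g (x, Y 0) $ q = 0"
        using eqset_imp_iff[OF J, of q] by (simp add: Y0 z J0_def)
      ultimately show ?thesis using 2 by (auto elim: eventually_mono)
    next
      case 3
      have "((\<lambda>t. g (x, Y t) $ j) \<longlongrightarrow> g z $ j) (at_right 0)"
        unfolding z by (intro tendsto_intros isCont_tendsto_compose[OF g_isCont] Ylim)
      from order_tendstoD(2)[OF this 3] show ?thesis by (rule eventually_mono) simp
    qed
  qed
  moreover have "\<forall>\<^sub>F t in at_right 0. dist (Y t) y < e"
    using Ylim e(1) by (rule tendstoD)
  ultimately have "\<forall>\<^sub>F t in at_right (0::real). False"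
  proof eventually_elim
    case (elim t)
    have "t \<in> N" using elim r(2) by (auto simp: dist_real_def)
    have ug: "u \<bullet> g (x, Y s) = 0" if "s \<in> N" for s
      using sum_support[of I u "\<lambda>j. g (x, Y s) $ j"] u Yact[OF that] by (simp add: inner_vec_expand)
    have "f (x, Y t) < f (x, y)"
      using Ldec[of t] elim ug[OF \<open>t \<in> N\<close>] ug[OF N(2)] Y0 by simp
    moreover have "f (x, y) \<le> f (x, Y t)"
      using e(2)[of "Y t"] elim by (simp add: feasible_def)
    ultimately show False by simp
  qed
  then show False by simp
qed

end

section \<open>LICQ points with and without strict complementarity\<close>

section \<open>Points of Type 1 and Type 2\<close>

context lower_level
begin

lemma star_system_iff:
  "star_system F g h z w \<xi> \<longleftrightarrow>
     nabla_x F z - hess_xy h z \<bullet> w + nabla_x (constr_comb \<xi> g) z = 0 \<and>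
     nabla_y F z = hess_yy h z *v w - (\<Sum>j\<in>UNIV. \<xi> $ j *\<^sub>R nabla_y (constr g j) z) \<and>
     (\<forall>j. j \<notin> J0 g z \<longrightarrow> \<xi> $ j = 0)"
proof -
  have "0 = a - b + c \<longleftrightarrow> a = b - c" for a b c :: "real^'m"
    by (auto simp: algebra_simps)
  then show ?thesis
    unfolding star_system_def nabla_constr_comb[OF g_diff] by auto
qed

text \<open>\<open>\<xi>\<^sub>q\<close> can be prescribed: its gradient term moves to the
  right-hand side of the saddle point system on \<open>I\<close>.\<close>

lemma dual_solution:
  assumes reg: "nonsingular_on H (tangent g I z)" and q: "q \<notin> I"
  obtains w \<xi> where "b = H *v w - (\<Sum>j\<in>UNIV. \<xi> $ j *\<^sub>R nabla_y (constr g j) z)"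
    "\<And>j. j \<in> I \<Longrightarrow> nabla_y (constr g j) z \<bullet> w = 0" "\<xi> $ q = c"
    "\<And>j. j \<notin> insert q I \<Longrightarrow> \<xi> $ j = 0"
proof -
  let ?n = "\<lambda>j. nabla_y (constr g j) z"
  obtain w d where w: "H *v w = (b + c *\<^sub>R ?n q) + (\<Sum>j\<in>I. d j *\<^sub>R ?n j)" "\<And>j. j \<in> I \<Longrightarrow> ?n j \<bullet> w = 0"
    using saddle_solvable[OF reg[unfolded tangent_def] finite] by blast
  define \<xi> :: "real^'p" where "\<xi> = (\<chi> j. if j = q then c else if j \<in> I then d j else 0)"
  have "(\<Sum>j\<in>UNIV. \<xi> $ j *\<^sub>R ?n j) = (\<Sum>j\<in>insert q I. \<xi> $ j *\<^sub>R ?n j)"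
    by (rule sum_support) (simp add: \<xi>_def)
  also have "\<dots> = c *\<^sub>R ?n q + (\<Sum>j\<in>I. \<xi> $ j *\<^sub>R ?n j)"
    using q by (simp add: \<xi>_def)
  also have "(\<Sum>j\<in>I. \<xi> $ j *\<^sub>R ?n j) = (\<Sum>j\<in>I. d j *\<^sub>R ?n j)"
    using q by (intro sum.cong) (auto simp: \<xi>_def)
  finally show ?thesis
    using w by (intro that[of w \<xi>]) (auto simp: \<xi>_def)
qed

lemma dual_solution_active:
  assumes reg: "nonsingular_on H (tangent g I z)"
  obtains w \<xi> where "b = H *v w - (\<Sum>j\<in>UNIV. \<xi> $ j *\<^sub>R nabla_y (constr g j) z)"
    "\<And>j. j \<in> I \<Longrightarrow> nabla_y (constr g j) z \<bullet> w = 0"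
    "\<And>j. j \<notin> I \<Longrightarrow> \<xi> $ j = 0"
proof -
  let ?n = "\<lambda>j. nabla_y (constr g j) z"
  obtain w d where w: "H *v w = b + (\<Sum>j\<in>I. d j *\<^sub>R ?n j)" "\<And>j. j \<in> I \<Longrightarrow> ?n j \<bullet> w = 0"
    using saddle_solvable[OF reg[unfolded tangent_def] finite] by blast
  define \<xi> :: "real^'p" where "\<xi> = (\<chi> j. if j \<in> I then d j else 0)"
  have "(\<Sum>j\<in>UNIV. \<xi> $ j *\<^sub>R ?n j) = (\<Sum>j\<in>I. \<xi> $ j *\<^sub>R ?n j)"
    by (rule sum_support) (simp add: \<xi>_def)
  also have "\<dots> = (\<Sum>j\<in>I. d j *\<^sub>R ?n j)"
    by (intro sum.cong) (auto simp: \<xi>_def)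
  finally show ?thesis
    using w by (intro that[of w \<xi>]) (auto simp: \<xi>_def)
qed

lemma stationary_E_branch:
  fixes xb :: real and yb :: "real^'m"
  assumes z: "z = (xb, yb)" and st: "stationary_multiplier f g z u"
    and I: "I \<subseteq> J0 g z" and u: "\<And>j. j \<notin> I \<Longrightarrow> u $ j = 0"
    and ind: "lin_indep_family (\<lambda>j. nabla_y (constr g j) z) I"
    and reg: "nonsingular_on (hess_yy (lagr f g u) z) (tangent g I z)"
  obtains y v W where "E_branch f g I xb yb u y v" "open W" "(xb, yb, u) \<in> W"
    "\<And>x y' v. (x, y', v) \<in> W \<Longrightarrow> (\<And>j. j \<notin> I \<Longrightarrow> v $ j = 0) \<Longrightarrow>
       nabla_y f (x, y') + (\<Sum>j\<in>I. v $ j *\<^sub>R nabla_y (constr g j) (x, y')) = 0 \<Longrightarrow>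
       (\<And>j. j \<in> I \<Longrightarrow> g (x, y') $ j = 0) \<Longrightarrow> y' = y x"
proof -
  have "(\<Sum>j\<in>J0 g z. u $ j *\<^sub>R nabla_y (constr g j) z) = (\<Sum>j\<in>I. u $ j *\<^sub>R nabla_y (constr g j) z)"
    by (rule sum.mono_neutral_right) (use I u in auto)
  then have "nabla_y f z + (\<Sum>j\<in>I. u $ j *\<^sub>R nabla_y (constr g j) z) = 0"
    using st by (simp add: stationary_multiplier_def)
  moreover have "g z $ j = 0" if "j \<in> I" for j
    using I that by (auto simp: J0_def)
  ultimately show ?thesis
    using E_branch_exists[of I u xb yb, folded z, OF u _ _ ind reg] that by blast
qed

text \<open>With \<open>w\<close> tangent and \<xi> supported on the active set, both corrections in
  \<open>KKT_E_branch_derivative\<close> vanish. The derivative of \<open>F\<close> is then the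
  residual of the x-equation.\<close>

lemma type1_equivalence:
  assumes lm: "local_minimizer f g xb yb" and z: "z = (xb, yb)" and J: "J = J0 g z"
    and T: "type1 f g xb yb"
  shows "\<exists>u. KKT_multipliers f g z = {u} \<and>
        ((\<exists>w xi. star_system F g (lagr f g u) z w xi \<and>
            (\<forall>j\<in>J. nabla_y (constr g j) z \<bullet> w = 0)) \<longleftrightarrow>
         (\<exists>y v. E_branch f g J xb yb u y v \<and> Fdot F xb yb y = 0))"
proof -
  obtain u where licq: "LICQ g z" and st: "stationary_multiplier f g z u"
    and reg: "nonsingular_on (hess_yy (lagr f g u) z) (tangent g J z)"
    using T by (auto simp: type1_def z J)
  note ind = licq[unfolded LICQ_def, folded J]
  have u: "u $ j = 0" if "j \<notin> J" for j using st that J by (simp add: stationary_multiplier_def)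
  have Fdot: "Fdot F xb yb y = nabla_x F z - hess_xy (lagr f g u) z \<bullet> w + nabla_x (constr_comb \<xi> g) z"
    if br: "E_branch f g J xb yb u y v"
      and b: "nabla_y F z = hess_yy (lagr f g u) z *v w - (\<Sum>j\<in>UNIV. \<xi> $ j *\<^sub>R nabla_y (constr g j) z)"
      and w: "\<And>j. j \<in> J \<Longrightarrow> nabla_y (constr g j) z \<bullet> w = 0" and \<xi>: "\<And>j. j \<notin> J \<Longrightarrow> \<xi> $ j = 0" for y v w \<xi>
  proof -
    obtain y' v' where y': "(y has_vector_derivative y') (at xb)"
      and eq: "nabla_x F z + nabla_y F z \<bullet> y' = (nabla_x F z - hess_xy (lagr f g u) z \<bullet> w + nabla_x (constr_comb \<xi> g) z)
       - (\<Sum>j\<in>J. v' j * (nabla_y (constr g j) z \<bullet> w))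
       - (\<Sum>j\<in>UNIV - J. \<xi> $ j * (nabla_x (constr g j) z + nabla_y (constr g j) z \<bullet> y'))"
      using KKT_E_branch_derivative[OF br u z b, of "nabla_x F z"] by blast
    show ?thesis
      unfolding Fdot_eq[OF y' z] eq using w \<xi> by simp
  qed
  have "(\<exists>w xi. star_system F g (lagr f g u) z w xi \<and> (\<forall>j\<in>J. nabla_y (constr g j) z \<bullet> w = 0)) \<longleftrightarrow>
         (\<exists>y v. E_branch f g J xb yb u y v \<and> Fdot F xb yb y = 0)" (is "?L \<longleftrightarrow> ?R")
  proof
    assume ?L
    then obtain w \<xi> where *: "star_system F g (lagr f g u) z w \<xi>" "\<And>j. j \<in> J \<Longrightarrow> nabla_y (constr g j) z \<bullet> w = 0"
      by blast
    obtain y v where br: "E_branch f g J xb yb u y v"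
      by (rule stationary_E_branch[OF z st equalityD1[OF J] u ind reg]) (assumption | erule that)+
    have "Fdot F xb yb y = 0"
      using Fdot[OF br, of w \<xi>] * by (simp add: star_system_iff J)
    with br show ?R by blast
  next
    assume ?R
    then obtain y v where br: "E_branch f g J xb yb u y v" "Fdot F xb yb y = 0" by blast
    obtain w \<xi> where s: "nabla_y F z = hess_yy (lagr f g u) z *v w - (\<Sum>j\<in>UNIV. \<xi> $ j *\<^sub>R nabla_y (constr g j) z)"
      "\<And>j. j \<in> J \<Longrightarrow> nabla_y (constr g j) z \<bullet> w = 0" "\<And>j. j \<notin> J \<Longrightarrow> \<xi> $ j = 0"
      by (rule dual_solution_active[OF reg]) blast
    from Fdot[OF br(1) s] br(2) s show ?L
      by (auto simp: star_system_iff J)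
  qed
  then show ?thesis using LICQ_KKT[OF lm z licq st] by blast
qed

text \<open>The difference \<eta> of the two velocities is tangent to the constraints in
  \<open>I\<close>, moves \<open>g\<^sub>q\<close> at rate \<open>a\<close>, and gives the Hessian
  form the value \<open>vh q * a\<close>. The second order condition makes this value
  nonnegative.\<close>

lemma type2_sign:
  assumes lm: "local_minimizer f g xb yb" and z: "z = (xb, yb)"
    and J: "J0 g z = insert q I" "q \<notin> I"
    and ind: "lin_indep_family (\<lambda>j. nabla_y (constr g j) z) I"
    and st: "stationary_multiplier f g z u" and u: "\<And>j. j \<notin> I \<Longrightarrow> u $ j = 0"
    and reg: "nonsingular_on (hess_yy (lagr f g u) z) (tangent g I z)"
    and yt: "hess_xy (lagr f g u) z + yt v* hess_yy (lagr f g u) z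
       + (\<Sum>j\<in>I. vt j *\<^sub>R nabla_y (constr g j) z) = 0"
      "\<And>j. j \<in> I \<Longrightarrow> nabla_x (constr g j) z + nabla_y (constr g j) z \<bullet> yt = 0"
    and yh: "hess_xy (lagr f g u) z + yh v* hess_yy (lagr f g u) z
       + (\<Sum>j\<in>insert q I. vh j *\<^sub>R nabla_y (constr g j) z) = 0"
      "\<And>j. j \<in> insert q I \<Longrightarrow> nabla_x (constr g j) z + nabla_y (constr g j) z \<bullet> yh = 0"
    and a: "a = nabla_x (constr g q) z + nabla_y (constr g q) z \<bullet> yt" "a \<noteq> 0"
  shows "vh q * a > 0"
proof -
  let ?n = "\<lambda>j. nabla_y (constr g j) z" and ?H = "hess_yy (lagr f g u) z"
  define \<eta> where "\<eta> = yt - yh"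
  have \<eta>I: "?n j \<bullet> \<eta> = 0" if "j \<in> I" for j
    using yt(2)[OF that] yh(2)[of j] that by (simp add: \<eta>_def inner_diff_right)
  have \<eta>q: "?n q \<bullet> \<eta> = a"
    using a(1) yh(2)[of q] by (simp add: \<eta>_def inner_diff_right)
  have "\<eta> v* ?H + (\<Sum>j\<in>I. (vt j - vh j) *\<^sub>R ?n j) - vh q *\<^sub>R ?n q
      = (hess_xy (lagr f g u) z + yt v* ?H + (\<Sum>j\<in>I. vt j *\<^sub>R ?n j))
        - (hess_xy (lagr f g u) z + yh v* ?H + (\<Sum>j\<in>insert q I. vh j *\<^sub>R ?n j))"
    using J(2) by (simp add: \<eta>_def vector_matrix_mult_diff_distrib scaleR_diff_left sum_subtractf)
  then have \<eta>H: "\<eta> v* ?H = vh q *\<^sub>R ?n q - (\<Sum>j\<in>I. (vt j - vh j) *\<^sub>R ?n j)"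
    unfolding yt(1) yh(1) by (simp add: algebra_simps)
  have inner: "(\<eta> v* ?H) \<bullet> \<zeta> = vh q * (?n q \<bullet> \<zeta>)" if "\<And>j. j \<in> I \<Longrightarrow> ?n j \<bullet> \<zeta> = 0" for \<zeta>
    unfolding \<eta>H using that by (simp add: inner_diff_left inner_sum_left)
  \<comment> \<open>Otherwise \<eta> solves the homogeneous saddle point system on \<open>I\<close>
    and is 0, against its nonzero rate \<open>a\<close>.\<close>
  have "vh q \<noteq> 0"
  proof
    assume "vh q = 0"
    then have "\<eta> = 0"
      using inner \<eta>I by (intro saddle_injective[OF reg]) (auto simp: tangent_def)
    then show False using \<eta>q a(2) by simp
  qed
  have "(\<Sum>j\<in>J0 g z. u $ j *\<^sub>R ?n j) = (\<Sum>j\<in>I. u $ j *\<^sub>R ?n j)"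
    by (rule sum.mono_neutral_right) (use J u in auto)
  then have stat: "nabla_y f z + (\<Sum>j\<in>I. u $ j *\<^sub>R ?n j) = 0"
    using st by (simp add: stationary_multiplier_def)
  note soc = second_order_necessary[OF lm z J(1) ind u stat]
  \<comment> \<open>The second order condition needs a direction in which \<open>g\<^sub>q\<close>
    decreases. One of \<eta> and -\<eta> is such, and the form is even.\<close>
  have "0 \<le> (\<eta> v* ?H) \<bullet> \<eta>"
  proof (cases "a < 0")
    case True
    then show ?thesis using \<eta>I \<eta>q by (intro soc) auto
  next
    case False
    then have "0 \<le> ((- \<eta>) v* ?H) \<bullet> (- \<eta>)"
      using \<eta>I \<eta>q a(2) by (intro soc) auto
    moreover have "(- \<eta>) v* ?H = - (\<eta> v* ?H)"
      using scaleR_vector_matrix_assoc[of "-1" \<eta> ?H] by simp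
    ultimately show ?thesis by simp
  qed
  then have "0 \<le> vh q * a" using inner[of \<eta>] \<eta>I \<eta>q by simp
  then show ?thesis using \<open>vh q \<noteq> 0\<close> a(2) by (simp add: less_le)
qed

lemma type2_equivalence:
  assumes lm: "local_minimizer f g xb yb" and z: "z = (xb, yb)" and J: "J = J0 g z"
    and T: "type2 f g xb yb"
  shows "\<exists>u q. KKT_multipliers f g z = {u} \<and> {j \<in> J. u $ j = 0} = {q} \<and>
        ((\<exists>w xi. star_system F g (lagr f g u) z w xi \<and>
            (\<forall>j\<in>J - {q}. nabla_y (constr g j) z \<bullet> w = 0) \<and>
            nabla_y (constr g q) z \<bullet> w \<le> 0 \<and> xi $ q \<ge> 0) \<longleftrightarrow>
         (\<exists>yt ut yh uh. E_branch f g (J - {q}) xb yb u yt ut \<and> E_branch f g J xb yb u yh uh \<and>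
            (gdot g q xb yt > 0 \<longrightarrow> Fdot F xb yb yt \<le> 0 \<and> Fdot F xb yb yh \<ge> 0) \<and>
            (gdot g q xb yt < 0 \<longrightarrow> Fdot F xb yb yt \<ge> 0 \<and> Fdot F xb yb yh \<le> 0)))"
proof -
  let ?n = "\<lambda>j. nabla_y (constr g j) z"
  obtain u q y0 v0 where licq: "LICQ g z" and st: "stationary_multiplier f g z u"
    and q: "{j \<in> J. u $ j = 0} = {q}"
    and regJ: "nonsingular_on (hess_yy (lagr f g u) z) (tangent g J z)"
    and regI: "nonsingular_on (hess_yy (lagr f g u) z) (tangent g (J - {q}) z)"
    and y0: "E_branch f g (J - {q}) xb yb u y0 v0" "gdot g q xb y0 \<noteq> 0"
    using T by (auto simp: type2_def z J)
  define I where "I = J - {q}"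
  have qJ: "q \<in> J" "u $ q = 0" using q by auto
  have JI: "J0 g z = insert q I" "q \<notin> I" "J = insert q I" using qJ by (auto simp: I_def J)
  have uJ: "u $ j = 0" if "j \<notin> J" for j using st that J by (simp add: stationary_multiplier_def)
  have uI: "u $ j = 0" if "j \<notin> I" for j using uJ qJ that by (auto simp: I_def)
  note indJ = licq[unfolded LICQ_def, folded J]
  have indI: "lin_indep_family ?n I"
    using lin_indep_family_mono[OF indJ] by (auto simp: I_def)
  let ?h = "hess_xy (lagr f g u) z" and ?H = "hess_yy (lagr f g u) z"
  \<comment> \<open>\<open>c\<close> will be the velocity of the multiplier \<open>u\<^sub>q\<close>
    along the branch on which \<open>g\<^sub>q\<close> stays active.\<close>
  have Fdot: "\<exists>c. c * gdot g q xb yt > 0 \<and> gdot g q xb yt \<noteq> 0 \<and>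
       Fdot F xb yb yt = (nabla_x F z - ?h \<bullet> w + nabla_x (constr_comb \<xi> g) z) - \<xi> $ q * gdot g q xb yt \<and>
       Fdot F xb yb yh = (nabla_x F z - ?h \<bullet> w + nabla_x (constr_comb \<xi> g) z) - c * (?n q \<bullet> w)"
    if bt: "E_branch f g I xb yb u yt ut" and bh: "E_branch f g J xb yb u yh uh"
      and b: "nabla_y F z = ?H *v w - (\<Sum>j\<in>UNIV. \<xi> $ j *\<^sub>R ?n j)"
      and w: "\<And>j. j \<in> I \<Longrightarrow> ?n j \<bullet> w = 0" and \<xi>: "\<And>j. j \<notin> J \<Longrightarrow> \<xi> $ j = 0"
    for yt ut yh uh w \<xi>
  proof -
    obtain t' vt where t: "(yt has_vector_derivative t') (at xb)"
      "?h + t' v* ?H + (\<Sum>j\<in>I. vt j *\<^sub>R ?n j) = 0"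
      "\<And>j. j \<in> I \<Longrightarrow> nabla_x (constr g j) z + ?n j \<bullet> t' = 0"
      "nabla_x F z + nabla_y F z \<bullet> t' = (nabla_x F z - ?h \<bullet> w + nabla_x (constr_comb \<xi> g) z)
       - (\<Sum>j\<in>I. vt j * (?n j \<bullet> w))
       - (\<Sum>j\<in>UNIV - I. \<xi> $ j * (nabla_x (constr g j) z + ?n j \<bullet> t'))"
      using KKT_E_branch_derivative[OF bt uI z b, of "nabla_x F z"] by blast
    obtain h' vh where h: "(yh has_vector_derivative h') (at xb)"
      "?h + h' v* ?H + (\<Sum>j\<in>J. vh j *\<^sub>R ?n j) = 0"
      "\<And>j. j \<in> J \<Longrightarrow> nabla_x (constr g j) z + ?n j \<bullet> h' = 0"
      "nabla_x F z + nabla_y F z \<bullet> h' = (nabla_x F z - ?h \<bullet> w + nabla_x (constr_comb \<xi> g) z)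
       - (\<Sum>j\<in>J. vh j * (?n j \<bullet> w))
       - (\<Sum>j\<in>UNIV - J. \<xi> $ j * (nabla_x (constr g j) z + ?n j \<bullet> h'))"
      using KKT_E_branch_derivative[OF bh uJ z b, of "nabla_x F z"] by blast
    obtain s' vs where s: "(y0 has_vector_derivative s') (at xb)"
      "?h + s' v* ?H + (\<Sum>j\<in>I. vs j *\<^sub>R ?n j) = 0"
      "\<And>j. j \<in> I \<Longrightarrow> nabla_x (constr g j) z + ?n j \<bullet> s' = 0"
      using E_branch_derivative[OF y0(1)[folded I_def] uI z] by blast
    have yx: "yt xb = yb" "y0 xb = yb" using bt y0(1) by (auto simp: E_branch_def)
    \<comment> \<open>Type 2 asserts a nonzero rate of \<open>g\<^sub>q\<close> for some branch
      only. The differentiated system determines the velocity, so every branch has the same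
      rate.\<close>
    have "s' - t' = 0"
    proof (rule saddle_injective[OF regI[folded I_def]])
      show "s' - t' \<in> tangent g I z"
        using s(3) t(3) by (simp add: tangent_def inner_diff_right) (metis add_left_cancel)
      fix \<zeta> assume "\<zeta> \<in> tangent g I z"
      then have 0: "(\<Sum>j\<in>I. c j *\<^sub>R ?n j) \<bullet> \<zeta> = 0" for c by (simp add: tangent_def inner_sum_left)
      have "(?h + s' v* ?H) \<bullet> \<zeta> = 0" "(?h + t' v* ?H) \<bullet> \<zeta> = 0"
        using arg_cong[OF s(2), of "\<lambda>a. a \<bullet> \<zeta>"] arg_cong[OF t(2), of "\<lambda>a. a \<bullet> \<zeta>"] 0
        by (simp_all add: inner_add_left)
      then show "((s' - t') v* ?H) \<bullet> \<zeta> = 0"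
        by (simp add: vector_matrix_mult_diff_distrib inner_diff_left inner_add_left)
    qed
    then have gd: "gdot g q xb yt = nabla_x (constr g q) z + ?n q \<bullet> t'" "gdot g q xb yt \<noteq> 0"
      using gdot_eq[OF t(1) yx(1) z] gdot_eq[OF s(1) yx(2) z, of q] y0(2) by auto
    have "vh q * gdot g q xb yt > 0"
      using type2_sign[OF lm z JI(1,2) indI st uI regI[folded I_def] t(2,3) h(2,3)[unfolded JI(3)] gd] .
    moreover have "(\<Sum>j\<in>UNIV - I. \<xi> $ j * (nabla_x (constr g j) z + ?n j \<bullet> t')) = \<xi> $ q * gdot g q xb yt"
    proof -
      have "(\<Sum>j\<in>UNIV - I. \<xi> $ j * (nabla_x (constr g j) z + ?n j \<bullet> t'))
          = (\<Sum>j\<in>{q}. \<xi> $ j * (nabla_x (constr g j) z + ?n j \<bullet> t'))"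
        by (rule sum.mono_neutral_right) (use \<xi> JI in auto)
      then show ?thesis by (simp add: gd)
    qed
    moreover have "(\<Sum>j\<in>J. vh j * (?n j \<bullet> w)) = vh q * (?n q \<bullet> w)"
      using w JI by simp
    ultimately show ?thesis
      using Fdot_eq[OF t(1) z, of F] Fdot_eq[OF h(1) z, of F] t(4) h(4) w \<xi> gd(2)
      by (intro exI[of _ "vh q"]) simp
  qed
  have "(\<exists>w xi. star_system F g (lagr f g u) z w xi \<and> (\<forall>j\<in>I. ?n j \<bullet> w = 0) \<and>
            ?n q \<bullet> w \<le> 0 \<and> xi $ q \<ge> 0) \<longleftrightarrow>
         (\<exists>yt ut yh uh. E_branch f g I xb yb u yt ut \<and> E_branch f g J xb yb u yh uh \<and>
            (gdot g q xb yt > 0 \<longrightarrow> Fdot F xb yb yt \<le> 0 \<and> Fdot F xb yb yh \<ge> 0) \<and>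
            (gdot g q xb yt < 0 \<longrightarrow> Fdot F xb yb yt \<ge> 0 \<and> Fdot F xb yb yh \<le> 0))" (is "?L \<longleftrightarrow> ?R")
  proof
    assume ?L
    then obtain w \<xi> where *: "star_system F g (lagr f g u) z w \<xi>" "\<And>j. j \<in> I \<Longrightarrow> ?n j \<bullet> w = 0"
      "?n q \<bullet> w \<le> 0" "\<xi> $ q \<ge> 0"
      by blast
    obtain yh uh where bh: "E_branch f g J xb yb u yh uh"
      by (rule stationary_E_branch[OF z st equalityD1[OF J] uJ indJ regJ]) (assumption | erule that)+
    obtain c where c: "c * gdot g q xb y0 > 0" "Fdot F xb yb y0 = - (\<xi> $ q * gdot g q xb y0)"
      "Fdot F xb yb yh = - (c * (?n q \<bullet> w))"
      using Fdot[OF y0(1)[folded I_def] bh, of w \<xi>] * by (auto simp: star_system_iff J)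
    have "Fdot F xb yb y0 \<le> 0 \<and> Fdot F xb yb yh \<ge> 0" if p: "gdot g q xb y0 > 0"
    proof -
      have "c > 0" using c(1) p by (simp add: zero_less_mult_iff)
      then show ?thesis using *(3,4) p unfolding c(2,3) by (simp add: mult_le_0_iff)
    qed
    moreover have "Fdot F xb yb y0 \<ge> 0 \<and> Fdot F xb yb yh \<le> 0" if p: "gdot g q xb y0 < 0"
    proof -
      have "c < 0" using c(1) p by (simp add: zero_less_mult_iff)
      then show ?thesis using *(3,4) p unfolding c(2,3) by (simp add: mult_le_0_iff zero_le_mult_iff)
    qed
    ultimately have "(gdot g q xb y0 > 0 \<longrightarrow> Fdot F xb yb y0 \<le> 0 \<and> Fdot F xb yb yh \<ge> 0) \<and>
       (gdot g q xb y0 < 0 \<longrightarrow> Fdot F xb yb y0 \<ge> 0 \<and> Fdot F xb yb yh \<le> 0)"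
      by blast
    with bh y0(1)[folded I_def] show ?R by blast
  next
    assume ?R
    then obtain yt ut yh uh where br: "E_branch f g I xb yb u yt ut" "E_branch f g J xb yb u yh uh"
      and sgn: "gdot g q xb yt > 0 \<longrightarrow> Fdot F xb yb yt \<le> 0 \<and> Fdot F xb yb yh \<ge> 0"
        "gdot g q xb yt < 0 \<longrightarrow> Fdot F xb yb yt \<ge> 0 \<and> Fdot F xb yb yh \<le> 0" by blast
    \<comment> \<open>This value of \<open>\<xi>\<^sub>q\<close> is the one for which the residual
      of the x-equation vanishes.\<close>
    obtain w \<xi> where s: "nabla_y F z = ?H *v w - (\<Sum>j\<in>UNIV. \<xi> $ j *\<^sub>R ?n j)"
      "\<And>j. j \<in> I \<Longrightarrow> ?n j \<bullet> w = 0" "\<xi> $ q = - (Fdot F xb yb yt / gdot g q xb yt)"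
      "\<And>j. j \<notin> insert q I \<Longrightarrow> \<xi> $ j = 0"
      by (rule dual_solution[OF regI[folded I_def] JI(2)]) blast
    obtain c where c: "c * gdot g q xb yt > 0" "gdot g q xb yt \<noteq> 0"
       "Fdot F xb yb yt = (nabla_x F z - ?h \<bullet> w + nabla_x (constr_comb \<xi> g) z) - \<xi> $ q * gdot g q xb yt"
       "Fdot F xb yb yh = (nabla_x F z - ?h \<bullet> w + nabla_x (constr_comb \<xi> g) z) - c * (?n q \<bullet> w)"
      using Fdot[OF br s(1,2) s(4)[folded JI(3)]] by blast
    have R0: "nabla_x F z - ?h \<bullet> w + nabla_x (constr_comb \<xi> g) z = 0"
      using c(2,3) s(3) by simp
    have "\<xi> $ q \<ge> 0 \<and> ?n q \<bullet> w \<le> 0"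
    proof (cases "gdot g q xb yt > 0")
      case True
      then have "c > 0" using c(1) by (simp add: zero_less_mult_iff)
      then show ?thesis
        using sgn(1) True c(4)[unfolded R0] unfolding s(3) by (simp add: divide_le_0_iff mult_le_0_iff)
    next
      case False
      then have neg: "gdot g q xb yt < 0" using c(2) by simp
      then have "c < 0" using c(1) by (simp add: zero_less_mult_iff)
      then show ?thesis
        using sgn(2) neg c(4)[unfolded R0] unfolding s(3) by (simp add: divide_le_0_iff zero_le_mult_iff)
    qed
    then show ?L
      using R0 s(1,2,4) by (intro exI[of _ w] exI[of _ \<xi>]) (auto simp: star_system_iff JI(1))
  qed
  then show ?thesis using LICQ_KKT[OF lm z licq st] q unfolding I_def by blast
qed

end

section \<open>Vertices with m + 1 active constraints\<close>

section \<open>Points of Type 5\<close>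

lemma lin_indep_family_span_UNIV:
  fixes v :: "'i \<Rightarrow> 'v::euclidean_space"
  assumes "lin_indep_family v I" "card I = DIM('v)"
  shows "span (v ` I) = UNIV"
proof -
  have "card (v ` I) = DIM('v)"
    using assms by (simp add: lin_indep_family_def card_image)
  then have "dim (v ` I) = DIM('v)"
    using assms(1) by (simp add: lin_indep_family_def dim_eq_card_independent)
  then show ?thesis by (simp add: dim_eq_full)
qed

text \<open>The ratio test: the largest step against \<mu> that keeps \<open>u\<close> nonnegative
  is a minimum of quotients, attained at an index whose entry becomes 0.\<close>

lemma descend_to_boundary:
  fixes u \<mu> :: "'i \<Rightarrow> real"
  assumes "finite J" "\<And>j. j \<in> J \<Longrightarrow> u j \<ge> 0" "i \<in> J" "\<mu> i > 0"
  obtains t q where "t \<ge> 0" "q \<in> J" "\<mu> q > 0" "u q - t * \<mu> q = 0" "\<And>j. j \<in> J \<Longrightarrow> u j - t * \<mu> j \<ge> 0"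
proof -
  let ?P = "{j \<in> J. \<mu> j > 0}"
  have fin: "finite ?P" "?P \<noteq> {}" using assms by auto
  define t where "t = Min ((\<lambda>j. u j / \<mu> j) ` ?P)"
  have "t \<in> (\<lambda>j. u j / \<mu> j) ` ?P"
    unfolding t_def using fin by (intro Min_in) auto
  then obtain q where q: "q \<in> J" "\<mu> q > 0" "t = u q / \<mu> q" by auto
  have t0: "t \<ge> 0" using q assms(2) by simp
  have "u j - t * \<mu> j \<ge> 0" if j: "j \<in> J" for j
  proof (cases "\<mu> j > 0")
    case True
    then have "t \<le> u j / \<mu> j"
      unfolding t_def using fin j by (intro Min_le) auto
    then show ?thesis using True by (simp add: field_simps)
  next
    case False
    then have "t * \<mu> j \<le> 0" using t0 by (simp add: mult_nonneg_nonpos)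
    then show ?thesis using assms(2)[OF j] by simp
  qed
  then show ?thesis using q t0 by (intro that[of t q]) auto
qed

context lower_level
begin

context
  fixes xb :: real and yb :: "real^'m" and z :: "real \<times> (real^'m)" and J :: "'p set"
  assumes z: "z = (xb, yb)" and J: "J = J0 g z"
    and T5: "type5 f g xb yb"
begin

lemma type5_card: "card J = Suc CARD('m)"
  and type5_full: "lin_indep_family (\<lambda>j. nabla (constr g j) z) J"
  and type5_part: "\<And>i. i \<in> J \<Longrightarrow> lin_indep_family (\<lambda>j. nabla_y (constr g j) z) (J - {i})"
  and type5_mult: "\<And>i. i \<in> J \<Longrightarrow> \<exists>u. nabla_y f z + (\<Sum>j\<in>J - {i}. u j *\<^sub>R nabla_y (constr g j) z) = 0 \<and>
        (\<forall>j\<in>J - {i}. u j \<noteq> (0::real))"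
  and type5_feasible: "feasible g xb yb"
proof -
  have T: "gen_critical f g xb yb" "card J = CARD('m) + 1" "lin_indep_family (\<lambda>j. nabla (constr g j) z) J"
     "\<And>I. I \<subseteq> J \<and> card I = CARD('m) \<Longrightarrow> lin_indep_family (\<lambda>j. nabla_y (constr g j) z) I"
    "\<And>i. i \<in> J \<Longrightarrow> \<exists>u::'p \<Rightarrow> real.
           nabla_y f z + (\<Sum>j\<in>J - {i}. u j *\<^sub>R nabla_y (constr g j) z) = 0 \<and>
           (\<forall>j\<in>J - {i}. u j \<noteq> 0)"
    using T5 unfolding type5_def Let_def z[symmetric] J[symmetric] by blast+
  show "card J = Suc CARD('m)" using T(2) by simp
  show "lin_indep_family (\<lambda>j. nabla (constr g j) z) J" by (rule T(3))
  show "lin_indep_family (\<lambda>j. nabla_y (constr g j) z) (J - {i})" if "i \<in> J" for i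
    by (rule T(4)) (use T(2) that in auto)
  show "\<exists>u. nabla_y f z + (\<Sum>j\<in>J - {i}. u j *\<^sub>R nabla_y (constr g j) z) = 0 \<and>
        (\<forall>j\<in>J - {i}. u j \<noteq> (0::real))" if "i \<in> J" for i
    using T(5)[OF that] .
  show "feasible g xb yb" using T(1) by (simp add: gen_critical_def)
qed

lemma type5_span: "i \<in> J \<Longrightarrow> span ((\<lambda>j. nabla_y (constr g j) z) ` (J - {i})) = UNIV"
  by (rule lin_indep_family_span_UNIV[OF type5_part]) (simp_all add: type5_card)

lemma type5_full_span: "span ((\<lambda>j. nabla (constr g j) z) ` J) = UNIV"
  by (rule lin_indep_family_span_UNIV[OF type5_full]) (simp add: type5_card)

text \<open>Any m of the gradients are independent, so a relation among all m + 1 that misses one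
  index is trivial. Relations therefore form a space of dimension at most one, on which the
  description of the multiplier sets rests.\<close>

lemma type5_kernel:
  assumes "(\<Sum>j\<in>J. \<mu> j *\<^sub>R nabla_y (constr g j) z) = 0" "k \<in> J" "\<mu> k = 0" "j \<in> J"
  shows "\<mu> j = 0"
proof (cases "j = k")
  case False
  have "(\<Sum>j\<in>J. \<mu> j *\<^sub>R nabla_y (constr g j) z) = (\<Sum>j\<in>J - {k}. \<mu> j *\<^sub>R nabla_y (constr g j) z)"
    by (rule sum.mono_neutral_right) (use assms(2,3) in auto)
  then show ?thesis
    using lin_indep_family_coeff_0[OF type5_part[OF assms(2)] finite, of \<mu> j] assms(1,4) False by simp
qed (simp add: assms)

text \<open>A multiplier that vanishes at \<open>q\<close> has to consist of the unique numbers
  attached to \<open>q\<close> by the definition of Type 5, and those are nonzero.\<close>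

lemma type5_KKT_positive:
  assumes u: "u \<in> KKT_multipliers f g z" and q: "q \<in> J" "u $ q = 0" and j: "j \<in> J - {q}"
  shows "u $ j > 0"
proof -
  note u = u[unfolded KKT_iff[OF type5_feasible z], folded J]
  obtain c where c: "nabla_y f z + (\<Sum>j\<in>J - {q}. c j *\<^sub>R nabla_y (constr g j) z) = 0"
    "\<And>j. j \<in> J - {q} \<Longrightarrow> c j \<noteq> 0"
    using type5_mult[OF q(1)] by blast
  have "(\<Sum>j\<in>J. u $ j *\<^sub>R nabla_y (constr g j) z) = (\<Sum>j\<in>J - {q}. u $ j *\<^sub>R nabla_y (constr g j) z)"
    by (rule sum.mono_neutral_right) (use q in auto)
  then have "nabla_y f z + (\<Sum>j\<in>J - {q}. u $ j *\<^sub>R nabla_y (constr g j) z)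
      = nabla_y f z + (\<Sum>j\<in>J - {q}. c j *\<^sub>R nabla_y (constr g j) z)"
    using u c by simp
  then have "(\<Sum>j\<in>J - {q}. (u $ j - c j) *\<^sub>R nabla_y (constr g j) z) = 0"
    by (simp add: scaleR_diff_left sum_subtractf)
  from lin_indep_family_coeff_0[OF type5_part[OF q(1)] finite this j]
  have "u $ j = c j" by simp
  then have "u $ j \<noteq> 0" using c(2)[OF j] by simp
  moreover have "u $ j \<ge> 0" using u by blast
  ultimately show ?thesis by simp
qed

lemma type5_shift_KKT:
  assumes u: "u \<in> KKT_multipliers f g z"
    and \<mu>: "(\<Sum>j\<in>J. \<mu> $ j *\<^sub>R nabla_y (constr g j) z) = 0" "\<And>j. j \<notin> J \<Longrightarrow> \<mu> $ j = 0"
    and pos: "\<And>j. j \<in> J \<Longrightarrow> u $ j + t * \<mu> $ j \<ge> 0"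
  shows "u + t *\<^sub>R \<mu> \<in> KKT_multipliers f g z"
proof -
  note u = u[unfolded KKT_iff[OF type5_feasible z], folded J]
  have "(\<Sum>j\<in>J. (u + t *\<^sub>R \<mu>) $ j *\<^sub>R nabla_y (constr g j) z)
      = (\<Sum>j\<in>J. u $ j *\<^sub>R nabla_y (constr g j) z) + t *\<^sub>R (\<Sum>j\<in>J. \<mu> $ j *\<^sub>R nabla_y (constr g j) z)"
    by (simp add: scaleR_add_left sum.distrib scaleR_sum_right)
  moreover have "(u + t *\<^sub>R \<mu>) $ j \<ge> 0" for j
    using pos[of j] u \<mu>(2)[of j] by (cases "j \<in> J") simp_all
  ultimately show ?thesis
    unfolding KKT_iff[OF type5_feasible z] J[symmetric] using u \<mu> by simp
qed

lemma type5_KKT_diff: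
  assumes "u \<in> KKT_multipliers f g z" "v \<in> KKT_multipliers f g z"
  shows "(\<Sum>j\<in>J. (v - u) $ j *\<^sub>R nabla_y (constr g j) z) = 0" "j \<notin> J \<Longrightarrow> (v - u) $ j = 0"
proof -
  note u = assms(1)[unfolded KKT_iff[OF type5_feasible z], folded J]
  note v = assms(2)[unfolded KKT_iff[OF type5_feasible z], folded J]
  have "nabla_y f z + (\<Sum>j\<in>J. u $ j *\<^sub>R nabla_y (constr g j) z)
      = nabla_y f z + (\<Sum>j\<in>J. v $ j *\<^sub>R nabla_y (constr g j) z)"
    using u v by simp
  then show "(\<Sum>j\<in>J. (v - u) $ j *\<^sub>R nabla_y (constr g j) z) = 0"
    by (simp add: scaleR_diff_left sum_subtractf)
  show "j \<notin> J \<Longrightarrow> (v - u) $ j = 0" using u v by simp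
qed

text \<open>The m + 1 independent full gradients are a basis of the whole space, and \<xi> lists the
  coefficients of -\<nabla>F in it.\<close>

lemma type5_star_unique:
  assumes "star5_system F g z \<xi>" "star5_system F g z \<xi>'"
  shows "\<xi> = \<xi>'"
proof -
  have nc: "nabla (constr_comb \<xi> g) z = (\<Sum>j\<in>J. \<xi> $ j *\<^sub>R nabla (constr g j) z)"
    if "star5_system F g z \<xi>" for \<xi>
  proof -
    have "nabla (constr_comb \<xi> g) z = (\<Sum>j\<in>UNIV. \<xi> $ j *\<^sub>R nabla (constr g j) z)"
      by (simp add: nabla_def nabla_constr_comb[OF g_diff] prod_eq_iff fst_sum snd_sum)
    also have "\<dots> = (\<Sum>j\<in>J. \<xi> $ j *\<^sub>R nabla (constr g j) z)"
      by (rule sum.mono_neutral_right) (use that in \<open>auto simp: star5_system_def J\<close>)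
    finally show ?thesis .
  qed
  have "nabla F z + nabla (constr_comb \<xi> g) z = nabla F z + nabla (constr_comb \<xi>' g) z"
    using assms by (simp add: star5_system_def)
  then have "(\<Sum>j\<in>J. (\<xi> $ j - \<xi>' $ j) *\<^sub>R nabla (constr g j) z) = 0"
    by (simp add: nc assms scaleR_diff_left sum_subtractf)
  from lin_indep_family_coeff_0[OF type5_full finite this]
  have "\<xi> $ j = \<xi>' $ j" if "j \<in> J" for j using that by simp
  moreover have "\<xi> $ j = \<xi>' $ j" if "j \<notin> J" for j
    using assms that by (simp add: star5_system_def J)
  ultimately show ?thesis unfolding vec_eq_iff by blast
qed

lemma type5_star_exists:
  obtains \<xi> where "star5_system F g z \<xi>"
proof -
  have "- nabla F z \<in> span ((\<lambda>j. nabla (constr g j) z) ` J)"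
    by (simp add: type5_full_span)
  then obtain c where c: "- nabla F z = (\<Sum>j\<in>J. c j *\<^sub>R nabla (constr g j) z)"
    using span_image_coeffs[OF finite] by blast
  define \<xi> :: "real^'p" where "\<xi> = (\<chi> j. if j \<in> J then c j else 0)"
  have "nabla (constr_comb \<xi> g) z = (\<Sum>j\<in>UNIV. \<xi> $ j *\<^sub>R nabla (constr g j) z)"
    by (simp add: nabla_def nabla_constr_comb[OF g_diff] prod_eq_iff fst_sum snd_sum)
  also have "\<dots> = (\<Sum>j\<in>J. \<xi> $ j *\<^sub>R nabla (constr g j) z)"
    by (rule sum_support) (simp add: \<xi>_def)
  also have "\<dots> = - nabla F z" unfolding c by (intro sum.cong) (simp_all add: \<xi>_def)
  finally have "star5_system F g z \<xi>" by (simp add: star5_system_def \<xi>_def J)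
  then show ?thesis by (rule that)
qed

text \<open>The remaining m gradients span, so a vector orthogonal to all of them is 0 and
  nonsingularity on the tangent space is trivial.\<close>

lemma type5_branch_exists:
  assumes u: "u \<in> KKT_multipliers f g z" and q: "q \<in> J" "u $ q = 0"
  obtains y v where "E_branch f g (J - {q}) xb yb u y v"
proof -
  note u = u[unfolded KKT_iff[OF type5_feasible z], folded J]
  have "\<zeta> = 0" if \<zeta>: "\<zeta> \<in> tangent g (J - {q}) z" for \<zeta>
  proof -
    have "\<zeta> \<in> span ((\<lambda>j. nabla_y (constr g j) z) ` (J - {q}))"
      by (simp add: type5_span[OF q(1)])
    then obtain c where c: "\<zeta> = (\<Sum>j\<in>J - {q}. c j *\<^sub>R nabla_y (constr g j) z)"
      using span_image_coeffs[OF finite] by blast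
    have "\<zeta> \<bullet> \<zeta> = (\<Sum>j\<in>J - {q}. c j *\<^sub>R nabla_y (constr g j) z) \<bullet> \<zeta>" by (simp only: c[symmetric])
    also have "\<dots> = 0" using \<zeta> by (simp add: inner_sum_left tangent_def)
    finally show ?thesis by simp
  qed
  then have "tangent g (J - {q}) z = {0}" by (auto simp: tangent_def)
  then have reg: "nonsingular_on (hess_yy (lagr f g u) z) (tangent g (J - {q}) z)"
    by (simp add: nonsingular_on_zero)
  have "(\<Sum>j\<in>J. u $ j *\<^sub>R nabla_y (constr g j) z) = (\<Sum>j\<in>J - {q}. u $ j *\<^sub>R nabla_y (constr g j) z)"
    by (rule sum.mono_neutral_right) (use q in auto)
  then have st: "nabla_y f (xb, yb) + (\<Sum>j\<in>J - {q}. u $ j *\<^sub>R nabla_y (constr g j) (xb, yb)) = 0"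
    using u z by simp
  have ub: "u $ j = 0" if "j \<notin> J - {q}" for j using u q that by auto
  have act: "g (xb, yb) $ j = 0" if "j \<in> J - {q}" for j using that by (simp add: J J0_def z)
  show ?thesis
    by (rule E_branch_exists[OF ub st act type5_part[OF q(1), unfolded z] reg[unfolded z]])
       (assumption | erule that)+
qed

text \<open>The vector (1, y') is orthogonal to every full gradient except that of \<open>q\<close>,
  so pairing a combination of full gradients with it leaves the term of \<open>q\<close> only. The
  three claims pair (1, y') itself, the gradient of \<open>F\<close>, and a relation among the
  y-gradients.\<close>

lemma type5_branch:
  assumes br: "E_branch f g (J - {q}) xb yb u y v" and q: "q \<in> J"
    and u: "\<And>j. j \<notin> J - {q} \<Longrightarrow> u $ j = 0"
  shows "gdot g q xb y \<noteq> 0"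
    and "star5_system F g z \<xi> \<Longrightarrow> Fdot F xb yb y = - (\<xi> $ q * gdot g q xb y)"
    and "(\<Sum>j\<in>J. c j *\<^sub>R nabla_y (constr g j) z) = 0 \<Longrightarrow>
       c q * gdot g q xb y = (\<Sum>j\<in>J. c j * nabla_x (constr g j) z)"
proof -
  obtain y' v' where y': "(y has_vector_derivative y') (at xb)"
    "\<And>j. j \<in> J - {q} \<Longrightarrow> nabla_x (constr g j) z + nabla_y (constr g j) z \<bullet> y' = 0"
    using E_branch_derivative[OF br u z] by blast
  have yx: "y xb = yb" using br by (simp add: E_branch_def)
  note gd = gdot_eq[OF y'(1) yx z, of q]
  let ?a = "\<lambda>j. nabla_x (constr g j) z + nabla_y (constr g j) z \<bullet> y'"
  have a: "nabla (constr g j) z \<bullet> (1, y') = ?a j" for j by (simp add: nabla_def)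
  have sum_a: "(\<Sum>j\<in>J. k j * ?a j) = k q * gdot g q xb y" for k
  proof -
    have "(\<Sum>j\<in>J. k j * ?a j) = (\<Sum>j\<in>{q}. k j * ?a j)"
      by (rule sum.mono_neutral_right) (use q y'(2) in auto)
    then show ?thesis by (simp add: gd)
  qed
  show "gdot g q xb y \<noteq> 0"
  proof
    assume 0: "gdot g q xb y = 0"
    have "(1, y') \<in> span ((\<lambda>j. nabla (constr g j) z) ` J)" by (simp add: type5_full_span)
    then obtain k where k: "(1, y') = (\<Sum>j\<in>J. k j *\<^sub>R nabla (constr g j) z)"
      using span_image_coeffs[OF finite] by blast
    have "(1::real, y') \<bullet> (1, y') = (\<Sum>j\<in>J. k j *\<^sub>R nabla (constr g j) z) \<bullet> (1, y')"
      by (simp only: k[symmetric])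
    also have "\<dots> = (\<Sum>j\<in>J. k j * ?a j)" by (simp only: inner_sum_left inner_scaleR_left a)
    also have "\<dots> = 0" by (simp only: sum_a 0)
    finally have "1 + y' \<bullet> y' = 0" by simp
    then show False using inner_ge_zero[of y'] by linarith
  qed
  show "Fdot F xb yb y = - (\<xi> $ q * gdot g q xb y)" if s: "star5_system F g z \<xi>"
  proof -
    have "(\<Sum>j\<in>UNIV. \<xi> $ j * ?a j) = (\<Sum>j\<in>J. \<xi> $ j * ?a j)"
      by (rule sum.mono_neutral_right) (use s in \<open>auto simp: star5_system_def J\<close>)
    then have 1: "(\<Sum>j\<in>UNIV. \<xi> $ j * ?a j) = \<xi> $ q * gdot g q xb y" by (simp only: sum_a)
    have "nabla_x F z = - (\<Sum>j\<in>UNIV. \<xi> $ j * nabla_x (constr g j) z)"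
      "nabla_y F z = - (\<Sum>j\<in>UNIV. \<xi> $ j *\<^sub>R nabla_y (constr g j) z)"
      using s by (simp_all add: star5_system_def nabla_def nabla_constr_comb[OF g_diff] zero_prod_def
          eq_neg_iff_add_eq_0)
    then have "Fdot F xb yb y = - (\<Sum>j\<in>UNIV. \<xi> $ j * ?a j)"
      unfolding Fdot_eq[OF y'(1) z] by (simp add: inner_sum_left distrib_left sum.distrib)
    then show ?thesis by (simp only: 1)
  qed
  show "c q * gdot g q xb y = (\<Sum>j\<in>J. c j * nabla_x (constr g j) z)"
    if c: "(\<Sum>j\<in>J. c j *\<^sub>R nabla_y (constr g j) z) = 0"
  proof -
    have "(\<Sum>j\<in>J. c j * ?a j) = (\<Sum>j\<in>J. c j * nabla_x (constr g j) z)
        + (\<Sum>j\<in>J. c j *\<^sub>R nabla_y (constr g j) z) \<bullet> y'"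
      by (simp add: inner_sum_left distrib_left sum.distrib)
    then show ?thesis using c by (simp add: sum_a)
  qed
qed

text \<open>Failure of MFCQ yields a nonnegative relation \<mu> by Gordan's alternative, strictly
  positive because a relation with a zero entry is trivial. Moving any multiplier against \<mu>
  until an entry vanishes reaches the endpoint \<open>u\<close> of the multiplier ray.\<close>

lemma type5_1_equivalence:
  assumes mf: "\<not> MFCQ g z" and kkt: "KKT_multipliers f g z \<noteq> {}"
  shows "\<exists>u q. type5_1_data f g z u q \<and>
        ((\<exists>xi. star5_system F g z xi \<and> xi $ q \<ge> 0) \<longleftrightarrow>
         (\<exists>yq uq. E_branch f g (J - {q}) xb yb u yq uq \<and>
            (gdot g q xb yq > 0 \<longrightarrow> Fdot F xb yb yq \<le> 0) \<and>
            (gdot g q xb yq < 0 \<longrightarrow> Fdot F xb yb yq \<ge> 0)))"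
proof -
  let ?n = "\<lambda>j. nabla_y (constr g j) z"
  have "\<nexists>d. \<forall>j\<in>J. ?n j \<bullet> d < 0" using mf by (simp add: MFCQ_def J)
  then obtain m where m: "\<And>j. j \<in> J \<Longrightarrow> 0 \<le> m j" "sum m J = 1" "(\<Sum>j\<in>J. m j *\<^sub>R ?n j) = 0"
    by (rule gordan_alternative[OF finite]) blast
  have mpos: "m j > 0" if "j \<in> J" for j
  proof -
    have "m j \<noteq> 0"
    proof
      assume "m j = 0"
      then have "m k = 0" if "k \<in> J" for k using type5_kernel[OF m(3) \<open>j \<in> J\<close>] that by blast
      then show False using m(2) by simp
    qed
    then show ?thesis using m(1)[OF that] by simp
  qed
  define \<mu> :: "real^'p" where "\<mu> = (\<chi> j. if j \<in> J then m j else 0)"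
  have \<mu>pos: "\<mu> $ j > 0" if "j \<in> J" for j using mpos that by (simp add: \<mu>_def)
  have \<mu>0: "(\<Sum>j\<in>J. \<mu> $ j *\<^sub>R ?n j) = 0" using m(3) by (simp add: \<mu>_def)
  have \<mu>supp: "\<mu> $ j = 0" if "j \<notin> J" for j using that by (simp add: \<mu>_def)
  obtain k where k: "k \<in> J" using type5_card by fastforce
  obtain us where us: "us \<in> KKT_multipliers f g z" using kkt by blast
  note us' = us[unfolded KKT_iff[OF type5_feasible z]]
  have us_nn: "us $ j \<ge> 0" for j using us' by blast
  obtain t q where tq: "t \<ge> 0" "q \<in> J" "\<mu> $ q > 0" "us $ q - t * \<mu> $ q = 0" "\<And>j. j \<in> J \<Longrightarrow> us $ j - t * \<mu> $ j \<ge> 0"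
    by (rule descend_to_boundary[of J "\<lambda>j. us $ j" k "\<lambda>j. \<mu> $ j", OF finite us_nn k \<mu>pos[OF k]]) blast
  define u where "u = us + (- t) *\<^sub>R \<mu>"
  have uK: "u \<in> KKT_multipliers f g z"
    unfolding u_def by (rule type5_shift_KKT[OF us \<mu>0 \<mu>supp]) (use tq(5) in auto)
  have uq: "u $ q = 0" using tq(4) by (simp add: u_def)
  have upos: "u $ j > 0" if "j \<in> J - {q}" for j
    by (rule type5_KKT_positive[OF uK tq(2) uq that])
  have u0: "u $ j = 0" if "j \<notin> J - {q}" for j
    using that uq uK[unfolded KKT_iff[OF type5_feasible z]] by (cases "j = q") (auto simp: J)
  have param: "KKT_multipliers f g z = {u + t *\<^sub>R \<mu> | t. t \<ge> 0}"
  proof (intro set_eqI iffI)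
    fix v assume v: "v \<in> KKT_multipliers f g z"
    \<comment> \<open>With this \<open>s\<close> the relation v - u - s \<mu> vanishes at
      \<open>q\<close>, hence everywhere.\<close>
    define s where "s = v $ q / \<mu> $ q"
    have s: "s \<ge> 0"
      using v[unfolded KKT_iff[OF type5_feasible z]] \<mu>pos[OF tq(2)] by (simp add: s_def)
    define c where "c j = (v - u) $ j - s * \<mu> $ j" for j
    have "(\<Sum>j\<in>J. c j *\<^sub>R ?n j) = (\<Sum>j\<in>J. (v - u) $ j *\<^sub>R ?n j) - s *\<^sub>R (\<Sum>j\<in>J. \<mu> $ j *\<^sub>R ?n j)"
      unfolding c_def by (simp add: scaleR_diff_left sum_subtractf scaleR_sum_right)
    then have c0: "(\<Sum>j\<in>J. c j *\<^sub>R ?n j) = 0" using type5_KKT_diff(1)[OF uK v] \<mu>0 by simp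
    have "c q = 0" using uq \<mu>pos[OF tq(2)] by (simp add: c_def s_def)
    then have "c j = 0" for j
      using type5_kernel[OF c0 tq(2)] type5_KKT_diff(2)[OF uK v, of j] \<mu>supp[of j]
      by (cases "j \<in> J") (auto simp: c_def)
    then have "v = u + s *\<^sub>R \<mu>" by (simp add: vec_eq_iff c_def algebra_simps)
    then show "v \<in> {u + t *\<^sub>R \<mu> | t. t \<ge> 0}" using s by blast
  next
    fix v assume "v \<in> {u + t *\<^sub>R \<mu> | t. t \<ge> 0}"
    then obtain s where s: "v = u + s *\<^sub>R \<mu>" "s \<ge> 0" by blast
    have "u $ j + s * \<mu> $ j \<ge> 0" if "j \<in> J" for j
      using s(2) \<mu>pos[OF that] uK[unfolded KKT_iff[OF type5_feasible z]]
      by (intro add_nonneg_nonneg mult_nonneg_nonneg) auto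
    then show "v \<in> KKT_multipliers f g z"
      unfolding s(1) by (intro type5_shift_KKT[OF uK \<mu>0]) (simp_all add: \<mu>supp)
  qed
  have data: "type5_1_data f g z u q"
    unfolding type5_1_data_def J[symmetric] using tq(2) uq upos param \<mu>pos by blast
  have "(\<exists>xi. star5_system F g z xi \<and> xi $ q \<ge> 0) \<longleftrightarrow>
         (\<exists>yq uq. E_branch f g (J - {q}) xb yb u yq uq \<and>
            (gdot g q xb yq > 0 \<longrightarrow> Fdot F xb yb yq \<le> 0) \<and>
            (gdot g q xb yq < 0 \<longrightarrow> Fdot F xb yb yq \<ge> 0))" (is "?L \<longleftrightarrow> ?R")
  proof
    assume ?L
    then obtain \<xi> where \<xi>: "star5_system F g z \<xi>" "\<xi> $ q \<ge> 0" by blast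
    obtain y v where br: "E_branch f g (J - {q}) xb yb u y v"
      by (rule type5_branch_exists[OF uK tq(2) uq])
    have "Fdot F xb yb y = - (\<xi> $ q * gdot g q xb y)"
      by (rule type5_branch(2)[OF br tq(2) u0 \<xi>(1)])
    then have "(gdot g q xb y > 0 \<longrightarrow> Fdot F xb yb y \<le> 0) \<and> (gdot g q xb y < 0 \<longrightarrow> Fdot F xb yb y \<ge> 0)"
      using \<xi>(2) by (simp add: mult_nonneg_nonpos)
    with br show ?R by blast
  next
    assume ?R
    then obtain y v where br: "E_branch f g (J - {q}) xb yb u y v"
      "gdot g q xb y > 0 \<longrightarrow> Fdot F xb yb y \<le> 0" "gdot g q xb y < 0 \<longrightarrow> Fdot F xb yb y \<ge> 0" by blast
    obtain \<xi> where \<xi>: "star5_system F g z \<xi>" by (rule type5_star_exists)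
    have "gdot g q xb y \<noteq> 0" by (rule type5_branch(1)[OF br(1) tq(2) u0])
    moreover have "Fdot F xb yb y = - (\<xi> $ q * gdot g q xb y)"
      by (rule type5_branch(2)[OF br(1) tq(2) u0 \<xi>])
    ultimately have "\<xi> $ q \<ge> 0"
      using br(2,3)
      by (cases "gdot g q xb y > 0") (auto simp: zero_le_mult_iff mult_le_0_iff)
    with \<xi> show ?L by blast
  qed
  with data show ?thesis by blast
qed

text \<open>MFCQ excludes nontrivial nonnegative relations, so \<mu> has entries of both signs and a
  multiplier can be moved along it only a finite way in either direction. The ends are
  \<open>u1\<close>, vanishing at \<open>q\<close>, and \<open>u2\<close>, vanishing at
  \<open>r\<close>.\<close>

lemma type5_2_equivalence:
  assumes lm: "local_minimizer f g xb yb" and mf: "MFCQ g z"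
  shows "\<exists>q r u1 u2. type5_2_data f g z q r u1 u2 \<and>
        (\<forall>q' r' u1' u2'. type5_2_data f g z q' r' u1' u2' \<longrightarrow> {q', r'} = {q, r}) \<and>
        ((\<forall>u\<in>KKT_multipliers f g z. \<exists>xi. star5_system F g z xi \<and>
            (u = u1 \<longrightarrow> xi $ q \<ge> 0) \<and> (u = u2 \<longrightarrow> xi $ r \<ge> 0)) \<longleftrightarrow>
         (\<exists>yq uq yr ur.
            E_branch f g (J - {q}) xb yb u1 yq uq \<and> E_branch f g (J - {r}) xb yb u2 yr ur \<and>
            (let \<gamma>q = sgn (gdot g q xb yq); \<gamma>r = sgn (gdot g r xb yr) in
              (\<gamma>q > 0 \<longleftrightarrow> \<gamma>r < 0) \<and> (\<gamma>q < 0 \<longleftrightarrow> \<gamma>r > 0) \<and>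
              (\<gamma>q > 0 \<longrightarrow> Fdot F xb yb yq \<le> 0 \<and> Fdot F xb yb yr \<ge> 0) \<and>
              (\<gamma>q < 0 \<longrightarrow> Fdot F xb yb yq \<ge> 0 \<and> Fdot F xb yb yr \<le> 0))))"
proof -
  let ?n = "\<lambda>j. nabla_y (constr g j) z"
  obtain d where d: "\<And>j. j \<in> J \<Longrightarrow> ?n j \<bullet> d < 0" using mf by (auto simp: MFCQ_def J)
  have no_pos: False
    if m0: "(\<Sum>j\<in>J. m j *\<^sub>R ?n j) = 0" and m: "\<And>j. j \<in> J \<Longrightarrow> m j \<ge> 0" "\<exists>j\<in>J. m j \<noteq> 0" for m
  proof -
    obtain i where i: "i \<in> J" "m i > 0" using m by force
    have "m j * (?n j \<bullet> d) \<le> 0" if "j \<in> J" for j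
      using m(1)[OF that] d[OF that] by (simp add: mult_nonneg_nonpos)
    moreover have "m i * (?n i \<bullet> d) < 0" using i d by (simp add: mult_pos_neg)
    ultimately have "(\<Sum>j\<in>J. m j * (?n j \<bullet> d)) < (\<Sum>j\<in>J. 0)"
      using i(1) by (intro sum_strict_mono_ex1) auto
    moreover have "(\<Sum>j\<in>J. m j * (?n j \<bullet> d)) = (\<Sum>j\<in>J. m j *\<^sub>R ?n j) \<bullet> d"
      by (simp add: inner_sum_left)
    ultimately show False using m0 by simp
  qed
  obtain k where k: "k \<in> J" using type5_card by fastforce
  have "?n k \<in> span (?n ` (J - {k}))" by (simp add: type5_span[OF k])
  then obtain c where c: "?n k = (\<Sum>j\<in>J - {k}. c j *\<^sub>R ?n j)"
    using span_image_coeffs[OF finite] by blast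
  \<comment> \<open>The gradient of \<open>k\<close> is a combination of the other m, which span the
    space; bringing it to the other side gives it the coefficient -1.\<close>
  define \<mu> :: "real^'p" where "\<mu> = (\<chi> j. if j = k then - 1 else if j \<in> J then c j else 0)"
  have "(\<Sum>j\<in>J. \<mu> $ j *\<^sub>R ?n j) = \<mu> $ k *\<^sub>R ?n k + (\<Sum>j\<in>J - {k}. \<mu> $ j *\<^sub>R ?n j)"
    using k by (simp add: sum.remove)
  also have "(\<Sum>j\<in>J - {k}. \<mu> $ j *\<^sub>R ?n j) = ?n k"
    unfolding c by (intro sum.cong) (auto simp: \<mu>_def)
  finally have \<mu>0: "(\<Sum>j\<in>J. \<mu> $ j *\<^sub>R ?n j) = 0" by (simp add: \<mu>_def)
  have \<mu>supp: "\<mu> $ j = 0" if "j \<notin> J" for j using that k by (auto simp: \<mu>_def)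
  have \<mu>nz: "\<mu> $ k \<noteq> 0" by (simp add: \<mu>_def)
  obtain i1 where i1: "i1 \<in> J" "\<mu> $ i1 > 0"
  proof -
    have "(\<Sum>j\<in>J. - (\<mu> $ j) *\<^sub>R ?n j) = 0" using \<mu>0 by (simp add: sum_negf)
    then have "\<not> (\<forall>j\<in>J. - (\<mu> $ j) \<ge> 0)"
      using no_pos[of "\<lambda>j. - (\<mu> $ j)"] k \<mu>nz by fastforce
    then show ?thesis using that by force
  qed
  obtain i2 where i2: "i2 \<in> J" "\<mu> $ i2 < 0"
    using no_pos[of "\<lambda>j. \<mu> $ j"] \<mu>0 k \<mu>nz by force
  obtain a v where FJ: "(a, v) \<in> FJ_multipliers f g z" using FJ_exists[OF lm z] .
  note av = FJ[unfolded FJ_iff[OF type5_feasible z] J[symmetric]]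
  have "a \<noteq> 0"
  proof
    assume a: "a = 0"
    have "\<exists>j\<in>J. v $ j \<noteq> 0"
    proof (rule ccontr)
      assume "\<not> ?thesis"
      then have "(\<Sum>j\<in>J. v $ j) = 0" by simp
      then show False using av a by simp
    qed
    then show False using no_pos[of "\<lambda>j. v $ j"] av a by simp
  qed
  then have a: "a > 0" using av by simp
  define us where "us = (1 / a) *\<^sub>R v"
  have us: "us \<in> KKT_multipliers f g z"
    unfolding us_def by (rule FJ_KKT[OF type5_feasible z FJ a])
  note us' = us[unfolded KKT_iff[OF type5_feasible z]]
  have us_nn: "us $ j \<ge> 0" for j using us' by blast
  obtain t1 q where "t1 \<ge> 0" and q: "q \<in> J" "\<mu> $ q > 0" "us $ q - t1 * \<mu> $ q = 0" "\<And>j. j \<in> J \<Longrightarrow> us $ j - t1 * \<mu> $ j \<ge> 0"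
    by (rule descend_to_boundary[of J "\<lambda>j. us $ j" i1 "\<lambda>j. \<mu> $ j", OF finite us_nn i1]) blast
  have "- (\<mu> $ i2) > 0" using i2(2) by simp
  then obtain t2 r where "t2 \<ge> 0" and r: "r \<in> J" "- (\<mu> $ r) > 0" "us $ r - t2 * - (\<mu> $ r) = 0" "\<And>j. j \<in> J \<Longrightarrow> us $ j - t2 * - (\<mu> $ j) \<ge> 0"
    by (rule descend_to_boundary[of J "\<lambda>j. us $ j" i2 "\<lambda>j. - (\<mu> $ j)", OF finite us_nn i2(1)]) blast
  define u1 where "u1 = us + (- t1) *\<^sub>R \<mu>"
  define u2 where "u2 = us + t2 *\<^sub>R \<mu>"
  have K1: "u1 \<in> KKT_multipliers f g z"
    unfolding u1_def by (rule type5_shift_KKT[OF us \<mu>0 \<mu>supp]) (use q(4) in auto)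
  have K2: "u2 \<in> KKT_multipliers f g z"
    unfolding u2_def by (rule type5_shift_KKT[OF us \<mu>0 \<mu>supp]) (use r(4) in auto)
  have z1: "u1 $ q = 0" using q(3) by (simp add: u1_def)
  have z2: "u2 $ r = 0" using r(3) by (simp add: u2_def)
  have qr: "q \<noteq> r" using q(2) r(2) by auto
  have p1: "u1 $ j > 0" if "j \<in> J - {q}" for j by (rule type5_KKT_positive[OF K1 q(1) z1 that])
  have p2: "u2 $ j > 0" if "j \<in> J - {r}" for j by (rule type5_KKT_positive[OF K2 r(1) z2 that])
  have pos: "u2 $ q > 0" "u1 $ r > 0" using p1 p2 q(1) r(1) qr by auto
  have data: "type5_2_data f g z q r u1 u2"
    unfolding type5_2_data_def J[symmetric] using q(1) r(1) qr K1 K2 z1 z2 p1 p2 by blast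
  \<comment> \<open>Every multiplier lies on the segment from \<open>u1\<close> to
    \<open>u2\<close>, and both ends are positive at any index other than \<open>q\<close> and
    \<open>r\<close>.\<close>
  have zero: "l = q \<or> l = r" if v: "v \<in> KKT_multipliers f g z" and l: "l \<in> J" "v $ l = 0" for v l
  proof (rule ccontr)
    assume n: "\<not> ?thesis"
    have vp: "v $ j \<ge> 0" for j using v[unfolded KKT_iff[OF type5_feasible z]] by blast
    define s where "s = v $ q / u2 $ q"
    have s0: "s \<ge> 0" using vp[of q] pos by (simp add: s_def)
    define e where "e j = (v - u1) $ j - s * (u2 - u1) $ j" for j
    have "(\<Sum>j\<in>J. e j *\<^sub>R ?n j) = (\<Sum>j\<in>J. (v - u1) $ j *\<^sub>R ?n j) - s *\<^sub>R (\<Sum>j\<in>J. (u2 - u1) $ j *\<^sub>R ?n j)"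
      unfolding e_def by (simp add: scaleR_diff_left[of "_ - _" "_ * _"] sum_subtractf scaleR_sum_right)
    then have e0: "(\<Sum>j\<in>J. e j *\<^sub>R ?n j) = 0"
      using type5_KKT_diff(1)[OF K1 v] type5_KKT_diff(1)[OF K1 K2] by simp
    have "e q = 0" using z1 pos by (simp add: e_def s_def)
    then have "e j = 0" if "j \<in> J" for j using type5_kernel[OF e0 q(1)] that by blast
    then have vs: "v $ j = (1 - s) * u1 $ j + s * u2 $ j" if "j \<in> J" for j
      using that by (force simp: e_def algebra_simps)
    have s1: "s \<le> 1" using vs[OF r(1)] vp[of r] z2 pos(2) by (simp add: zero_le_mult_iff)
    have "u1 $ l > 0" "u2 $ l > 0" using p1 p2 l(1) n by auto
    then have "(1 - s) * u1 $ l + s * u2 $ l > 0"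
      using s0 s1 by (cases "s = 0") (auto intro!: add_nonneg_pos mult_nonneg_nonneg)
    then show False using vs[OF l(1)] l(2) by simp
  qed
  have uniq: "{q', r'} = {q, r}" if "type5_2_data f g z q' r' u1' u2'" for q' r' u1' u2'
  proof -
    have "q' \<in> J" "r' \<in> J" "q' \<noteq> r'" "u1' \<in> KKT_multipliers f g z" "u2' \<in> KKT_multipliers f g z"
      "u1' $ q' = 0" "u2' $ r' = 0"
      using that by (auto simp: type5_2_data_def J)
    then show ?thesis using zero[of u1' q'] zero[of u2' r'] by auto
  qed
  have s1: "u1 $ j = 0" if "j \<notin> J - {q}" for j
    using that z1 K1[unfolded KKT_iff[OF type5_feasible z]] by (cases "j = q") (auto simp: J)
  have s2: "u2 $ j = 0" if "j \<notin> J - {r}" for j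
    using that z2 K2[unfolded KKT_iff[OF type5_feasible z]] by (cases "j = r") (auto simp: J)
  \<comment> \<open>Each rate times the matching entry of the relation \<open>u2 - u1\<close> gives
    the same number, and that relation is positive at \<open>q\<close> and negative at
    \<open>r\<close>.\<close>
  have opposite: "(gdot g q xb yq > 0 \<longleftrightarrow> gdot g r xb yr < 0) \<and> (gdot g q xb yq < 0 \<longleftrightarrow> gdot g r xb yr > 0)"
    if bq: "E_branch f g (J - {q}) xb yb u1 yq uq" and brr: "E_branch f g (J - {r}) xb yb u2 yr ur"
    for yq uq yr ur
  proof -
    have "(u2 - u1) $ q * gdot g q xb yq = (\<Sum>j\<in>J. (u2 - u1) $ j * nabla_x (constr g j) z)"
      by (rule type5_branch(3)[OF bq q(1) s1 type5_KKT_diff(1)[OF K1 K2]])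
    also have "\<dots> = (u2 - u1) $ r * gdot g r xb yr"
      by (rule type5_branch(3)[OF brr r(1) s2 type5_KKT_diff(1)[OF K1 K2], symmetric])
    finally have "u2 $ q * gdot g q xb yq = - (u1 $ r) * gdot g r xb yr"
      using z1 z2 by simp
    then have eq: "u2 $ q * gdot g q xb yq + u1 $ r * gdot g r xb yr = 0" by simp
    have "gdot g q xb yq > 0 \<longleftrightarrow> u2 $ q * gdot g q xb yq > 0" "gdot g q xb yq < 0 \<longleftrightarrow> u2 $ q * gdot g q xb yq < 0"
      "gdot g r xb yr > 0 \<longleftrightarrow> u1 $ r * gdot g r xb yr > 0" "gdot g r xb yr < 0 \<longleftrightarrow> u1 $ r * gdot g r xb yr < 0"
      using pos by (simp_all add: zero_less_mult_iff mult_less_0_iff)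
    then show ?thesis using eq by linarith
  qed
  have equiv: "(\<forall>u\<in>KKT_multipliers f g z. \<exists>xi. star5_system F g z xi \<and>
            (u = u1 \<longrightarrow> xi $ q \<ge> 0) \<and> (u = u2 \<longrightarrow> xi $ r \<ge> 0)) \<longleftrightarrow>
         (\<exists>yq uq yr ur.
            E_branch f g (J - {q}) xb yb u1 yq uq \<and> E_branch f g (J - {r}) xb yb u2 yr ur \<and>
            (let \<gamma>q = sgn (gdot g q xb yq); \<gamma>r = sgn (gdot g r xb yr) in
              (\<gamma>q > 0 \<longleftrightarrow> \<gamma>r < 0) \<and> (\<gamma>q < 0 \<longleftrightarrow> \<gamma>r > 0) \<and>
              (\<gamma>q > 0 \<longrightarrow> Fdot F xb yb yq \<le> 0 \<and> Fdot F xb yb yr \<ge> 0) \<and>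
              (\<gamma>q < 0 \<longrightarrow> Fdot F xb yb yq \<ge> 0 \<and> Fdot F xb yb yr \<le> 0)))" (is "?L \<longleftrightarrow> ?R")
  proof
    assume L: ?L
    obtain \<xi> where \<xi>: "star5_system F g z \<xi>" by (rule type5_star_exists)
    \<comment> \<open>The dual solution is unique, so the solutions provided for \<open>u1\<close>
      and for \<open>u2\<close> are the same \<xi>, which carries both sign conditions.\<close>
    have nn: "\<xi> $ q \<ge> 0" "\<xi> $ r \<ge> 0"
      using L K1 K2 type5_star_unique[OF \<xi>] by blast+
    obtain yq uq where bq: "E_branch f g (J - {q}) xb yb u1 yq uq"
      by (rule type5_branch_exists[OF K1 q(1) z1])
    obtain yr ur where brr: "E_branch f g (J - {r}) xb yb u2 yr ur"
      by (rule type5_branch_exists[OF K2 r(1) z2])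
    note opp = opposite[OF bq brr]
    have Fq: "Fdot F xb yb yq = - (\<xi> $ q * gdot g q xb yq)"
      by (rule type5_branch(2)[OF bq q(1) s1 \<xi>])
    have Fr: "Fdot F xb yb yr = - (\<xi> $ r * gdot g r xb yr)"
      by (rule type5_branch(2)[OF brr r(1) s2 \<xi>])
    have "(gdot g q xb yq > 0 \<longrightarrow> Fdot F xb yb yq \<le> 0 \<and> Fdot F xb yb yr \<ge> 0) \<and>
        (gdot g q xb yq < 0 \<longrightarrow> Fdot F xb yb yq \<ge> 0 \<and> Fdot F xb yb yr \<le> 0)"
      unfolding Fq Fr using nn opp
      by (cases "gdot g q xb yq" "0::real" rule: linorder_cases) (simp_all add: mult_nonneg_nonpos)
    then show ?R
      using bq brr opp unfolding Let_def by (intro exI[of _ yq] exI[of _ uq] exI[of _ yr] exI[of _ ur]) simp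
  next
    assume ?R
    then obtain yq uq yr ur where bq: "E_branch f g (J - {q}) xb yb u1 yq uq"
      and brr: "E_branch f g (J - {r}) xb yb u2 yr ur"
      and sg: "gdot g q xb yq > 0 \<longrightarrow> Fdot F xb yb yq \<le> 0 \<and> Fdot F xb yb yr \<ge> 0"
              "gdot g q xb yq < 0 \<longrightarrow> Fdot F xb yb yq \<ge> 0 \<and> Fdot F xb yb yr \<le> 0"
      by (auto simp: Let_def)
    obtain \<xi> where \<xi>: "star5_system F g z \<xi>" by (rule type5_star_exists)
    note opp = opposite[OF bq brr]
    have Fq: "Fdot F xb yb yq = - (\<xi> $ q * gdot g q xb yq)"
      by (rule type5_branch(2)[OF bq q(1) s1 \<xi>])
    have Fr: "Fdot F xb yb yr = - (\<xi> $ r * gdot g r xb yr)"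
      by (rule type5_branch(2)[OF brr r(1) s2 \<xi>])
    have "\<xi> $ q \<ge> 0 \<and> \<xi> $ r \<ge> 0"
    proof (cases "gdot g q xb yq > 0")
      case True
      then show ?thesis
        using sg(1) opp unfolding Fq Fr
        by (simp add: zero_le_mult_iff mult_le_0_iff)
    next
      case False
      moreover have "gdot g q xb yq \<noteq> 0" by (rule type5_branch(1)[OF bq q(1) s1])
      ultimately have "gdot g q xb yq < 0" by simp
      then show ?thesis
        using sg(2) opp unfolding Fq Fr
        by (simp add: zero_le_mult_iff mult_le_0_iff)
    qed
    with \<xi> show ?L by blast
  qed
  show ?thesis
  proof (rule exI[of _ q], rule exI[of _ r], rule exI[of _ u1], rule exI[of _ u2], intro conjI)
    show "\<forall>q' r' u1' u2'. type5_2_data f g z q' r' u1' u2' \<longrightarrow> {q', r'} = {q, r}"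
      using uniq by blast
  qed (rule data equiv)+
qed

end

end

section \<open>Curves of Fritz John points through a failure of KKT\<close>

section \<open>Points of Type 4\<close>

lemma nabla_y_scale:
  fixes h :: "real \<times> (real^'m) \<Rightarrow> real"
  assumes "h differentiable (at z)"
  shows "nabla_y (\<lambda>w. c * h w) z = c *\<^sub>R nabla_y h z"
proof -
  have "((\<lambda>w. c * h w) has_derivative (\<lambda>v. c * (fst v * nabla_x h z + nabla_y h z \<bullet> snd v))) (at z)"
    by (intro has_derivative_mult_right nabla_has_derivative assms)
  then have "((\<lambda>w. c * h w) has_derivative (\<lambda>v. fst v * (c * nabla_x h z) + (c *\<^sub>R nabla_y h z) \<bullet> snd v)) (at z)"
    by (rule back_subst[of "\<lambda>D. (_ has_derivative D) _"]) (simp add: fun_eq_iff algebra_simps)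
  from nabla_eqI(2)[OF this] show ?thesis .
qed

lemma hess_yy_scale:
  fixes h :: "real \<times> (real^'m) \<Rightarrow> real"
  assumes "Ck_on (Suc (Suc k)) h UNIV"
  shows "hess_yy (\<lambda>w. c * h w) z = c *\<^sub>R hess_yy h z"
proof -
  have "nabla_y (\<lambda>w. c * h w) w = c *\<^sub>R nabla_y h w" for w
    by (rule nabla_y_scale[OF Ck_on_imp_differentiable[OF assms]])
  moreover have "nabla_y (\<lambda>w. c * nabla_y h w $ i) z = c *\<^sub>R nabla_y (\<lambda>w. nabla_y h w $ i) z" for i
    by (intro nabla_y_scale Ck_on_imp_differentiable[of k]
        Ck_on_linear_compose[OF bounded_linear_vec_nth open_UNIV] Ck_on_nabla_y assms)
  ultimately show ?thesis
    by (simp add: hess_yy_def vec_eq_iff)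
qed

text \<open>Type 4 is stated for a relation of arbitrary scale, whereas the FJ-multiplier is
  normalised; this carries regularity from one to the other.\<close>

lemma nonsingular_on_scale:
  assumes "nonsingular_on H W" "c \<noteq> 0"
  shows "nonsingular_on (c *\<^sub>R H) W"
proof -
  obtain Bs C where Bs: "is_basis_of Bs W" and C: "matrix_inverse_on Bs (compression H) C"
    using assms(1) by (auto simp: nonsingular_on_def)
  have c: "compression (c *\<^sub>R H) b b' = c * compression H b b'" for b b'
    by (simp add: compression_def scaleR_matrix_vector_assoc[symmetric])
  have "matrix_inverse_on Bs (compression (c *\<^sub>R H)) (\<lambda>b b'. C b b' / c)"
    using C assms(2) unfolding matrix_inverse_on_def c by simp
  with Bs show ?thesis by (auto simp: nonsingular_on_def)
qed

text \<open>Subtracting a multiple of \<open>lam\<close> gives a relation \<open>e\<close> that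
  misses \<open>k\<close>. If \<open>e l\<close> were nonzero, \<open>n l\<close> and then also
  \<open>n k\<close> would depend on the vectors other than these two, and the rank would be at most
  \<open>card J - 2\<close>.\<close>

lemma corank_one_kernel:
  fixes n :: "'i \<Rightarrow> 'v::euclidean_space"
  assumes fin: "finite J" and rank: "dim (n ` J) = card J - 1"
    and lam: "(\<Sum>j\<in>J. lam j *\<^sub>R n j) = 0" "\<And>j. j \<in> J \<Longrightarrow> lam j \<noteq> 0"
    and c: "(\<Sum>j\<in>J. c j *\<^sub>R n j) = 0"
  obtains t where "\<And>j. j \<in> J \<Longrightarrow> c j = t * lam j"
proof (cases "J = {}")
  case False
  then obtain k where k: "k \<in> J" by blast
  define e where "e j = c j - c k / lam k * lam j" for j
  have "(\<Sum>j\<in>J. e j *\<^sub>R n j) = (\<Sum>j\<in>J. c j *\<^sub>R n j) - (c k / lam k) *\<^sub>R (\<Sum>j\<in>J. lam j *\<^sub>R n j)"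
    by (simp add: e_def scaleR_diff_left sum_subtractf scaleR_sum_right)
  then have e0: "(\<Sum>j\<in>J. e j *\<^sub>R n j) = 0" using lam c by simp
  have ek: "e k = 0" using lam(2)[OF k] by (simp add: e_def)
  have combination: "n i \<in> span (n ` (J - {i}))"
    if i: "i \<in> J" and a: "(\<Sum>j\<in>J. a j *\<^sub>R n j) = 0" "a i \<noteq> 0" for a i
  proof -
    have "a i *\<^sub>R n i = - (\<Sum>j\<in>J - {i}. a j *\<^sub>R n j)"
      using a(1) i fin by (simp add: sum.remove eq_neg_iff_add_eq_0)
    then have "(1 / a i) *\<^sub>R (a i *\<^sub>R n i) = (1 / a i) *\<^sub>R (- (\<Sum>j\<in>J - {i}. a j *\<^sub>R n j))"
      by (rule arg_cong)
    moreover have "(1 / a i) *\<^sub>R (- (\<Sum>j\<in>J - {i}. a j *\<^sub>R n j)) \<in> span (n ` (J - {i}))"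
      by (intro span_scale span_neg span_sum span_base imageI)
    ultimately show ?thesis using a(2) by simp
  qed
  have "e l = 0" if l: "l \<in> J" for l
  proof (rule ccontr)
    assume el: "e l \<noteq> 0"
    then have lk: "l \<noteq> k" using ek by auto
    let ?K = "J - {k} - {l}"
    have "(\<Sum>j\<in>J. e j *\<^sub>R n j) = (\<Sum>j\<in>J - {k}. e j *\<^sub>R n j)"
      by (rule sum.mono_neutral_right) (use fin ek in auto)
    then have eK: "(\<Sum>j\<in>J - {k}. e j *\<^sub>R n j) = 0" using e0 by simp
    have "e l *\<^sub>R n l = - (\<Sum>j\<in>?K. e j *\<^sub>R n j)"
      using eK l lk fin by (simp add: sum.remove[of "J - {k}" l] eq_neg_iff_add_eq_0)
    then have "(1 / e l) *\<^sub>R (e l *\<^sub>R n l) = (1 / e l) *\<^sub>R (- (\<Sum>j\<in>?K. e j *\<^sub>R n j))"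
      by (rule arg_cong)
    moreover have "(1 / e l) *\<^sub>R (- (\<Sum>j\<in>?K. e j *\<^sub>R n j)) \<in> span (n ` ?K)"
      by (intro span_scale span_neg span_sum span_base imageI)
    ultimately have nl: "n l \<in> span (n ` ?K)" using el by simp
    have sub1: "n ` (J - {k}) \<subseteq> span (n ` ?K)"
      using nl by (auto intro: span_base)
    have "n k \<in> span (n ` (J - {k}))" by (rule combination[OF k lam(1) lam(2)[OF k]])
    then have "n k \<in> span (n ` ?K)" using sub1 span_minimal subspace_span by blast
    then have "n ` J \<subseteq> span (n ` ?K)" using sub1 by auto
    then have "dim (n ` J) \<le> dim (n ` ?K)" by (metis dim_span dim_subset)
    also have "\<dots> \<le> card (n ` ?K)" using fin by (intro dim_le_card') auto
    also have "\<dots> \<le> card ?K" using fin by (intro card_image_le) auto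
    also have "\<dots> = card J - 2" using k l lk fin by simp
    finally have "card J - 1 \<le> card J - 2" using rank by simp
    \<comment> \<open>Subtraction of naturals truncates; the two distinct indices make the
      inequality an actual contradiction.\<close>
    moreover have "card {k, l} \<le> card J" using k l fin by (intro card_mono) auto
    ultimately show False using lk by simp
  qed
  then have "c j = c k / lam k * lam j" if "j \<in> J" for j
    using that by (simp add: e_def)
  then show ?thesis by (rule that)
qed (use that in blast)

context lower_level
begin

text \<open>Here \<open>x\<close> is an unknown too, and the normalisation of the multipliers
  supplies the matching equation. Multipliers off \<open>I\<close> are frozen as in
  \<open>E_map\<close>.\<close>

definition FJ_map ::
  "'p set \<Rightarrow> real^'p \<Rightarrow> real \<times> real \<times> (real^'m) \<times> (real^'p) \<Rightarrow> real \<times> (real^'m) \<times> (real^'p)" where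
  "FJ_map I ub w = (let t = fst w; p = (fst (snd w), fst (snd (snd w))); u = snd (snd (snd w)) in
     (t + (\<Sum>j\<in>I. u $ j) - 1,
      t *\<^sub>R nabla_y f p + (\<Sum>j\<in>I. u $ j *\<^sub>R nabla_y (constr g j) p),
      \<chi> j. if j \<in> I then g p $ j else u $ j - ub $ j))"

lemma FJ_map_eq_0_iff:
  "FJ_map I ub (t, x, y, u) = 0 \<longleftrightarrow>
     t + (\<Sum>j\<in>I. u $ j) = 1 \<and>
     t *\<^sub>R nabla_y f (x, y) + (\<Sum>j\<in>I. u $ j *\<^sub>R nabla_y (constr g j) (x, y)) = 0 \<and>
     (\<forall>j\<in>I. g (x, y) $ j = 0) \<and> (\<forall>j. j \<notin> I \<longrightarrow> u $ j = ub $ j)"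
  by (auto simp: FJ_map_def Let_def zero_prod_def vec_eq_iff)

lemma bounded_linear_FJ_point:
    "bounded_linear (\<lambda>w::real \<times> real \<times> (real^'k) \<times> (real^'l). (fst (snd w), fst (snd (snd w))))"
  and bounded_linear_FJ_nth:
    "bounded_linear (\<lambda>w::real \<times> real \<times> (real^'k) \<times> (real^'l). snd (snd (snd w)) $ j)"
  by (intro bounded_linear_intros bounded_linear_compose[OF bounded_linear_vec_nth])+

lemma FJ_map_C2: "Ck_on 2 (FJ_map I ub) UNIV"
proof -
  have if_C: "Ck_on 2 (\<lambda>w::real \<times> real \<times> (real^'m) \<times> (real^'p). if j \<in> I then g (fst (snd w), fst (snd (snd w))) $ j else snd (snd (snd w)) $ j - ub $ j) UNIV"
    for j
    using Ck_on_compose_linear[OF bounded_linear_FJ_point Ck_on_Suc_imp[OF constr_C[of j]]]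
      Ck_on_add[OF Ck_on_linear[OF bounded_linear_FJ_nth] Ck_on_const, of 2 j "- ub $ j"]
    by (cases "j \<in> I") (simp_all add: numeral_2_eq_2 del: Ck_on.simps)
  have 1: "Ck_on 2 (\<lambda>w::real \<times> real \<times> (real^'m) \<times> (real^'p). fst w + (\<Sum>j\<in>I. snd (snd (snd w)) $ j) - 1) UNIV"
    unfolding diff_conv_add_uminus
    by (intro Ck_on_add Ck_on_sum Ck_on_const Ck_on_linear bounded_linear_FJ_nth bounded_linear_fst)
  have "Ck_on 2 (nabla_y f) UNIV" "Ck_on 2 (nabla_y (constr g j)) UNIV" for j
    using Ck_on_nabla_y[OF f_C] Ck_on_nabla_y[OF constr_C] by (simp_all only: numeral_2_eq_2)
  then show ?thesis
    unfolding FJ_map_def[abs_def] Let_def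
    by (intro 1 Ck_on_Pair Ck_on_add Ck_on_sum Ck_on_scaleR Ck_on_vec if_C
        Ck_on_compose_linear[OF bounded_linear_FJ_point, where h = "nabla_y f"]
        Ck_on_compose_linear[OF bounded_linear_FJ_point, where h = "nabla_y (constr g _)"]
        Ck_on_linear[OF bounded_linear_FJ_nth] Ck_on_linear[OF bounded_linear_fst])
qed

definition FJ_map_deriv ::
  "'p set \<Rightarrow> real^'p \<Rightarrow> real \<times> (real^'m) \<Rightarrow> real \<times> real \<times> (real^'m) \<times> (real^'p) \<Rightarrow>
     real \<times> (real^'m) \<times> (real^'p)" where
  "FJ_map_deriv I ub z v = (let dt = fst v; dx = fst (snd v); dy = fst (snd (snd v)); du = snd (snd (snd v)) in
     (dt + (\<Sum>j\<in>I. du $ j),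
      dt *\<^sub>R nabla_y f z + (dx *\<^sub>R hess_xy (constr_comb ub g) z + dy v* hess_yy (constr_comb ub g) z)
        + (\<Sum>j\<in>I. du $ j *\<^sub>R nabla_y (constr g j) z),
      \<chi> j. if j \<in> I then dx * nabla_x (constr g j) z + nabla_y (constr g j) z \<bullet> dy else du $ j))"

lemma FJ_map_has_derivative:
  assumes "\<And>j. j \<notin> I \<Longrightarrow> ub $ j = 0"
  shows "(FJ_map I ub has_derivative FJ_map_deriv I ub (x, y)) (at (0, x, y, ub))"
proof -
  let ?p = "\<lambda>w::real \<times> real \<times> (real^'m) \<times> (real^'p). (fst (snd w), fst (snd (snd w)))"
  let ?w = "(0, x, y, ub)"
  have p: "(?p has_derivative ?p) (at ?w)"
    by (rule bounded_linear_imp_has_derivative[OF bounded_linear_FJ_point])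
  have supp: "(\<Sum>j\<in>UNIV. ub $ j *\<^sub>R k j) = (\<Sum>j\<in>I. ub $ j *\<^sub>R k j)" for k :: "'p \<Rightarrow> real^'m"
    by (rule sum.mono_neutral_right) (use assms in auto)
  \<comment> \<open>The same rewriting as for \<open>E_map\<close>. The Hessian of \<open>f\<close>
    drops out because its factor \<open>fst w\<close> is 0 at the base point.\<close>
  have E: "FJ_map I ub = (\<lambda>w. (fst w + (\<Sum>j\<in>I. snd (snd (snd w)) $ j) - 1,
      fst w *\<^sub>R nabla_y f (?p w) + nabla_y (constr_comb ub g) (?p w)
        + (\<Sum>j\<in>I. (snd (snd (snd w)) $ j - ub $ j) *\<^sub>R nabla_y (constr g j) (?p w)),
      \<chi> j. if j \<in> I then g (?p w) $ j else snd (snd (snd w)) $ j - ub $ j))"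
    by (rule ext) (simp add: FJ_map_def Let_def nabla_constr_comb[OF g_diff] supp scaleR_diff_left sum_subtractf)
  have p': "((\<lambda>w. h (?p w)) has_derivative (\<lambda>v. D (?p v))) (at ?w)"
    if "(h has_derivative D) (at (x, y))" for h :: "real \<times> (real^'m) \<Rightarrow> 'c::real_normed_vector" and D
    using has_derivative_compose[OF p, of h D] that by simp
  have u: "((\<lambda>w::real \<times> real \<times> (real^'m) \<times> (real^'p). snd (snd (snd w)) $ j - ub $ j) has_derivative (\<lambda>v. snd (snd (snd v)) $ j)) (at ?w)" for j
    using has_derivative_diff[OF bounded_linear_imp_has_derivative[OF bounded_linear_FJ_nth] has_derivative_const]
    by simp
  have 1: "((\<lambda>w. (snd (snd (snd w)) $ j - ub $ j) *\<^sub>R nabla_y (constr g j) (?p w)) has_derivative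
      (\<lambda>v. snd (snd (snd v)) $ j *\<^sub>R nabla_y (constr g j) (x, y))) (at ?w)" for j
    using has_derivative_scaleR[OF u p'[OF nabla_y_constr_deriv]] by simp
  have 2: "((\<lambda>w. (\<chi> j. if j \<in> I then g (?p w) $ j else snd (snd (snd w)) $ j - ub $ j)) has_derivative
     (\<lambda>v. \<chi> j. if j \<in> I then fst (snd v) * nabla_x (constr g j) (x, y) + nabla_y (constr g j) (x, y) \<bullet> fst (snd (snd v))
           else snd (snd (snd v)) $ j)) (at ?w)"
  proof (rule has_derivative_vecI)
    show "((\<lambda>w. (\<chi> j. if j \<in> I then g (?p w) $ j else snd (snd (snd w)) $ j - ub $ j) $ i) has_derivative
      (\<lambda>v. (\<chi> j. if j \<in> I then fst (snd v) * nabla_x (constr g j) (x, y) + nabla_y (constr g j) (x, y) \<bullet> fst (snd (snd v))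
           else snd (snd (snd v)) $ j) $ i)) (at ?w)" for i
      using p'[OF constr_deriv, of i] u by (cases "i \<in> I") simp_all
  qed
  have fst': "(fst has_derivative fst) (at ?w)"
    by (rule bounded_linear_imp_has_derivative[OF bounded_linear_fst])
  have 3: "((\<lambda>w. fst w *\<^sub>R nabla_y f (?p w)) has_derivative (\<lambda>v. fst v *\<^sub>R nabla_y f (x, y))) (at ?w)"
    using has_derivative_scaleR[OF fst' p'[OF nabla_y_f_deriv]] by simp
  have 4: "((\<lambda>w. fst w + (\<Sum>j\<in>I. snd (snd (snd w)) $ j) - 1) has_derivative
     (\<lambda>v. fst v + (\<Sum>j\<in>I. snd (snd (snd v)) $ j))) (at ?w)"
    using has_derivative_diff[OF has_derivative_add[OF fst' has_derivative_sum[of I,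
        OF bounded_linear_imp_has_derivative[OF bounded_linear_FJ_nth]]] has_derivative_const[of 1]]
    by simp
  show ?thesis
    unfolding E FJ_map_deriv_def[abs_def] Let_def
    using p'[OF nabla_y_comb_deriv[of ub]]
    by (intro has_derivative_Pair has_derivative_add has_derivative_sum 1 2 3 4) simp
qed

lemma FJ_branch_derivative:
  assumes br: "FJ_branch f g I xb yb ub x y v" and ub: "\<And>j. j \<notin> I \<Longrightarrow> ub $ j = 0"
    and z: "z = (xb, yb)"
  obtains x' y' v' where "(x has_real_derivative x') (at 0)" "(y has_vector_derivative y') (at 0)"
    "1 + (\<Sum>j\<in>I. v' j) = 0"
    "nabla_y f z + (x' *\<^sub>R hess_xy (constr_comb ub g) z + y' v* hess_yy (constr_comb ub g) z)
       + (\<Sum>j\<in>I. v' j *\<^sub>R nabla_y (constr g j) z) = 0"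
    "\<And>j. j \<in> I \<Longrightarrow> x' * nabla_x (constr g j) z + nabla_y (constr g j) z \<bullet> y' = 0"
proof -
  from br obtain N where y0: "x 0 = xb" "y 0 = yb" "\<And>j. j \<in> I \<Longrightarrow> v j 0 = ub $ j"
    and N: "open N" "0 \<in> N" and C: "Ck_on 2 x N" "Ck_on 2 y N" "\<And>j. j \<in> I \<Longrightarrow> Ck_on 2 (v j) N"
    and sol: "\<And>t. t \<in> N \<Longrightarrow> t *\<^sub>R nabla_y f (x t, y t) + (\<Sum>j\<in>I. v j t *\<^sub>R nabla_y (constr g j) (x t, y t)) = 0"
      "\<And>t. t \<in> N \<Longrightarrow> t + (\<Sum>j\<in>I. v j t) = 1"
      "\<And>t j. t \<in> N \<Longrightarrow> j \<in> I \<Longrightarrow> g (x t, y t) $ j = 0"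
    unfolding FJ_branch_def by blast
  define x' where "x' = vector_derivative x (at 0)"
  define y' where "y' = vector_derivative y (at 0)"
  define v' where "v' j = vector_derivative (v j) (at 0)" for j
  have x': "(x has_vector_derivative x') (at 0)"
    unfolding x'_def using C N by (intro Ck_on_curve_derivative[of 1]) (simp_all only: Suc_1)
  have y': "(y has_vector_derivative y') (at 0)"
    unfolding y'_def using C N by (intro Ck_on_curve_derivative[of 1]) (simp_all only: Suc_1)
  have v': "(v j has_vector_derivative v' j) (at 0)" if "j \<in> I" for j
    unfolding v'_def using C that N by (intro Ck_on_curve_derivative[of 1]) (simp_all only: Suc_1)
  let ?u = "\<lambda>t. \<chi> j. if j \<in> I then v j t else 0"
  let ?u' = "\<chi> j. if j \<in> I then v' j else 0"
  have "(?u has_derivative (\<lambda>h. h *\<^sub>R ?u')) (at 0)"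
  proof (rule has_derivative_vecI)
    show "((\<lambda>x. ?u x $ j) has_derivative (\<lambda>h. (h *\<^sub>R ?u') $ j)) (at 0)" for j
      using v' by (cases "j \<in> I") (simp_all add: has_vector_derivative_def)
  qed
  then have W: "((\<lambda>t. (x t, y t, ?u t)) has_vector_derivative (x', y', ?u')) (at 0)"
    by (intro has_vector_derivative_Pair x' y') (simp only: has_vector_derivative_def)
  have "(0, x 0, y 0, ?u 0) = (0, xb, yb, ub)"
    using y0 ub by (simp add: vec_eq_iff)
  then have GD: "(FJ_map I ub has_derivative FJ_map_deriv I ub z) (at (0, x 0, y 0, ?u 0))"
    using FJ_map_has_derivative[OF ub] z by simp
  have G0: "FJ_map I ub (t, x t, y t, ?u t) = 0" if "t \<in> N" for t
    using sol that ub by (simp add: FJ_map_eq_0_iff)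
  have "FJ_map_deriv I ub z (1, x', y', ?u') = 0"
    by (rule implicit_curve_derivative[OF N G0 W GD])
  then have *: "1 + (\<Sum>j\<in>I. v' j) = 0"
    "nabla_y f z + (x' *\<^sub>R hess_xy (constr_comb ub g) z + y' v* hess_yy (constr_comb ub g) z)
       + (\<Sum>j\<in>I. v' j *\<^sub>R nabla_y (constr g j) z) = 0"
    "\<forall>i. (if i \<in> I then x' * nabla_x (constr g i) z + nabla_y (constr g i) z \<bullet> y' else 0) = 0"
    by (simp_all add: FJ_map_deriv_def Let_def zero_prod_def vec_eq_iff cong: if_cong)
  have "(x has_real_derivative x') (at 0)"
    using x' by (simp add: has_real_derivative_iff_has_vector_derivative)
  from that[OF this y' *(1,2)] *(3) show ?thesis by metis
qed

text \<open>Pairing the linearised constraints with \<open>ub\<close> cancels the y-part and leaves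
  the nonzero slope times dx, so dx = 0. Regularity gives dy = 0. The remaining multiplier part is a
  multiple of \<open>ub\<close> with sum 0, while \<open>ub\<close> has sum 1.\<close>

lemma FJ_branch_exists:
  fixes xb :: real and yb :: "real^'m"
  defines "z \<equiv> (xb, yb)"
  assumes ub: "\<And>j. j \<notin> I \<Longrightarrow> ub $ j = 0"
    and stat: "(\<Sum>j\<in>I. ub $ j *\<^sub>R nabla_y (constr g j) z) = 0" and sum1: "(\<Sum>j\<in>I. ub $ j) = 1"
    and act: "\<And>j. j \<in> I \<Longrightarrow> g z $ j = 0"
    and kernel: "\<And>c. (\<Sum>j\<in>I. c j *\<^sub>R nabla_y (constr g j) z) = 0 \<Longrightarrow> \<exists>t. \<forall>j\<in>I. c j = t * ub $ j"
    and slope: "(\<Sum>j\<in>I. ub $ j * nabla_x (constr g j) z) \<noteq> 0"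
    and reg: "nonsingular_on (hess_yy (constr_comb ub g) z) (tangent g I z)"
  obtains x y v where "FJ_branch f g I xb yb ub x y v"
proof -
  let ?n = "\<lambda>j. nabla_y (constr g j) z"
  have 0: "FJ_map I ub (0, xb, yb, ub) = 0"
    using stat act sum1 by (simp add: FJ_map_eq_0_iff z_def)
  have inj: "v = 0" if v: "FJ_map_deriv I ub z (0, v) = 0" for v
  proof -
    let ?dx = "fst v" and ?dy = "fst (snd v)" and ?du = "snd (snd v)"
    have 1: "(\<Sum>j\<in>I. ?du $ j) = 0"
      and 2: "(?dx *\<^sub>R hess_xy (constr_comb ub g) z + ?dy v* hess_yy (constr_comb ub g) z)
        + (\<Sum>j\<in>I. ?du $ j *\<^sub>R ?n j) = 0"
      and 34: "\<forall>i. (if i \<in> I then ?dx * nabla_x (constr g i) z + ?n i \<bullet> ?dy else ?du $ i) = 0"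
      using v by (simp_all add: FJ_map_deriv_def Let_def zero_prod_def vec_eq_iff cong: if_cong)
    have 3: "?dx * nabla_x (constr g j) z + ?n j \<bullet> ?dy = 0" if "j \<in> I" for j
      using 34 that by metis
    have 4: "?du $ j = 0" if "j \<notin> I" for j using 34 that by metis
    have "0 = (\<Sum>j\<in>I. ub $ j * (?dx * nabla_x (constr g j) z + ?n j \<bullet> ?dy))" using 3 by simp
    also have "\<dots> = ?dx * (\<Sum>j\<in>I. ub $ j * nabla_x (constr g j) z) + (\<Sum>j\<in>I. ub $ j *\<^sub>R ?n j) \<bullet> ?dy"
      by (simp add: distrib_left sum.distrib sum_distrib_left inner_sum_left mult_ac)
    finally have dx: "?dx = 0" using stat slope by simp
    have dy: "?dy = 0"
    proof (rule saddle_injective[OF reg])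
      show "?dy \<in> tangent g I z" using 3 dx by (simp add: tangent_def)
      fix \<zeta> assume "\<zeta> \<in> tangent g I z"
      then have "(\<Sum>j\<in>I. ?du $ j *\<^sub>R ?n j) \<bullet> \<zeta> = 0"
        by (simp add: tangent_def inner_sum_left)
      then show "(?dy v* hess_yy (constr_comb ub g) z) \<bullet> \<zeta> = 0"
        using arg_cong[OF 2, of "\<lambda>a. a \<bullet> \<zeta>"] dx by (simp add: inner_add_left)
    qed
    have "(\<Sum>j\<in>I. ?du $ j *\<^sub>R ?n j) = 0" using 2 dx dy by simp
    from kernel[OF this] obtain t where t: "\<And>j. j \<in> I \<Longrightarrow> ?du $ j = t * ub $ j" by blast
    then have "t * (\<Sum>j\<in>I. ub $ j) = 0" using 1 by (simp add: sum_distrib_left)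
    then have "t = 0" using sum1 by simp
    then have "?du $ j = 0" for j using t[of j] 4[of j] by (cases "j \<in> I") simp_all
    with dx dy show "v = 0" by (simp add: prod_eq_iff vec_eq_iff)
  qed
  have der: "(FJ_map I ub has_derivative FJ_map_deriv I ub z) (at (0, xb, yb, ub))"
    unfolding z_def by (rule FJ_map_has_derivative[OF ub])
  obtain w N W where N: "open N" "0 \<in> N" and W: "open W" "(0, xb, yb, ub) \<in> W"
    and w0: "w 0 = (xb, yb, ub)" and wC: "Ck_on 2 w N"
    and sol: "\<And>t. t \<in> N \<Longrightarrow> FJ_map I ub (t, w t) = 0"
    and uniq: "\<And>t z. (t, z) \<in> W \<Longrightarrow> FJ_map I ub (t, z) = 0 \<Longrightarrow> t \<in> N \<and> z = w t"
    by (rule implicit_curve_C2[OF FJ_map_C2 0 der inj]) blast+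
  let ?x = "\<lambda>t. fst (w t)" and ?y = "\<lambda>t. fst (snd (w t))" and ?u = "\<lambda>j t. snd (snd (w t)) $ j"
  have sol': "t + (\<Sum>j\<in>I. ?u j t) = 1"
    "t *\<^sub>R nabla_y f (?x t, ?y t) + (\<Sum>j\<in>I. ?u j t *\<^sub>R nabla_y (constr g j) (?x t, ?y t)) = 0"
    "\<forall>j\<in>I. g (?x t, ?y t) $ j = 0" if "t \<in> N" for t
    using sol[OF that] FJ_map_eq_0_iff[of I ub t "?x t" "?y t" "snd (snd (w t))"] by simp_all
  have "FJ_branch f g I xb yb ub ?x ?y ?u"
    unfolding FJ_branch_def
  proof (intro conjI exI[of _ N] ballI N)
    show "Ck_on 2 ?x N"
      by (rule Ck_on_linear_compose[OF bounded_linear_fst N(1) wC])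
    show "Ck_on 2 ?y N"
      by (rule Ck_on_linear_compose[OF _ N(1) wC])
         (intro bounded_linear_compose[OF bounded_linear_fst] bounded_linear_snd)
    show "Ck_on 2 (?u j) N" for j
      by (rule Ck_on_linear_compose[OF _ N(1) wC])
         (intro bounded_linear_compose[OF bounded_linear_vec_nth] bounded_linear_compose[OF bounded_linear_snd] bounded_linear_snd)
  qed (use w0 sol' in auto)
  then show ?thesis by (rule that)
qed

text \<open>The same pairing shows that \<open>x\<close> is stationary along the curve, so
  \<open>F\<close> changes through \<open>y\<close> only, at a rate that the differentiated system
  evaluates as minus the product of the gradient of \<open>f\<close> with \<open>w\<close>.\<close>

lemma type4_equivalence:
  assumes lm: "local_minimizer f g xb yb" and z: "z = (xb, yb)" and J: "J = J0 g z"
    and T: "type4 f g xb yb"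
  shows "\<exists>u. FJ_multipliers f g z = {(0, u)} \<and>
        ((\<exists>w xi. star_system F g (constr_comb u g) z w xi \<and>
            nabla_y f z \<bullet> w \<le> 0 \<and> (\<forall>j\<in>J. nabla_y (constr g j) z \<bullet> w = 0)) \<longleftrightarrow>
         (\<exists>x y v. FJ_branch f g J xb yb u x y v \<and>
            nabla_x F z * deriv x 0 + nabla_y F z \<bullet> vector_derivative y (at 0) \<ge> 0))"
proof -
  let ?n = "\<lambda>j. nabla_y (constr g j) z"
  have feas: "feasible g xb yb" using lm by (simp add: local_minimizer_def)
  obtain lam :: "real^'p" and Bs C where rank: "dim (?n ` J) = card J - 1"
    and lam: "\<And>j. j \<notin> J \<Longrightarrow> lam $ j = 0" "(\<Sum>j\<in>J. lam $ j *\<^sub>R ?n j) = 0" "\<And>j. j \<in> J \<Longrightarrow> lam $ j \<noteq> 0"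
      "(\<Sum>j\<in>J. lam $ j * nabla_x (constr g j) z) \<noteq> 0"
    and Bs: "is_basis_of Bs (tangent g J z)"
      "matrix_inverse_on Bs (compression (hess_yy (constr_comb lam g) z)) C"
      "(\<Sum>b\<in>Bs. \<Sum>b'\<in>Bs. (b \<bullet> nabla_y f z) * C b b' * (b' \<bullet> nabla_y f z)) \<noteq> 0"
    using T unfolding type4_def Let_def z[symmetric] J[symmetric] by blast
  have kernel: "\<exists>t. \<forall>j\<in>J. c j = t * lam $ j" if "(\<Sum>j\<in>J. c j *\<^sub>R ?n j) = 0" for c
    by (rule corank_one_kernel[OF finite rank lam(2,3) that]) auto
  \<comment> \<open>Otherwise the gradient of \<open>f\<close> would be orthogonal to the tangent
    space, making the form of the inverse matrix 0. Hence the objective has weight 0 in every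
    FJ-multiplier.\<close>
  have f_notin: "nabla_y f z \<noteq> (\<Sum>j\<in>J. c j *\<^sub>R ?n j)" for c
  proof
    assume f: "nabla_y f z = (\<Sum>j\<in>J. c j *\<^sub>R ?n j)"
    have "b \<bullet> nabla_y f z = 0" if "b \<in> Bs" for b
    proof -
      have "b \<in> tangent g J z" using Bs(1) span_base[OF that] by (simp add: is_basis_of_def)
      then show ?thesis unfolding f by (simp add: inner_sum_right tangent_def inner_commute)
    qed
    then show False using Bs(3) by simp
  qed
  have FJ: "a = 0 \<and> (\<exists>t. t * (\<Sum>j\<in>J. lam $ j) = 1 \<and> v = t *\<^sub>R lam)"
    if "(a, v) \<in> FJ_multipliers f g z" for a v
  proof -
    note av = that[unfolded FJ_iff[OF feas z] J[symmetric]]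
    have a: "a = 0"
    proof (rule ccontr)
      assume a: "a \<noteq> 0"
      have "a *\<^sub>R nabla_y f z = - (\<Sum>j\<in>J. v $ j *\<^sub>R ?n j)"
        using av by (simp only: eq_neg_iff_add_eq_0)
      then have "(1 / a) *\<^sub>R (a *\<^sub>R nabla_y f z) = (1 / a) *\<^sub>R (- (\<Sum>j\<in>J. v $ j *\<^sub>R ?n j))"
        by (rule arg_cong)
      then have "nabla_y f z = (\<Sum>j\<in>J. (- (v $ j / a)) *\<^sub>R ?n j)"
        using a by (simp add: scaleR_sum_right sum_negf)
      then show False by (rule notE[OF f_notin])
    qed
    then have "(\<Sum>j\<in>J. v $ j *\<^sub>R ?n j) = 0" using av by simp
    from kernel[OF this] obtain t where t: "\<forall>j\<in>J. v $ j = t * lam $ j" by blast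
    have "v $ j = (t *\<^sub>R lam) $ j" for j
      using t av lam(1)[of j] by (cases "j \<in> J") simp_all
    then have "v = t *\<^sub>R lam" by (simp add: vec_eq_iff)
    moreover have "t * (\<Sum>j\<in>J. lam $ j) = 1" using av a t by (simp add: sum_distrib_left)
    ultimately show ?thesis using a by blast
  qed
  obtain a u where au: "(a, u) \<in> FJ_multipliers f g z" using FJ_exists[OF lm z] .
  from FJ[OF au] obtain t where a: "a = 0" and t: "t * (\<Sum>j\<in>J. lam $ j) = 1" "u = t *\<^sub>R lam" by blast
  have t0: "t \<noteq> 0" using t(1) by auto
  have FJ_eq: "FJ_multipliers f g z = {(0, u)}"
  proof -
    have "p = (0, u)" if p: "p \<in> FJ_multipliers f g z" for p
    proof -
      obtain a' v where p': "p = (a', v)" by (cases p)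
      from FJ[OF p[unfolded p']] obtain s where s: "a' = 0" "s * (\<Sum>j\<in>J. lam $ j) = 1" "v = s *\<^sub>R lam" by blast
      have "s = t" using s(2) t(1) by (metis mult_cancel_right mult_zero_right zero_neq_one)
      then show ?thesis using s t p' by simp
    qed
    then show ?thesis using au a by blast
  qed
  have u: "u $ j = 0" if "j \<notin> J" for j using lam(1)[OF that] t(2) by simp
  have u_stat: "(\<Sum>j\<in>J. u $ j *\<^sub>R ?n j) = 0"
  proof -
    have "(\<Sum>j\<in>J. u $ j *\<^sub>R ?n j) = t *\<^sub>R (\<Sum>j\<in>J. lam $ j *\<^sub>R ?n j)"
      by (simp add: t(2) scaleR_sum_right)
    then show ?thesis using lam(2) by simp
  qed
  have u_sum: "(\<Sum>j\<in>J. u $ j) = 1" using t by (simp add: sum_distrib_left)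
  have u_slope: "(\<Sum>j\<in>J. u $ j * nabla_x (constr g j) z) \<noteq> 0" (is "?\<kappa> \<noteq> 0")
  proof -
    have "?\<kappa> = t * (\<Sum>j\<in>J. lam $ j * nabla_x (constr g j) z)"
      by (simp add: t(2) sum_distrib_left mult.assoc)
    then show ?thesis using lam(4) t0 by simp
  qed
  have u_kernel: "\<exists>s. \<forall>j\<in>J. c j = s * u $ j" if c: "(\<Sum>j\<in>J. c j *\<^sub>R ?n j) = 0" for c
  proof -
    obtain s where "\<forall>j\<in>J. c j = s * lam $ j" using kernel[OF c] by blast
    then have "\<forall>j\<in>J. c j = s / t * u $ j" using t0 t(2) by simp
    then show ?thesis by blast
  qed
  let ?h = "hess_xy (constr_comb u g) z" and ?H = "hess_yy (constr_comb u g) z"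
  have "constr_comb u g = (\<lambda>w. t * (lam \<bullet> g w))" by (simp add: t(2))
  then have "?H = t *\<^sub>R hess_yy (constr_comb lam g) z"
    using hess_yy_scale[OF constr_comb_C] by simp
  moreover have "nonsingular_on (hess_yy (constr_comb lam g) z) (tangent g J z)"
    using Bs(1,2) by (auto simp: nonsingular_on_def)
  ultimately have reg: "nonsingular_on ?H (tangent g J z)"
    using nonsingular_on_scale[OF _ t0] by simp
  have val: "nabla_x F z * deriv x 0 + nabla_y F z \<bullet> vector_derivative y (at 0) = - (nabla_y f z \<bullet> w)"
    if br: "FJ_branch f g J xb yb u x y v"
      and b: "nabla_y F z = ?H *v w - (\<Sum>j\<in>UNIV. \<xi> $ j *\<^sub>R ?n j)"
      and w: "\<And>j. j \<in> J \<Longrightarrow> ?n j \<bullet> w = 0" and \<xi>: "\<And>j. j \<notin> J \<Longrightarrow> \<xi> $ j = 0"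
    for x y v w \<xi>
  proof -
    obtain x' y' v' where d: "(x has_real_derivative x') (at 0)" "(y has_vector_derivative y') (at 0)"
      and "1 + (\<Sum>j\<in>J. v' j) = 0" and e: "nabla_y f z + (x' *\<^sub>R ?h + y' v* ?H) + (\<Sum>j\<in>J. v' j *\<^sub>R ?n j) = 0"
      "\<And>j. j \<in> J \<Longrightarrow> x' * nabla_x (constr g j) z + ?n j \<bullet> y' = 0"
      by (rule FJ_branch_derivative[OF br u z]) blast+
    have "0 = (\<Sum>j\<in>J. u $ j * (x' * nabla_x (constr g j) z + ?n j \<bullet> y'))" using e(2) by simp
    also have "\<dots> = x' * ?\<kappa> + (\<Sum>j\<in>J. u $ j *\<^sub>R ?n j) \<bullet> y'"
      by (simp add: distrib_left sum.distrib sum_distrib_left inner_sum_left mult_ac)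
    finally have x0: "x' = 0" using u_stat u_slope by simp
    have "(\<Sum>j\<in>UNIV. \<xi> $ j * (?n j \<bullet> y')) = 0"
      using e(2) x0 \<xi> by (intro sum.neutral) (metis add_0 mult_zero_left mult_zero_right)
    then have "nabla_y F z \<bullet> y' = (y' v* ?H) \<bullet> w"
      unfolding b by (simp add: inner_diff_left inner_sum_left dot_lmul_matrix inner_commute[of "_ *v _"])
    moreover have "(\<Sum>j\<in>J. v' j *\<^sub>R ?n j) \<bullet> w = 0" using w by (simp add: inner_sum_left)
    then have "nabla_y f z \<bullet> w + (y' v* ?H) \<bullet> w = 0"
      using arg_cong[OF e(1), of "\<lambda>a. a \<bullet> w"] x0 by (simp add: inner_add_left)
    ultimately show ?thesis
      using x0 by (simp add: DERIV_imp_deriv[OF d(1)] vector_derivative_at[OF d(2)])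
  qed
  have "(\<exists>w xi. star_system F g (constr_comb u g) z w xi \<and>
            nabla_y f z \<bullet> w \<le> 0 \<and> (\<forall>j\<in>J. nabla_y (constr g j) z \<bullet> w = 0)) \<longleftrightarrow>
         (\<exists>x y v. FJ_branch f g J xb yb u x y v \<and>
            nabla_x F z * deriv x 0 + nabla_y F z \<bullet> vector_derivative y (at 0) \<ge> 0)" (is "?L \<longleftrightarrow> ?R")
  proof
    assume ?L
    then obtain w \<xi> where *: "star_system F g (constr_comb u g) z w \<xi>" "nabla_y f z \<bullet> w \<le> 0"
      "\<And>j. j \<in> J \<Longrightarrow> ?n j \<bullet> w = 0" by blast
    have act: "g (xb, yb) $ j = 0" if "j \<in> J" for j using that by (simp add: J J0_def z)
    obtain x y v where br: "FJ_branch f g J xb yb u x y v"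
      by (rule FJ_branch_exists[of J u xb yb, folded z, OF u u_stat u_sum act[folded z] u_kernel u_slope reg])
    have "nabla_y F z = ?H *v w - (\<Sum>j\<in>UNIV. \<xi> $ j *\<^sub>R ?n j)" "\<And>j. j \<notin> J \<Longrightarrow> \<xi> $ j = 0"
      using *(1) unfolding star_system_iff J by blast+
    from val[OF br this(1) *(3) this(2)] *(2) br show ?R by force
  next
    assume ?R
    then obtain x y v where br: "FJ_branch f g J xb yb u x y v"
      and pos: "nabla_x F z * deriv x 0 + nabla_y F z \<bullet> vector_derivative y (at 0) \<ge> 0" by blast
    obtain w \<xi>0 where s: "nabla_y F z = ?H *v w - (\<Sum>j\<in>UNIV. \<xi>0 $ j *\<^sub>R ?n j)"
      "\<And>j. j \<in> J \<Longrightarrow> ?n j \<bullet> w = 0" "\<And>j. j \<notin> J \<Longrightarrow> \<xi>0 $ j = 0"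
      by (rule dual_solution_active[OF reg]) blast
    \<comment> \<open>Adding \<open>r *\<^sub>R u\<close> to \<xi> leaves the y-equation intact,
      since the gradients weighted by \<open>u\<close> cancel, and changes the residual by
      \<open>r\<close> times the slope; this quotient cancels the residual.\<close>
    define r where "r = - (nabla_x F z - ?h \<bullet> w + (\<Sum>j\<in>UNIV. \<xi>0 $ j * nabla_x (constr g j) z)) / ?\<kappa>"
    define \<xi> where "\<xi> = \<xi>0 + r *\<^sub>R u"
    have \<xi>supp: "\<xi> $ j = 0" if "j \<notin> J" for j using s(3)[OF that] u[OF that] by (simp add: \<xi>_def)
    have "(\<Sum>j\<in>UNIV. \<xi> $ j *\<^sub>R ?n j) = (\<Sum>j\<in>UNIV. \<xi>0 $ j *\<^sub>R ?n j) + r *\<^sub>R (\<Sum>j\<in>UNIV. u $ j *\<^sub>R ?n j)"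
      by (simp add: \<xi>_def scaleR_add_left sum.distrib scaleR_sum_right)
    also have "(\<Sum>j\<in>UNIV. u $ j *\<^sub>R ?n j) = 0"
      using sum_support[of J u ?n] u u_stat by simp
    finally have b: "nabla_y F z = ?H *v w - (\<Sum>j\<in>UNIV. \<xi> $ j *\<^sub>R ?n j)" using s(1) by simp
    have "(\<Sum>j\<in>UNIV. u $ j * nabla_x (constr g j) z) = ?\<kappa>"
      using sum_support[of J u "\<lambda>j. nabla_x (constr g j) z"] u by simp
    then have "nabla_x (constr_comb \<xi> g) z = (\<Sum>j\<in>UNIV. \<xi>0 $ j * nabla_x (constr g j) z) + r * ?\<kappa>"
      by (simp add: nabla_constr_comb[OF g_diff] \<xi>_def distrib_right sum.distrib mult.assoc flip: sum_distrib_left)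
    then have "nabla_x F z - ?h \<bullet> w + nabla_x (constr_comb \<xi> g) z = 0"
      using u_slope by (simp add: r_def)
    then have "star_system F g (constr_comb u g) z w \<xi>"
      unfolding star_system_iff J[symmetric] using b \<xi>supp by blast
    moreover have "nabla_y f z \<bullet> w \<le> 0" using val[OF br b s(2) \<xi>supp] pos by simp
    ultimately show ?L using s(2) by blast
  qed
  then show ?thesis using FJ_eq by blast
qed

end

section \<open>Curves of local minimizers and the two-minimizer case\<close>

section \<open>Two global minimizers\<close>

text \<open>Turns a claim near a point into one about sequences, so that compactness can be applied
  to a sequence of counterexamples.\<close>

lemma eventually_at_by_sequences:
  fixes a :: "'a::metric_space"
  assumes "\<And>X. (\<And>n. X n \<noteq> a) \<Longrightarrow> (\<And>n. \<not> P (X n)) \<Longrightarrow> X \<longlonglongrightarrow> a \<Longrightarrow> False"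
  shows "eventually P (at a)"
proof (rule ccontr)
  assume "\<not> ?thesis"
  then have ex: "\<exists>x. x \<noteq> a \<and> dist x a < d \<and> \<not> P x" if "d > 0" for d
    using that by (auto simp: eventually_at)
  have "\<forall>n. \<exists>x. x \<noteq> a \<and> dist x a < inverse (real (Suc n)) \<and> \<not> P x"
    using ex by simp
  then obtain X where X: "\<And>n. X n \<noteq> a" "\<And>n. dist (X n) a < inverse (real (Suc n))" "\<And>n. \<not> P (X n)"
    by metis
  have "(\<lambda>n. dist (X n) a) \<longlonglongrightarrow> 0"
    by (rule tendsto_sandwich[OF _ _ tendsto_const LIMSEQ_inverse_real_of_nat])
       (use X(2) in \<open>auto intro!: always_eventually less_imp_le\<close>)
  then have "X \<longlonglongrightarrow> a" by (rule iffD2[OF tendsto_dist_iff])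
  from assms[OF X(1,3) this] show False .
qed

context lower_level
begin

lemma isCont_nabla_y_f: "isCont (nabla_y f) w"
  and isCont_nabla_y_constr: "isCont (nabla_y (constr g j)) w"
  by (rule has_derivative_continuous[OF nabla_y_f_deriv] has_derivative_continuous[OF nabla_y_constr_deriv])+

lemma E_branch_isCont:
  assumes "E_branch f g I xb yb u y v"
  shows "(y \<longlongrightarrow> yb) (at xb)"
proof -
  obtain N where N: "xb \<in> N" "Ck_on 2 y N" "y xb = yb"
    using assms by (auto simp: E_branch_def simp del: Ck_on.simps)
  have "(y has_vector_derivative vector_derivative y (at xb)) (at xb)"
    using N by (intro Ck_on_curve_derivative[of 1]) (simp_all only: Suc_1)
  then show ?thesis
    using has_vector_derivative_continuous[of y _ xb UNIV] N(3) by (simp add: isCont_def)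
qed

lemma E_branch_eventually_feasible:
  assumes br: "E_branch f g (J0 g z) xb yb u y v" and z: "z = (xb, yb)" and feas: "feasible g xb yb"
  shows "\<forall>\<^sub>F x in at xb. feasible g x (y x)"
  unfolding feasible_def
proof (rule eventually_all_finite)
  fix j
  show "\<forall>\<^sub>F x in at xb. g (x, y x) $ j \<le> 0"
  proof (cases "j \<in> J0 g z")
    case True
    obtain N where N: "open N" "xb \<in> N" "\<And>x. x \<in> N \<Longrightarrow> g (x, y x) $ j = 0"
      using br True unfolding E_branch_def by blast
    show ?thesis
      using eventually_at_in_open'[OF N(1,2)] by eventually_elim (simp add: N(3))
  next
    case False
    have "((\<lambda>x. g (x, y x) $ j) \<longlongrightarrow> g z $ j) (at xb)"
      unfolding z by (intro tendsto_intros isCont_tendsto_compose[OF g_isCont] E_branch_isCont[OF br])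
    moreover have "g z $ j < 0"
      using feas False by (simp add: feasible_def J0_def z less_le)
    ultimately have "\<forall>\<^sub>F x in at xb. g (x, y x) $ j < 0" by (rule order_tendstoD)
    then show ?thesis by (rule eventually_mono) simp
  qed
qed

text \<open>Minimise f(x, .) over the feasible points of a closed ball around \<open>yb\<close> that
  is too small to contain another global minimizer at \<open>xb\<close>. If the minimizers stayed on
  the sphere as x tends to \<open>xb\<close>, a limit point would be feasible and, compared with the
  points \<open>y x\<close>, no worse than \<open>yb\<close>, hence another global
  minimizer.\<close>

lemma local_minimizers_nearby:
  assumes sol: "yb \<in> Sol f g xb" and fin: "finite (Sol f g xb)"
    and cont: "(y \<longlongrightarrow> yb) (at xb)" and feas: "\<forall>\<^sub>F x in at xb. feasible g x (y x)"
    and e: "e > 0"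
  shows "\<forall>\<^sub>F x in at xb. \<exists>m. local_minimizer f g x m \<and> dist m yb < e"
proof -
  obtain d where d: "d > 0" "\<And>m. m \<in> Sol f g xb \<Longrightarrow> m \<noteq> yb \<Longrightarrow> d \<le> dist yb m"
    using finite_set_avoid[OF fin, of yb] by blast
  define r where "r = min e (d / 2)"
  have r: "r > 0" "r \<le> e" "r < d" using e d(1) by (auto simp: r_def)
  have "\<forall>\<^sub>F x in at xb. dist (y x) yb < r" using cont r(1) by (rule tendstoD)
  moreover have "\<forall>\<^sub>F x in at xb. feasible g x (y x) \<and> dist (y x) yb < r \<longrightarrow>
      (\<exists>m. local_minimizer f g x m \<and> dist m yb < r)"
  proof (rule eventually_at_by_sequences)
    fix X assume Xne: "\<And>n. X n \<noteq> xb" and X: "X \<longlonglongrightarrow> xb"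
      and neg: "\<And>n. \<not> (feasible g (X n) (y (X n)) \<and> dist (y (X n)) yb < r \<longrightarrow>
      (\<exists>m. local_minimizer f g (X n) m \<and> dist m yb < r))"
    let ?K = "\<lambda>n. cball yb r \<inter> {m. feasible g (X n) m}"
    have "\<exists>m\<in>?K n. \<forall>m'\<in>?K n. f (X n, m) \<le> f (X n, m')" for n
    proof (rule continuous_attains_inf)
      have "{m. feasible g (X n) m} = (\<Inter>j. {m. g (X n, m) $ j \<le> 0})"
        by (auto simp: feasible_def)
      moreover have "closed {m. g (X n, m) $ j \<le> 0}" for j
        by (intro closed_Collect_le continuous_intros continuous_at_imp_continuous_on ballI
            isCont_o2[OF _ g_isCont])
      ultimately show "compact (?K n)" by (intro compact_Int_closed) auto
      have "y (X n) \<in> ?K n" using neg[of n] by (simp add: dist_commute)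
      then show "?K n \<noteq> {}" by blast
      show "continuous_on (?K n) (\<lambda>m. f (X n, m))"
        by (intro continuous_at_imp_continuous_on ballI isCont_o2[OF _ f_isCont] continuous_intros)
    qed
    then obtain m where m: "\<And>n. m n \<in> ?K n" "\<And>n m'. m' \<in> ?K n \<Longrightarrow> f (X n, m n) \<le> f (X n, m')"
      by metis
    \<comment> \<open>A minimizer inside the open ball would be a local minimizer of the lower level
      problem itself, which \<open>neg\<close> excludes.\<close>
    have on_sphere: "dist (m n) yb = r" for n
    proof (rule ccontr)
      assume "dist (m n) yb \<noteq> r"
      then have lt: "dist (m n) yb < r" using m(1)[of n] by (simp add: dist_commute less_le)
      have "local_minimizer f g (X n) (m n)"
        unfolding local_minimizer_def
      proof (intro conjI exI[of _ "r - dist (m n) yb"] allI impI)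
        show "feasible g (X n) (m n)" using m(1)[of n] by simp
        show "0 < r - dist (m n) yb" using lt by simp
        fix m' assume *: "feasible g (X n) m' \<and> dist m' (m n) < r - dist (m n) yb"
        then have "dist m' yb < r" using dist_triangle[of m' yb "m n"] by simp
        then show "f (X n, m n) \<le> f (X n, m')"
          using * by (intro m(2)) (simp add: dist_commute)
      qed
      then show False using neg[of n] lt by blast
    qed
    have "\<forall>n. m n \<in> cball yb r" using m(1) by blast
    then obtain l s where s: "strict_mono s" and l: "(m \<circ> s) \<longlonglongrightarrow> l"
      using compact_cball[of yb r] unfolding compact_def by blast
    have Xs: "(\<lambda>n. X (s n)) \<longlonglongrightarrow> xb"
      using LIMSEQ_subseq_LIMSEQ[OF X s] by (simp add: o_def)
    have ls: "(\<lambda>n. m (s n)) \<longlonglongrightarrow> l" using l by (simp add: o_def)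
    have "(\<lambda>n. dist (m (s n)) yb) \<longlonglongrightarrow> dist l yb" by (intro tendsto_intros ls)
    then have lr: "dist l yb = r" by (simp add: on_sphere LIMSEQ_const_iff)
    have "g (xb, l) $ j \<le> 0" for j
    proof (rule tendsto_upperbound)
      show "(\<lambda>n. g (X (s n), m (s n)) $ j) \<longlonglongrightarrow> g (xb, l) $ j"
        by (intro tendsto_intros isCont_tendsto_compose[OF g_isCont] Xs ls)
      show "\<forall>\<^sub>F n in sequentially. g (X (s n), m (s n)) $ j \<le> 0"
        using m(1) by (auto simp: feasible_def)
    qed simp
    then have lf: "feasible g xb l" by (simp add: feasible_def)
    have "f (xb, l) \<le> f (xb, yb)"
    proof (rule tendsto_le)
      show "(\<lambda>n. f (X (s n), m (s n))) \<longlonglongrightarrow> f (xb, l)"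
        by (intro isCont_tendsto_compose[OF f_isCont] tendsto_intros Xs ls)
      have "filterlim (\<lambda>n. X (s n)) (at xb) sequentially"
        using Xs Xne by (simp add: filterlim_at)
      then have "(\<lambda>n. y (X (s n))) \<longlonglongrightarrow> yb" by (rule filterlim_compose[OF cont])
      then show "(\<lambda>n. f (X (s n), y (X (s n)))) \<longlonglongrightarrow> f (xb, yb)"
        by (intro isCont_tendsto_compose[OF f_isCont] tendsto_intros Xs)
      have "f (X n, m n) \<le> f (X n, y (X n))" for n
        using neg[of n] by (intro m(2)) (simp add: dist_commute)
      then show "\<forall>\<^sub>F n in sequentially. f (X (s n), m (s n)) \<le> f (X (s n), y (X (s n)))" by simp
    qed simp
    then have "l \<in> Sol f g xb"
      using sol lf unfolding Sol_def is_arg_min_linorder by force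
    moreover have "l \<noteq> yb" using lr r(1) by auto
    ultimately have "d \<le> dist yb l" by (rule d(2))
    then show False using lr r(3) by (simp add: dist_commute)
  qed
  ultimately show ?thesis
    using feas by eventually_elim (use r(2) in force)
qed

text \<open>
  Fritz John multipliers along the curve of local minimizers accumulate only at the unique multiplier \<open>u\<close>
  of the limit point. Hence they inherit strict complementarity, and the curve solves \<open>(E\<^sub>J)\<close>.
\<close>

lemma local_minimizer_curve_eq_branch:
  assumes z: "z = (xb, yb)" and licq: "LICQ g z" and kkt: "KKT_multipliers f g z = {u}"
    and nz: "\<And>j. j \<in> J0 g z \<Longrightarrow> u $ j \<noteq> 0"
    and sol: "yb \<in> Sol f g xb" and fin: "finite (Sol f g xb)"
    and br: "E_branch f g (J0 g z) xb yb u y v" and W: "open W" "(xb, yb, u) \<in> W"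
    and uniq: "\<And>x y' v. (x, y', v) \<in> W \<Longrightarrow> (\<And>j. j \<notin> J0 g z \<Longrightarrow> v $ j = 0) \<Longrightarrow>
       nabla_y f (x, y') + (\<Sum>j\<in>J0 g z. v $ j *\<^sub>R nabla_y (constr g j) (x, y')) = 0 \<Longrightarrow>
       (\<And>j. j \<in> J0 g z \<Longrightarrow> g (x, y') $ j = 0) \<Longrightarrow> y' = y x"
    and curve: "local_minimizer_curve f g xb yb yc"
  shows "\<forall>\<^sub>F x in at xb. yc x = y x"
proof -
  obtain N U where N: "open N" "xb \<in> N" and U: "open U" "yb \<in> U"
    and NU: "\<And>x. x \<in> N \<Longrightarrow> {v \<in> U. local_minimizer f g x v} = {yc x}"
    using curve by (auto simp: local_minimizer_curve_def)
  have feas: "feasible g xb yb" using Sol_local_minimizer[OF sol] by (simp add: local_minimizer_def)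
  \<comment> \<open>The definition of a local minimizer curve contains no continuity. It follows
    because local minimizers exist arbitrarily close to \<open>yb\<close>, and the curve runs
    through the only one in \<open>U\<close>.\<close>
  have lim: "(yc \<longlongrightarrow> yb) (at xb)"
  proof (rule tendstoI)
    fix e :: real assume e: "e > 0"
    obtain r where r: "r > 0" "ball yb r \<subseteq> U" using U open_contains_ball by blast
    have "\<forall>\<^sub>F x in at xb. \<exists>m. local_minimizer f g x m \<and> dist m yb < min e r"
      using e r(1) by (intro local_minimizers_nearby[OF sol fin E_branch_isCont[OF br]
          E_branch_eventually_feasible[OF br z feas]]) simp
    moreover have "\<forall>\<^sub>F x in at xb. x \<in> N" using eventually_at_in_open'[OF N] .
    ultimately show "\<forall>\<^sub>F x in at xb. dist (yc x) yb < e"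
    proof eventually_elim
      case (elim x)
      then obtain m where m: "local_minimizer f g x m" "dist m yb < min e r" by blast
      then have "m \<in> U" using r(2) by (auto simp: dist_commute)
      then have "m = yc x" using NU[OF elim(2)] m(1) by blast
      then show ?case using m(2) by simp
    qed
  qed
  have "\<forall>\<^sub>F x in at xb. x \<in> N \<longrightarrow> yc x = y x"
  proof (rule eventually_at_by_sequences)
    fix X assume Xne: "\<And>n. X n \<noteq> xb" and X: "X \<longlonglongrightarrow> xb" and neg: "\<And>n. \<not> (X n \<in> N \<longrightarrow> yc (X n) = y (X n))"
    have lm: "local_minimizer f g (X n) (yc (X n))" for n
      using NU[of "X n"] neg[of n] by blast
    have feasn: "feasible g (X n) (yc (X n))" for n using lm by (simp add: local_minimizer_def)
    have "\<exists>p. p \<in> FJ_multipliers f g (X n, yc (X n))" for n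
      using FJ_exists[OF lm refl] by metis
    then obtain p where p: "\<And>n. p n \<in> FJ_multipliers f g (X n, yc (X n))" by metis
    define a where "a n = fst (p n)" for n
    define w where "w n = snd (p n)" for n
    have pn: "(a n, w n) \<in> FJ_multipliers f g (X n, yc (X n))" for n
      using p by (simp add: a_def w_def)
    note FJn = pn[unfolded FJ_iff[OF feasn refl]]
    \<comment> \<open>The normalisation confines the multipliers to a compact set.\<close>
    have box: "(a n, w n) \<in> {0..1} \<times> cbox 0 1" for n
    proof -
      have "(\<Sum>j\<in>J0 g (X n, yc (X n)). w n $ j) \<ge> 0" using FJn[of n] by (intro sum_nonneg) auto
      moreover have "w n $ j \<le> 1" for j
      proof (cases "j \<in> J0 g (X n, yc (X n))")
        case True
        then have "w n $ j \<le> (\<Sum>j\<in>J0 g (X n, yc (X n)). w n $ j)"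
          using FJn[of n] by (intro member_le_sum) auto
        then show ?thesis using FJn[of n] by linarith
      qed (use FJn[of n] in simp)
      ultimately show ?thesis using FJn[of n] by (auto simp: mem_box_cart)
    qed
    have "compact ({0..1::real} \<times> cbox 0 (1::real^'p))" by (intro compact_Times compact_Icc compact_cbox)
    then obtain l s where s: "strict_mono s" and l: "((\<lambda>n. (a n, w n)) \<circ> s) \<longlonglongrightarrow> l"
      using box unfolding compact_def by (metis (no_types, lifting))
    have as: "(\<lambda>n. a (s n)) \<longlonglongrightarrow> fst l" and ws: "(\<lambda>n. w (s n)) \<longlonglongrightarrow> snd l"
      using tendsto_fst[OF l] tendsto_snd[OF l] by (simp_all add: o_def)
    have Xs: "(\<lambda>n. X (s n)) \<longlonglongrightarrow> xb" using LIMSEQ_subseq_LIMSEQ[OF X s] by (simp add: o_def)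
    have "filterlim (\<lambda>n. X (s n)) (at xb) sequentially"
      using Xs Xne by (simp add: filterlim_at)
    then have ys: "(\<lambda>n. yc (X (s n))) \<longlonglongrightarrow> yb" by (rule filterlim_compose[OF lim])
    let ?P = "\<lambda>n. (X (s n), yc (X (s n)))"
    have Ps: "?P \<longlonglongrightarrow> z" unfolding z by (intro tendsto_intros Xs ys)
    have FJs: "a (s n) \<ge> 0" "\<forall>i. w (s n) $ i \<ge> 0"
         "a (s n) *\<^sub>R nabla_y f (?P n) + (\<Sum>i\<in>UNIV. w (s n) $ i *\<^sub>R nabla_y (constr g i) (?P n)) = 0"
         "\<bar>a (s n)\<bar> + (\<Sum>i\<in>UNIV. \<bar>w (s n) $ i\<bar>) = 1" "w (s n) \<bullet> g (?P n) = 0" for n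
      using pn[of "s n"] by (auto simp: FJ_multipliers_def)
    have "(fst l, snd l) \<in> FJ_multipliers f g z"
      unfolding FJ_multipliers_def mem_Collect_eq case_prod_conv
    proof (intro conjI allI)
      show "0 \<le> fst l" by (rule LIMSEQ_le_const[OF as]) (use FJs(1) in blast)
      show "0 \<le> snd l $ i" for i
        by (rule LIMSEQ_le_const[OF tendsto_vec_nth[OF ws]]) (use FJs(2) in blast)
      have "(\<lambda>n. a (s n) *\<^sub>R nabla_y f (?P n) + (\<Sum>i\<in>UNIV. w (s n) $ i *\<^sub>R nabla_y (constr g i) (?P n)))
          \<longlonglongrightarrow> fst l *\<^sub>R nabla_y f z + (\<Sum>i\<in>UNIV. snd l $ i *\<^sub>R nabla_y (constr g i) z)"
        by (intro tendsto_intros as ws isCont_tendsto_compose[OF isCont_nabla_y_f]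
            isCont_tendsto_compose[OF isCont_nabla_y_constr] Ps)
      then show "fst l *\<^sub>R nabla_y f z + (\<Sum>i\<in>UNIV. snd l $ i *\<^sub>R nabla_y (constr g i) z) = 0"
        unfolding FJs(3) by (simp add: LIMSEQ_const_iff)
      have "(\<lambda>n. \<bar>a (s n)\<bar> + (\<Sum>i\<in>UNIV. \<bar>w (s n) $ i\<bar>)) \<longlonglongrightarrow> \<bar>fst l\<bar> + (\<Sum>i\<in>UNIV. \<bar>snd l $ i\<bar>)"
        by (intro tendsto_intros as ws)
      then show "\<bar>fst l\<bar> + (\<Sum>i\<in>UNIV. \<bar>snd l $ i\<bar>) = 1"
        unfolding FJs(4) by (simp add: LIMSEQ_const_iff)
      have "(\<lambda>n. w (s n) \<bullet> g (?P n)) \<longlonglongrightarrow> snd l \<bullet> g z"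
        by (intro tendsto_intros ws isCont_tendsto_compose[OF g_isCont] Ps)
      then show "snd l \<bullet> g z = 0"
        unfolding FJs(5) by (simp add: LIMSEQ_const_iff)
    qed
    then have l0: "fst l > 0" by (rule LICQ_FJ_pos[OF feas z licq])
    have lu: "(1 / fst l) *\<^sub>R snd l = u"
      using FJ_KKT[OF feas z \<open>(fst l, snd l) \<in> FJ_multipliers f g z\<close> l0] kkt by blast
    let ?u = "\<lambda>n. (1 / a (s n)) *\<^sub>R w (s n)"
    have us: "?u \<longlonglongrightarrow> u"
      unfolding lu[symmetric] using l0 by (intro tendsto_intros as ws) simp
    \<comment> \<open>\<open>nz\<close> excludes zero entries and the KKT condition negative ones.
      This positivity passes to the sequence by convergence.\<close>
    have upos: "u $ j > 0" if "j \<in> J0 g z" for j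
      using nz[OF that] kkt by (auto simp: KKT_multipliers_def less_le)
    have "\<forall>\<^sub>F n in sequentially. (X (s n), yc (X (s n)), ?u n) \<in> W"
      by (rule topological_tendstoD[OF _ W]) (intro tendsto_intros Xs ys us)
    moreover have "\<forall>\<^sub>F n in sequentially. a (s n) > 0" using as l0 by (rule order_tendstoD)
    moreover have "\<forall>\<^sub>F n in sequentially. \<forall>j. (j \<in> J0 g z \<longrightarrow> ?u n $ j > 0) \<and> (j \<notin> J0 g z \<longrightarrow> g (?P n) $ j < 0)"
    proof (rule eventually_all_finite)
      fix j
      show "\<forall>\<^sub>F n in sequentially. (j \<in> J0 g z \<longrightarrow> ?u n $ j > 0) \<and> (j \<notin> J0 g z \<longrightarrow> g (?P n) $ j < 0)"
      proof (cases "j \<in> J0 g z")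
        case True
        show ?thesis
          using order_tendstoD(1)[OF tendsto_vec_nth[OF us] upos[OF True]]
          by (rule eventually_mono) (simp add: True)
      next
        case False
        have "g z $ j < 0"
          using feas False by (simp add: feasible_def J0_def z less_le)
        moreover have "(\<lambda>n. g (?P n) $ j) \<longlonglongrightarrow> g z $ j"
          by (intro tendsto_intros isCont_tendsto_compose[OF g_isCont] Ps)
        ultimately have "\<forall>\<^sub>F n in sequentially. g (?P n) $ j < 0" by (intro order_tendstoD)
        then show ?thesis by (rule eventually_mono) (simp add: False)
      qed
    qed
    ultimately have "\<forall>\<^sub>F n in sequentially. False"
    proof eventually_elim
      case (elim n)
      have wz: "w (s n) $ j = 0" if "g (?P n) $ j \<noteq> 0" for j
        using FJn[of "s n"] that by (auto simp: J0_def)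
      \<comment> \<open>Complementarity at the nearby points works both ways: a positive multiplier
        forces its constraint to be active, and a negative constraint value forces its multiplier to
        be 0.\<close>
      have act: "g (?P n) $ j = 0" if "j \<in> J0 g z" for j
        using wz[of j] elim(3) that by force
      have inact: "?u n $ j = 0" if "j \<notin> J0 g z" for j
        using wz[of j] elim(3) that by force
      have "nabla_y f (?P n) + (\<Sum>j\<in>J0 g z. ?u n $ j *\<^sub>R nabla_y (constr g j) (?P n))
          = nabla_y f (?P n) + (\<Sum>j\<in>UNIV. ?u n $ j *\<^sub>R nabla_y (constr g j) (?P n))"
        using sum_support[of "J0 g z" "?u n" "\<lambda>j. nabla_y (constr g j) (?P n)"] inact by simp
      also have "\<dots> = (1 / a (s n)) *\<^sub>R (a (s n) *\<^sub>R nabla_y f (?P n) + (\<Sum>j\<in>UNIV. w (s n) $ j *\<^sub>R nabla_y (constr g j) (?P n)))"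
        using elim(2) by (simp add: scaleR_add_right scaleR_sum_right)
      also have "\<dots> = 0" by (simp only: FJs(3) scaleR_zero_right)
      finally have "yc (X (s n)) = y (X (s n))"
        using uniq[OF elim(1)] inact act by blast
      then show False using neg[of "s n"] by blast
    qed
    then show False by simp
  qed
  moreover have "\<forall>\<^sub>F x in at xb. x \<in> N" using eventually_at_in_open'[OF N] .
  ultimately show ?thesis by eventually_elim simp
qed

text \<open>The envelope formula: constraints with nonzero multiplier stay 0 on the branch, so the
  value changes at the rate of the x-derivative of the Lagrangian.\<close>

lemma E_branch_value_derivative:
  assumes br: "E_branch f g I xb yb u y v" and z: "z = (xb, yb)"
    and u: "\<And>j. j \<notin> I \<Longrightarrow> u $ j = 0" and kkt: "u \<in> KKT_multipliers f g z"
    and y': "(y has_vector_derivative y') (at xb)"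
    "\<And>j. j \<in> I \<Longrightarrow> nabla_x (constr g j) z + nabla_y (constr g j) z \<bullet> y' = 0"
  shows "nabla_y f z \<bullet> y' = (\<Sum>j\<in>UNIV. u $ j * nabla_x (constr g j) z)"
    and "((\<lambda>x. f (x, y x)) has_real_derivative nabla_x f z + (\<Sum>j\<in>UNIV. u $ j * nabla_x (constr g j) z)) (at xb)"
proof -
  have f: "nabla_y f z = - (\<Sum>j\<in>UNIV. u $ j *\<^sub>R nabla_y (constr g j) z)"
    using kkt by (simp add: KKT_multipliers_def eq_neg_iff_add_eq_0)
  have "0 = (\<Sum>j\<in>UNIV. u $ j * (nabla_x (constr g j) z + nabla_y (constr g j) z \<bullet> y'))"
    using u y'(2) by (intro sum.neutral[symmetric]) (metis mult_eq_0_iff)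
  also have "\<dots> = (\<Sum>j\<in>UNIV. u $ j * nabla_x (constr g j) z) + (\<Sum>j\<in>UNIV. u $ j *\<^sub>R nabla_y (constr g j) z) \<bullet> y'"
    by (simp add: distrib_left sum.distrib inner_sum_left)
  finally show fy: "nabla_y f z \<bullet> y' = (\<Sum>j\<in>UNIV. u $ j * nabla_x (constr g j) z)"
    by (simp add: f)
  have yx: "y xb = yb" using br by (simp add: E_branch_def)
  have 1: "((\<lambda>x. (x, y x)) has_derivative (\<lambda>h. (h, h *\<^sub>R y'))) (at xb)"
    using y'(1) by (intro has_derivative_Pair has_derivative_ident) (simp add: has_vector_derivative_def)
  have 2: "(f has_derivative (\<lambda>v. fst v * nabla_x f z + nabla_y f z \<bullet> snd v)) (at (xb, y xb))"
    unfolding yx z[symmetric] by (rule f_deriv)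
  from has_derivative_compose[OF 1 2]
  show "((\<lambda>x. f (x, y x)) has_real_derivative nabla_x f z + (\<Sum>j\<in>UNIV. u $ j * nabla_x (constr g j) z)) (at xb)"
    unfolding has_field_derivative_def
    by (rule back_subst[of "\<lambda>D. (_ has_derivative D) _"]) (simp add: fun_eq_iff fy algebra_simps)
qed

text \<open>By the envelope formula the derivative of \<open>F\<close> is the residual plus
  \<open>\<mu> * l2 * (L2 - L1)\<close>, where \<open>L1\<close> and \<open>L2\<close> are the
  slopes of the two value functions. The product of \<mu> and \<open>l2\<close> can be any
  nonnegative number, so only its sign matters.\<close>

lemma case_II_equivalence:
  assumes z: "z = (xb, yb)" and J: "J = J0 g z" and T: "case_II f g xb yb yb2"
  shows "\<exists>u1 u2. KKT_multipliers f g z = {u1} \<and> KKT_multipliers f g (xb, yb2) = {u2} \<and>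
        ((\<exists>l1 l2 w xi \<mu>. l1 \<ge> 0 \<and> l2 \<ge> 0 \<and> l1 + l2 = 1 \<and> \<mu> > 0 \<and>
            0 = nabla_x F z
                + \<mu> * (l1 * (nabla_x f z - nabla_x f z
                              - (\<Sum>i\<in>UNIV. u1 $ i * nabla_x (constr g i) z))
                     + l2 * (nabla_x f z - nabla_x f (xb, yb2)
                              - (\<Sum>i\<in>UNIV. u2 $ i * nabla_x (constr g i) (xb, yb2))))
                - hess_xy (lagr f g u1) z \<bullet> w + nabla_x (constr_comb xi g) z \<and>
            0 = nabla_y F z + \<mu> *\<^sub>R nabla_y f z
                - hess_yy (lagr f g u1) z *v w + nabla_y (constr_comb xi g) z \<and>
            (\<forall>i. i \<notin> J \<longrightarrow> xi $ i = 0) \<and>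
            (\<forall>j\<in>J. nabla_y (constr g j) z \<bullet> w = 0)) \<longleftrightarrow>
         (\<exists>y1 v1 y2 v2. E_branch f g J xb yb u1 y1 v1 \<and>
            E_branch f g (J0 g (xb, yb2)) xb yb2 u2 y2 v2 \<and>
            (deriv (\<lambda>x. f (x, y2 x) - f (x, y1 x)) xb > 0 \<longrightarrow> Fdot F xb yb y1 \<ge> 0) \<and>
            (deriv (\<lambda>x. f (x, y2 x) - f (x, y1 x)) xb < 0 \<longrightarrow> Fdot F xb yb y1 \<le> 0)))"
proof -
  define z2 where z2: "z2 = (xb, yb2)"
  define K where K: "K = J0 g z2"
  obtain c1 c2 D where Sol: "Sol f g xb = {yb, yb2}" and t1: "type1 f g xb yb" and t2: "type1 f g xb yb2"
    and c1: "local_minimizer_curve f g xb yb c1" and c2: "local_minimizer_curve f g xb yb2 c2"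
    and D: "((\<lambda>x. f (x, c2 x) - f (x, c1 x)) has_real_derivative D) (at xb)" "D \<noteq> 0"
    using T unfolding case_II_def by blast
  obtain u1 where licq1: "LICQ g z" and st1: "stationary_multiplier f g z u1"
    and nz1: "\<And>j. j \<in> J \<Longrightarrow> u1 $ j \<noteq> 0"
    and reg1: "nonsingular_on (hess_yy (lagr f g u1) z) (tangent g J z)"
    using t1 by (auto simp: type1_def z J)
  obtain u2 where licq2: "LICQ g z2" and st2: "stationary_multiplier f g z2 u2"
    and nz2: "\<And>j. j \<in> K \<Longrightarrow> u2 $ j \<noteq> 0"
    and reg2: "nonsingular_on (hess_yy (lagr f g u2) z2) (tangent g K z2)"
    using t2 by (auto simp: type1_def z2 K)
  have sol: "yb \<in> Sol f g xb" "yb2 \<in> Sol f g xb" "finite (Sol f g xb)" by (simp_all add: Sol)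
  have kkt1: "KKT_multipliers f g z = {u1}"
    by (rule LICQ_KKT[OF Sol_local_minimizer[OF sol(1)] z licq1 st1])
  have kkt2: "KKT_multipliers f g z2 = {u2}"
    by (rule LICQ_KKT[OF Sol_local_minimizer[OF sol(2)] z2 licq2 st2])
  have s1: "u1 $ j = 0" if "j \<notin> J" for j using st1 that J by (simp add: stationary_multiplier_def)
  have s2: "u2 $ j = 0" if "j \<notin> K" for j using st2 that K by (simp add: stationary_multiplier_def)
  define L1 where "L1 = nabla_x f z + (\<Sum>j\<in>UNIV. u1 $ j * nabla_x (constr g j) z)"
  define L2 where "L2 = nabla_x f z2 + (\<Sum>j\<in>UNIV. u2 $ j * nabla_x (constr g j) z2)"
  have val1: "((\<lambda>x. f (x, y x)) has_real_derivative L1) (at xb)" if br: "E_branch f g J xb yb u1 y v" for y v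
  proof -
    obtain y' where y': "(y has_vector_derivative y') (at xb)"
      "\<And>j. j \<in> J \<Longrightarrow> nabla_x (constr g j) z + nabla_y (constr g j) z \<bullet> y' = 0"
      using E_branch_derivative[OF br s1 z] by blast
    show ?thesis unfolding L1_def using kkt1
      by (intro E_branch_value_derivative(2)[OF br z s1 _ y']) auto
  qed
  have val2: "((\<lambda>x. f (x, y x)) has_real_derivative L2) (at xb)" if br: "E_branch f g K xb yb2 u2 y v" for y v
  proof -
    obtain y' where y': "(y has_vector_derivative y') (at xb)"
      "\<And>j. j \<in> K \<Longrightarrow> nabla_x (constr g j) z2 + nabla_y (constr g j) z2 \<bullet> y' = 0"
      using E_branch_derivative[OF br s2 z2] by blast
    show ?thesis unfolding L2_def using kkt2
      by (intro E_branch_value_derivative(2)[OF br z2 s2 _ y']) auto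
  qed
  have dval: "deriv (\<lambda>x. f (x, y2 x) - f (x, y1 x)) xb = L2 - L1"
    if "E_branch f g J xb yb u1 y1 v1" "E_branch f g K xb yb2 u2 y2 v2" for y1 v1 y2 v2
    by (rule DERIV_imp_deriv[OF DERIV_diff[OF val2[OF that(2)] val1[OF that(1)]]])
  obtain y1 v1 W1 where br1: "E_branch f g J xb yb u1 y1 v1" and W1: "open W1" "(xb, yb, u1) \<in> W1"
    and uniq1: "\<And>x y' v. (x, y', v) \<in> W1 \<Longrightarrow> (\<And>j. j \<notin> J \<Longrightarrow> v $ j = 0) \<Longrightarrow>
       nabla_y f (x, y') + (\<Sum>j\<in>J. v $ j *\<^sub>R nabla_y (constr g j) (x, y')) = 0 \<Longrightarrow>
       (\<And>j. j \<in> J \<Longrightarrow> g (x, y') $ j = 0) \<Longrightarrow> y' = y1 x"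
  proof (rule stationary_E_branch[OF z st1 equalityD1[OF J] s1 licq1[unfolded LICQ_def, folded J] reg1])
    fix y v W
    assume *: "E_branch f g J xb yb u1 y v" "open W" "(xb, yb, u1) \<in> W"
      "\<And>x y' v. (x, y', v) \<in> W \<Longrightarrow> (\<And>j. j \<notin> J \<Longrightarrow> v $ j = 0) \<Longrightarrow>
       nabla_y f (x, y') + (\<Sum>j\<in>J. v $ j *\<^sub>R nabla_y (constr g j) (x, y')) = 0 \<Longrightarrow>
       (\<And>j. j \<in> J \<Longrightarrow> g (x, y') $ j = 0) \<Longrightarrow> y' = y x"
    show thesis by (rule that[OF *])
  qed
  obtain y2 v2 W2 where br2: "E_branch f g K xb yb2 u2 y2 v2" and W2: "open W2" "(xb, yb2, u2) \<in> W2"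
    and uniq2: "\<And>x y' v. (x, y', v) \<in> W2 \<Longrightarrow> (\<And>j. j \<notin> K \<Longrightarrow> v $ j = 0) \<Longrightarrow>
       nabla_y f (x, y') + (\<Sum>j\<in>K. v $ j *\<^sub>R nabla_y (constr g j) (x, y')) = 0 \<Longrightarrow>
       (\<And>j. j \<in> K \<Longrightarrow> g (x, y') $ j = 0) \<Longrightarrow> y' = y2 x"
  proof (rule stationary_E_branch[OF z2 st2 equalityD1[OF K] s2 licq2[unfolded LICQ_def, folded K] reg2])
    fix y v W
    assume *: "E_branch f g K xb yb2 u2 y v" "open W" "(xb, yb2, u2) \<in> W"
      "\<And>x y' v. (x, y', v) \<in> W \<Longrightarrow> (\<And>j. j \<notin> K \<Longrightarrow> v $ j = 0) \<Longrightarrow>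
       nabla_y f (x, y') + (\<Sum>j\<in>K. v $ j *\<^sub>R nabla_y (constr g j) (x, y')) = 0 \<Longrightarrow>
       (\<And>j. j \<in> K \<Longrightarrow> g (x, y') $ j = 0) \<Longrightarrow> y' = y x"
    show thesis by (rule that[OF *])
  qed
  \<comment> \<open>Simplicity speaks about curves of minimizers, the claim about branches. They
    agree near \<open>xb\<close>, so the nonzero derivative carries over.\<close>
  have slope: "L2 - L1 \<noteq> 0"
  proof -
    have "\<forall>\<^sub>F x in at xb. c1 x = y1 x"
      by (rule local_minimizer_curve_eq_branch[OF z licq1 kkt1 nz1[unfolded J] sol(1,3) br1[unfolded J] W1 uniq1[unfolded J] c1])
    moreover have "\<forall>\<^sub>F x in at xb. c2 x = y2 x"
      by (rule local_minimizer_curve_eq_branch[OF z2 licq2 kkt2 nz2[unfolded K] sol(2,3) br2[unfolded K] W2 uniq2[unfolded K] c2])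
    ultimately have "\<forall>\<^sub>F x in at xb. f (x, c2 x) - f (x, c1 x) = f (x, y2 x) - f (x, y1 x)"
      by eventually_elim simp
    moreover have "c1 xb = y1 xb" "c2 xb = y2 xb"
      using c1 c2 br1 br2 by (simp_all add: local_minimizer_curve_def E_branch_def)
    ultimately have "\<forall>\<^sub>F x in nhds xb. f (x, c2 x) - f (x, c1 x) = f (x, y2 x) - f (x, y1 x)"
      by (simp add: eventually_nhds_conv_at)
    from DERIV_cong_ev[OF refl this refl] D(1)
    have "((\<lambda>x. f (x, y2 x) - f (x, y1 x)) has_real_derivative D) (at xb)" by simp
    from DERIV_unique[OF this DERIV_diff[OF val2[OF br2] val1[OF br1]]] D(2)
    show ?thesis by simp
  qed
  let ?n = "\<lambda>j. nabla_y (constr g j) z" and ?h = "hess_xy (lagr f g u1) z" and ?H = "hess_yy (lagr f g u1) z"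
  define S where "S l1 l2 = l1 * (nabla_x f z - nabla_x f z - (\<Sum>i\<in>UNIV. u1 $ i * nabla_x (constr g i) z))
       + l2 * (nabla_x f z - nabla_x f z2 - (\<Sum>i\<in>UNIV. u2 $ i * nabla_x (constr g i) z2))" for l1 l2
  have Fdot: "Fdot F xb yb y = (nabla_x F z + \<mu> * S l1 l2 - ?h \<bullet> w + nabla_x (constr_comb \<xi> g) z) + \<mu> * l2 * (L2 - L1)"
    if br: "E_branch f g J xb yb u1 y v" and l: "l1 + l2 = 1"
      and b: "nabla_y F z + \<mu> *\<^sub>R nabla_y f z = ?H *v w - (\<Sum>j\<in>UNIV. \<xi> $ j *\<^sub>R ?n j)"
      and w: "\<And>j. j \<in> J \<Longrightarrow> ?n j \<bullet> w = 0" and \<xi>: "\<And>j. j \<notin> J \<Longrightarrow> \<xi> $ j = 0"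
    for y v l1 l2 \<mu> w \<xi>
  proof -
    obtain y' v' where y': "(y has_vector_derivative y') (at xb)"
      "\<And>j. j \<in> J \<Longrightarrow> nabla_x (constr g j) z + nabla_y (constr g j) z \<bullet> y' = 0"
      and eq: "(nabla_x F z + \<mu> * S l1 l2) + (nabla_y F z + \<mu> *\<^sub>R nabla_y f z) \<bullet> y'
       = (nabla_x F z + \<mu> * S l1 l2 - ?h \<bullet> w + nabla_x (constr_comb \<xi> g) z)
       - (\<Sum>j\<in>J. v' j * (?n j \<bullet> w))
       - (\<Sum>j\<in>UNIV - J. \<xi> $ j * (nabla_x (constr g j) z + ?n j \<bullet> y'))"
      using KKT_E_branch_derivative[OF br s1 z b, of "nabla_x F z + \<mu> * S l1 l2"] by blast
    have fy: "nabla_y f z \<bullet> y' = L1 - nabla_x f z"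
      using E_branch_value_derivative(1)[OF br z s1 _ y'] kkt1 by (simp add: L1_def)
    have l1: "l1 = 1 - l2" using l by simp
    have S: "S l1 l2 = - (L1 - nabla_x f z) - l2 * (L2 - L1)"
      unfolding S_def L1_def L2_def l1 by (simp add: algebra_simps)
    have "\<mu> * S l1 l2 + \<mu> * (nabla_y f z \<bullet> y') = - (\<mu> * l2 * (L2 - L1))"
      unfolding fy S by (simp add: algebra_simps)
    moreover have "(nabla_x F z + \<mu> * S l1 l2) + (nabla_y F z + \<mu> *\<^sub>R nabla_y f z) \<bullet> y'
       = nabla_x F z + \<mu> * S l1 l2 - ?h \<bullet> w + nabla_x (constr_comb \<xi> g) z"
      unfolding eq using w \<xi> by simp
    ultimately show ?thesis
      unfolding Fdot_eq[OF y'(1) z] by (simp add: inner_add_left)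
  qed
  have b_iff: "0 = nabla_y F z + \<mu> *\<^sub>R nabla_y f z - ?H *v w + nabla_y (constr_comb \<xi> g) z \<longleftrightarrow>
      nabla_y F z + \<mu> *\<^sub>R nabla_y f z = ?H *v w - (\<Sum>j\<in>UNIV. \<xi> $ j *\<^sub>R ?n j)" for \<mu> w \<xi>
    unfolding nabla_constr_comb[OF g_diff] by (auto simp: algebra_simps)
  have "(\<exists>l1 l2 w xi \<mu>. l1 \<ge> 0 \<and> l2 \<ge> 0 \<and> l1 + l2 = 1 \<and> \<mu> > 0 \<and>
            0 = nabla_x F z + \<mu> * S l1 l2 - ?h \<bullet> w + nabla_x (constr_comb xi g) z \<and>
            0 = nabla_y F z + \<mu> *\<^sub>R nabla_y f z - ?H *v w + nabla_y (constr_comb xi g) z \<and>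
            (\<forall>i. i \<notin> J \<longrightarrow> xi $ i = 0) \<and> (\<forall>j\<in>J. ?n j \<bullet> w = 0)) \<longleftrightarrow>
         (\<exists>y1 v1 y2 v2. E_branch f g J xb yb u1 y1 v1 \<and> E_branch f g K xb yb2 u2 y2 v2 \<and>
            (deriv (\<lambda>x. f (x, y2 x) - f (x, y1 x)) xb > 0 \<longrightarrow> Fdot F xb yb y1 \<ge> 0) \<and>
            (deriv (\<lambda>x. f (x, y2 x) - f (x, y1 x)) xb < 0 \<longrightarrow> Fdot F xb yb y1 \<le> 0))" (is "?L \<longleftrightarrow> ?R")
  proof
    assume ?L
    then obtain l1 l2 w \<xi> \<mu> where l: "l2 \<ge> 0" "l1 + l2 = 1" "\<mu> > 0"
      and x: "0 = nabla_x F z + \<mu> * S l1 l2 - ?h \<bullet> w + nabla_x (constr_comb \<xi> g) z"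
      and b: "nabla_y F z + \<mu> *\<^sub>R nabla_y f z = ?H *v w - (\<Sum>j\<in>UNIV. \<xi> $ j *\<^sub>R ?n j)"
      and \<xi>: "\<And>j. j \<notin> J \<Longrightarrow> \<xi> $ j = 0" and w: "\<And>j. j \<in> J \<Longrightarrow> ?n j \<bullet> w = 0"
      unfolding b_iff by blast
    have "Fdot F xb yb y1 = \<mu> * l2 * (L2 - L1)"
      using Fdot[OF br1 l(2) b w \<xi>] x by simp
    moreover have "\<mu> * l2 \<ge> 0" using l by simp
    ultimately have "(L2 - L1 > 0 \<longrightarrow> Fdot F xb yb y1 \<ge> 0) \<and> (L2 - L1 < 0 \<longrightarrow> Fdot F xb yb y1 \<le> 0)"
      by (metis less_imp_le mult_nonneg_nonneg mult_nonneg_nonpos)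
    then have "(deriv (\<lambda>x. f (x, y2 x) - f (x, y1 x)) xb > 0 \<longrightarrow> Fdot F xb yb y1 \<ge> 0) \<and>
        (deriv (\<lambda>x. f (x, y2 x) - f (x, y1 x)) xb < 0 \<longrightarrow> Fdot F xb yb y1 \<le> 0)"
      unfolding dval[OF br1 br2] .
    then show ?R using br1 br2 by blast
  next
    assume ?R
    then obtain y v y2' v2' where br: "E_branch f g J xb yb u1 y v" "E_branch f g K xb yb2 u2 y2' v2'"
      and sg: "deriv (\<lambda>x. f (x, y2' x) - f (x, y x)) xb > 0 \<longrightarrow> Fdot F xb yb y \<ge> 0"
            "deriv (\<lambda>x. f (x, y2' x) - f (x, y x)) xb < 0 \<longrightarrow> Fdot F xb yb y \<le> 0" by blast
    define \<rho> where "\<rho> = Fdot F xb yb y / (L2 - L1)"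
    have \<rho>: "\<rho> \<ge> 0"
      using sg slope unfolding dval[OF br] \<rho>_def
      by (cases "L2 - L1 > 0") (auto intro!: divide_nonneg_pos divide_nonpos_neg)
    \<comment> \<open>Only the product of \<mu> and \<open>l2\<close> is prescribed, namely \<rho>.
      Adding 1 keeps \<mu> positive for \<rho> = 0 and the weight \<open>l2\<close> below 1.\<close>
    define \<mu> where "\<mu> = \<rho> + 1"
    define l2 where "l2 = \<rho> / \<mu>"
    have l: "\<mu> > 0" "l2 \<ge> 0" "1 - l2 \<ge> 0" "\<mu> * l2 = \<rho>"
      using \<rho> by (simp_all add: \<mu>_def l2_def field_simps)
    obtain w \<xi> where s: "nabla_y F z + \<mu> *\<^sub>R nabla_y f z = ?H *v w - (\<Sum>j\<in>UNIV. \<xi> $ j *\<^sub>R ?n j)"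
      "\<And>j. j \<in> J \<Longrightarrow> ?n j \<bullet> w = 0" "\<And>j. j \<notin> J \<Longrightarrow> \<xi> $ j = 0"
      by (rule dual_solution_active[OF reg1]) blast
    have "Fdot F xb yb y = (nabla_x F z + \<mu> * S (1 - l2) l2 - ?h \<bullet> w + nabla_x (constr_comb \<xi> g) z) + \<mu> * l2 * (L2 - L1)"
      by (rule Fdot[OF br(1) _ s]) simp
    moreover have "\<mu> * l2 * (L2 - L1) = Fdot F xb yb y" using l(4) slope by (simp add: \<rho>_def)
    ultimately have "0 = nabla_x F z + \<mu> * S (1 - l2) l2 - ?h \<bullet> w + nabla_x (constr_comb \<xi> g) z" by simp
    moreover have "(1 - l2) + l2 = 1" by simp
    ultimately show ?L
      unfolding b_iff using l(1-3) s by blast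
  qed
  then show ?thesis
    using kkt1 kkt2 unfolding S_def K z2 by blast
qed

end


section \<open>The theorem\<close>

theorem theorem6p3:
  fixes F f :: "real \<times> (real^'m) \<Rightarrow> real"
    and g :: "real \<times> (real^'m) \<Rightarrow> real^'p"
    and xb :: real and yb :: "real^'m"
    and z :: "real \<times> (real^'m)" and J :: "'p set"
  assumes "Ck_on 1 F UNIV" and "Ck_on 3 f UNIV" and "Ck_on 3 g UNIV"
    and "\<And>xh c. compact {(x, y). \<bar>x - xh\<bar> \<le> 1 \<and> f (x, y) \<le> c \<and> (\<forall>j. g (x, y) $ j \<le> 0)}"
    and "(xb, yb) \<in> BLPP_M f g"
    and "simple_at f g xb yb"
    and "z = (xb, yb)" and "J = J0 g z"
  shows "
    (Sol f g xb = {yb} \<and> type1 f g xb yb \<longrightarrow>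
      (\<exists>u. KKT_multipliers f g z = {u} \<and>
        ((\<exists>w xi. star_system F g (lagr f g u) z w xi \<and>
            (\<forall>j\<in>J. nabla_y (constr g j) z \<bullet> w = 0)) \<longleftrightarrow>
         (\<exists>y v. E_branch f g J xb yb u y v \<and> Fdot F xb yb y = 0)))) \<and>
    (Sol f g xb = {yb} \<and> type2 f g xb yb \<longrightarrow>
      (\<exists>u q. KKT_multipliers f g z = {u} \<and> {j \<in> J. u $ j = 0} = {q} \<and>
        ((\<exists>w xi. star_system F g (lagr f g u) z w xi \<and>
            (\<forall>j\<in>J - {q}. nabla_y (constr g j) z \<bullet> w = 0) \<and>
            nabla_y (constr g q) z \<bullet> w \<le> 0 \<and> xi $ q \<ge> 0) \<longleftrightarrow>
         (\<exists>yt ut yh uh. E_branch f g (J - {q}) xb yb u yt ut \<and> E_branch f g J xb yb u yh uh \<and>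
            (gdot g q xb yt > 0 \<longrightarrow> Fdot F xb yb yt \<le> 0 \<and> Fdot F xb yb yh \<ge> 0) \<and>
            (gdot g q xb yt < 0 \<longrightarrow> Fdot F xb yb yt \<ge> 0 \<and> Fdot F xb yb yh \<le> 0))))) \<and>
    (Sol f g xb = {yb} \<and> type4 f g xb yb \<longrightarrow>
      (\<exists>u. FJ_multipliers f g z = {(0, u)} \<and>
        ((\<exists>w xi. star_system F g (constr_comb u g) z w xi \<and>
            nabla_y f z \<bullet> w \<le> 0 \<and> (\<forall>j\<in>J. nabla_y (constr g j) z \<bullet> w = 0)) \<longleftrightarrow>
         (\<exists>x y v. FJ_branch f g J xb yb u x y v \<and>
            nabla_x F z * deriv x 0 + nabla_y F z \<bullet> vector_derivative y (at 0) \<ge> 0)))) \<and>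
    (Sol f g xb = {yb} \<and> type5_1 f g xb yb \<longrightarrow>
      (\<exists>u q. type5_1_data f g z u q \<and>
        ((\<exists>xi. star5_system F g z xi \<and> xi $ q \<ge> 0) \<longleftrightarrow>
         (\<exists>yq uq. E_branch f g (J - {q}) xb yb u yq uq \<and>
            (gdot g q xb yq > 0 \<longrightarrow> Fdot F xb yb yq \<le> 0) \<and>
            (gdot g q xb yq < 0 \<longrightarrow> Fdot F xb yb yq \<ge> 0))))) \<and>
    (Sol f g xb = {yb} \<and> type5_2 f g xb yb \<longrightarrow>
      (\<exists>q r u1 u2. type5_2_data f g z q r u1 u2 \<and>
        (\<forall>q' r' u1' u2'. type5_2_data f g z q' r' u1' u2' \<longrightarrow> {q', r'} = {q, r}) \<and>
        ((\<forall>u\<in>KKT_multipliers f g z. \<exists>xi. star5_system F g z xi \<and>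
            (u = u1 \<longrightarrow> xi $ q \<ge> 0) \<and> (u = u2 \<longrightarrow> xi $ r \<ge> 0)) \<longleftrightarrow>
         (\<exists>yq uq yr ur.
            E_branch f g (J - {q}) xb yb u1 yq uq \<and> E_branch f g (J - {r}) xb yb u2 yr ur \<and>
            (let \<gamma>q = sgn (gdot g q xb yq); \<gamma>r = sgn (gdot g r xb yr) in
              (\<gamma>q > 0 \<longleftrightarrow> \<gamma>r < 0) \<and> (\<gamma>q < 0 \<longleftrightarrow> \<gamma>r > 0) \<and>
              (\<gamma>q > 0 \<longrightarrow> Fdot F xb yb yq \<le> 0 \<and> Fdot F xb yb yr \<ge> 0) \<and>
              (\<gamma>q < 0 \<longrightarrow> Fdot F xb yb yq \<ge> 0 \<and> Fdot F xb yb yr \<le> 0)))))) \<and>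
    (\<forall>yb2. case_II f g xb yb yb2 \<longrightarrow>
      (\<exists>u1 u2. KKT_multipliers f g z = {u1} \<and> KKT_multipliers f g (xb, yb2) = {u2} \<and>
        ((\<exists>l1 l2 w xi \<mu>. l1 \<ge> 0 \<and> l2 \<ge> 0 \<and> l1 + l2 = 1 \<and> \<mu> > 0 \<and>
            0 = nabla_x F z
                + \<mu> * (l1 * (nabla_x f z - nabla_x f z
                              - (\<Sum>i\<in>UNIV. u1 $ i * nabla_x (constr g i) z))
                     + l2 * (nabla_x f z - nabla_x f (xb, yb2)
                              - (\<Sum>i\<in>UNIV. u2 $ i * nabla_x (constr g i) (xb, yb2))))
                - hess_xy (lagr f g u1) z \<bullet> w + nabla_x (constr_comb xi g) z \<and>
            0 = nabla_y F z + \<mu> *\<^sub>R nabla_y f z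
                - hess_yy (lagr f g u1) z *v w + nabla_y (constr_comb xi g) z \<and>
            (\<forall>i. i \<notin> J \<longrightarrow> xi $ i = 0) \<and>
            (\<forall>j\<in>J. nabla_y (constr g j) z \<bullet> w = 0)) \<longleftrightarrow>
         (\<exists>y1 v1 y2 v2. E_branch f g J xb yb u1 y1 v1 \<and>
            E_branch f g (J0 g (xb, yb2)) xb yb2 u2 y2 v2 \<and>
            (deriv (\<lambda>x. f (x, y2 x) - f (x, y1 x)) xb > 0 \<longrightarrow> Fdot F xb yb y1 \<ge> 0) \<and>
            (deriv (\<lambda>x. f (x, y2 x) - f (x, y1 x)) xb < 0 \<longrightarrow> Fdot F xb yb y1 \<le> 0)))))"
proof -
  interpret lower_level f g
    by unfold_locales (rule assms(2,3))+
  note z = assms(7) and J = assms(8)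
  have lm: "local_minimizer f g xb yb"
    using assms(5) by (intro Sol_local_minimizer) (simp add: BLPP_M_def)
  note 1 = type1_equivalence[OF lm z J, of F] and 2 = type2_equivalence[OF lm z J, of F]
    and 4 = type4_equivalence[OF lm z J, of F] and II = case_II_equivalence[OF z J, of _ F]
  have 51: "type5 f g xb yb" "\<not> MFCQ g z" "KKT_multipliers f g z \<noteq> {}" if "type5_1 f g xb yb"
    using that unfolding type5_1_def z by blast+
  note 51 = type5_1_equivalence[OF z J 51, of F]
  have 52: "type5 f g xb yb" "MFCQ g z" if "type5_2 f g xb yb"
    using that unfolding type5_2_def z by blast+
  note 52 = type5_2_equivalence[OF z J 52(1) lm 52(2), of F]
  show ?thesis
    by (intro conjI)
       ((rule impI, erule conjE, (rule 1 2 4 51 52; assumption)) | (intro allI impI, rule II, assumption))+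
qed

end
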